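(* Let $A$ and $B$ be unital $C^*$-algebras and let $\theta: A\otimes^\gamma B \to A\otimes^\gamma B$ be a mapping. (i) $\theta$ is an isometric automorphism if and only if either $\theta = \phi\otimes^\gamma\psi$ for some isometric isomorphisms $\phi: A\to A$ and $\psi: B\to B$, or $\theta = (\mu\otimes^\gamma\rho)\circ\tau$ for some isometric isomorphisms $\mu: B\to A$ and $\rho: A\to B$. (ii) $\theta$ is an isometric $*$-automorphism if and only if either $\theta = \phi\otimes^\gamma\psi$ for some $*$-isomorphisms $\phi: A\to A$ and $\psi: B\to B$, or $\theta = (\mu\otimes^\gamma\rho)\circ\tau$ for some $*$-isomorphisms $\mu: B\to A$ and $\rho: A\to B$. Here $\tau: A\otimes^\gamma B\to B\otimes^\gamma A$ is the flip map given by $\tau(x\otimes y)=y\otimes x$.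
   Context: For Banach spaces $X, Y$, $X\otimes^\gamma Y$ denotes the Banach space projective tensor product, i.e. the completion of the algebraic tensor product $X\otimes Y$ in the norm $\|u\| = \inf\{\sum_{i=1}^n \|x_i\|\|y_i\| : u=\sum_{i=1}^n x_i\otimes y_i\}$. For $C^*$-algebras $A,B$, $A\otimes^\gamma B$ is a Banach $*$-algebra with $(a\otimes b)(c\otimes d)=ac\otimes bd$ and $(a\otimes b)^*=a^*\otimes b^*$. Automorphisms and isomorphisms are (bijective, linear, multiplicative) algebra automorphisms and isomorphisms; a $*$-automorphism or $*$-isomorphism additionally preserves the involution. For isometric isomorphisms $\phi_i: A_i\to B_i$ ($i=1,2$) of Banach algebras, $\phi_1\otimes^\gamma\phi_2: A_1\otimes^\gamma A_2\to B_1\otimes^\gamma B_2$ denotes the unique continuous linear extension of $x\otimes y\mapsto \phi_1(x)\otimes\phi_2(y)$. The map $\tau$ is likewise the continuous linear extension of the given formula on elementary tensors. *)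

theory Defs
  imports "HOL-Analysis.Analysis"
begin

section \<open>Complex normed algebras with involution\<close>

class scaleC =
  fixes scaleC :: "complex \<Rightarrow> 'a \<Rightarrow> 'a"  (infixr "*\<^sub>C" 75)

text \<open>The complex structure extends the real one of the library, so that the library's
  real normed spaces and algebras are available on every complex one.\<close>

class complex_vector = real_vector + scaleC +
  assumes scaleC_add_right: "c *\<^sub>C (x + y) = c *\<^sub>C x + c *\<^sub>C y"
    and scaleC_add_left: "(c + d) *\<^sub>C x = c *\<^sub>C x + d *\<^sub>C x"
    and scaleC_scaleC: "c *\<^sub>C (d *\<^sub>C x) = (c * d) *\<^sub>C x"
    and scaleR_scaleC: "r *\<^sub>R x = complex_of_real r *\<^sub>C x"

class complex_normed_vector = complex_vector + real_normed_vector +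
  assumes norm_scaleC: "norm (c *\<^sub>C x) = cmod c * norm x"

class complex_banach = complex_normed_vector + banach

class complex_algebra = complex_vector + real_algebra +
  assumes mult_scaleC_left: "(c *\<^sub>C x) * y = c *\<^sub>C (x * y)"
    and mult_scaleC_right: "x * (c *\<^sub>C y) = c *\<^sub>C (x * y)"

class complex_normed_algebra = complex_algebra + complex_normed_vector + real_normed_algebra

class star =
  fixes star :: "'a \<Rightarrow> 'a"

class complex_star_algebra = complex_algebra + star +
  assumes star_star: "star (star x) = x"
    and star_add: "star (x + y) = star x + star y"
    and star_scaleC: "star (c *\<^sub>C x) = cnj c *\<^sub>C star x"
    and star_mult: "star (x * y) = star y * star x"

class complex_normed_star_algebra = complex_star_algebra + complex_normed_algebra +
  assumes norm_star: "norm (star x) = norm x"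

class banach_star_algebra = complex_normed_star_algebra + complex_banach

class cstar_algebra = banach_star_algebra +
  assumes cstar_identity: "norm (star x * x) = (norm x)\<^sup>2"

text \<open>The unit is that of \<^class>\<open>monoid_mult\<close> and not of \<^class>\<open>real_normed_algebra_1\<close>,
  so the zero algebra is not excluded.\<close>

class unital_cstar_algebra = cstar_algebra + monoid_mult

lemma scaleC_one: "1 *\<^sub>C x = (x :: 'a :: complex_vector)"
  using scaleR_scaleC[of 1 x] by simp

lemma scaleC_zero_left: "0 *\<^sub>C x = (0 :: 'a :: complex_vector)"
  using scaleR_scaleC[of 0 x] by simp

lemma scaleC_zero_right: "c *\<^sub>C 0 = (0 :: 'a :: complex_vector)"
  using scaleC_add_right[of c 0 0] by simp

lemma scaleC_minus_left: "(-1) *\<^sub>C x = - (x :: 'a :: complex_vector)"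
  using scaleR_scaleC[of "-1" x] by simp

lemma scaleC_minus_right: "c *\<^sub>C (- x) = - (c *\<^sub>C (x :: 'a :: complex_vector))"
  using scaleC_add_right[of c x "- x"]
  by (simp add: scaleC_zero_right eq_neg_iff_add_eq_0 add.commute)

lemma scaleC_diff_right: "c *\<^sub>C (x - y) = c *\<^sub>C x - c *\<^sub>C (y :: 'a :: complex_vector)"
  using scaleC_add_right[of c x "- y"] by (simp add: scaleC_minus_right)

lemma star_zero: "star 0 = (0 :: 'a :: complex_star_algebra)"
  using star_add[of 0 "0 :: 'a"] by simp

lemma star_minus: "star (- x) = - star (x :: 'a :: complex_star_algebra)"
  using star_add[of x "- x"] by (simp add: star_zero eq_neg_iff_add_eq_0 add.commute)

lemma star_diff: "star (x - y) = star x - star (y :: 'a :: complex_star_algebra)"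
  using star_add[of x "- y"] by (simp add: star_minus)


section \<open>The algebraic tensor product\<close>

text \<open>A list \<open>[(x\<^sub>1, y\<^sub>1), \<dots>, (x\<^sub>n, y\<^sub>n)]\<close> stands for the formal sum of the \<open>x\<^sub>i \<otimes> y\<^sub>i\<close>. The relation
  below is the congruence on the free commutative monoid over the pairs that is generated by
  the bilinearity relations.\<close>

inductive tensor_eq ::
  "('a::complex_vector \<times> 'b::complex_vector) list \<Rightarrow> ('a \<times> 'b) list \<Rightarrow> bool" where
  refl: "tensor_eq xs xs"
| sym: "tensor_eq xs ys \<Longrightarrow> tensor_eq ys xs"
| trans: "tensor_eq xs ys \<Longrightarrow> tensor_eq ys zs \<Longrightarrow> tensor_eq xs zs"
| append: "tensor_eq xs xs' \<Longrightarrow> tensor_eq ys ys' \<Longrightarrow> tensor_eq (xs @ ys) (xs' @ ys')"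
| comm: "tensor_eq (xs @ ys) (ys @ xs)"
| add_left: "tensor_eq [(x + x', y)] [(x, y), (x', y)]"
| add_right: "tensor_eq [(x, y + y')] [(x, y), (x, y')]"
| scale: "tensor_eq [(c *\<^sub>C x, y)] [(x, c *\<^sub>C y)]"
| zero: "tensor_eq [(0, y)] []"

quotient_type (overloaded) ('a, 'b) atensor = "('a::complex_vector \<times> 'b::complex_vector) list" / tensor_eq
  by (rule equivpI) (auto intro!: reflpI sympI transpI intro: tensor_eq.intros(1-3))

lemma tensor_eq_map:
  fixes f :: "'a::complex_vector \<Rightarrow> 'c::complex_vector" and g :: "'b::complex_vector \<Rightarrow> 'd::complex_vector"
  assumes f: "\<And>x y. f (x + y) = f x + f y" and g: "\<And>x y. g (x + y) = g x + g y"
    and s: "\<And>c x y. tensor_eq [(f (c *\<^sub>C x), g y)] [(f x, g (c *\<^sub>C y))]"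
    and eq: "tensor_eq xs ys"
  shows "tensor_eq (map (map_prod f g) xs) (map (map_prod f g) ys)"
proof -
  have f0: "f 0 = 0" using f[of 0 0] by simp
  show ?thesis
    using eq by induction
      (auto simp: f g f0 intro: tensor_eq.intros(1) tensor_eq.sym tensor_eq.append tensor_eq.comm
         tensor_eq.add_left tensor_eq.add_right s tensor_eq.zero intro: tensor_eq.trans)
qed

lemma tensor_eq_negate:
  "tensor_eq (map (map_prod uminus id) xs @ xs) ([] :: ('a::complex_vector \<times> 'b::complex_vector) list)"
proof (induction xs)
  case Nil
  show ?case by (simp add: tensor_eq.refl)
next
  case (Cons p xs)
  obtain x y where p: "p = (x, y)" by fastforce
  let ?m = "map (map_prod uminus id) xs"
  have 1: "tensor_eq [(- x, y), (x, y)] []"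
    using tensor_eq.trans[OF tensor_eq.sym[OF tensor_eq.add_left[of "- x" x y]]] tensor_eq.zero[of y]
    by simp
  have "tensor_eq ([(- x, y)] @ (?m @ [(x, y)]) @ xs) ([(- x, y)] @ ([(x, y)] @ ?m) @ xs)"
    by (intro tensor_eq.append tensor_eq.comm tensor_eq.refl)
  also have "[(- x, y)] @ ([(x, y)] @ ?m) @ xs = [(- x, y), (x, y)] @ (?m @ xs)" by simp
  finally have "tensor_eq ([(- x, y)] @ (?m @ [(x, y)]) @ xs) ([(- x, y), (x, y)] @ (?m @ xs))" .
  moreover have "tensor_eq ([(- x, y), (x, y)] @ (?m @ xs)) ([] @ [])"
    using 1 Cons.IH by (rule tensor_eq.append)
  ultimately have "tensor_eq ([(- x, y)] @ (?m @ [(x, y)]) @ xs) ([] @ [])"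
    by (rule tensor_eq.trans)
  then show ?case by (simp add: p id_def)
qed

instantiation atensor :: (complex_vector, complex_vector) complex_vector
begin

lift_definition zero_atensor :: "('a, 'b) atensor" is "[]" .

lift_definition plus_atensor :: "('a, 'b) atensor \<Rightarrow> ('a, 'b) atensor \<Rightarrow> ('a, 'b) atensor"
  is "(@)" by (rule tensor_eq.append)

lift_definition uminus_atensor :: "('a, 'b) atensor \<Rightarrow> ('a, 'b) atensor"
  is "map (map_prod uminus id)"
  by (rule tensor_eq_map)
     (auto simp: scaleC_minus_right[symmetric] intro: tensor_eq.scale)

definition minus_atensor :: "('a, 'b) atensor \<Rightarrow> ('a, 'b) atensor \<Rightarrow> ('a, 'b) atensor"
  where "minus_atensor u v = u + - v"

lift_definition scaleC_atensor :: "complex \<Rightarrow> ('a, 'b) atensor \<Rightarrow> ('a, 'b) atensor"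
  is "\<lambda>c. map (map_prod (scaleC c) id)"
proof (rule tensor_eq_map)
  fix c d and x :: 'a and y :: 'b
  show "tensor_eq [(c *\<^sub>C d *\<^sub>C x, id y)] [(c *\<^sub>C x, id (d *\<^sub>C y))]"
    using tensor_eq.scale[of d "c *\<^sub>C x" y] by (simp add: scaleC_scaleC mult.commute)
qed (auto simp: scaleC_add_right)

definition scaleR_atensor :: "real \<Rightarrow> ('a, 'b) atensor \<Rightarrow> ('a, 'b) atensor"
  where "scaleR_atensor r u = complex_of_real r *\<^sub>C u"

instance
proof -
  have comm: "u + v = v + u" for u v :: "('a, 'b) atensor"
    by transfer (rule tensor_eq.comm)
  have addC: "c *\<^sub>C (u + v) = c *\<^sub>C u + c *\<^sub>C v" for c and u v :: "('a, 'b) atensor"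
    by transfer (simp add: tensor_eq.refl)
  have CC: "c *\<^sub>C d *\<^sub>C u = (c * d) *\<^sub>C u" for c d and u :: "('a, 'b) atensor"
    by transfer (simp add: tensor_eq.refl prod.map_comp o_def id_def scaleC_scaleC)
  have one: "1 *\<^sub>C u = u" for u :: "('a, 'b) atensor"
  proof transfer
    fix xs :: "('a \<times> 'b) list"
    have "map_prod (scaleC 1) id = (id :: 'a \<times> 'b \<Rightarrow> 'a \<times> 'b)"
      by (auto simp: fun_eq_iff scaleC_one)
    then show "tensor_eq (map (map_prod (scaleC 1) id) xs) xs"
      by (simp add: tensor_eq.refl)
  qed
  have Cadd: "(c + d) *\<^sub>C u = c *\<^sub>C u + d *\<^sub>C u" for c d and u :: "('a, 'b) atensor"
  proof transfer
    fix c d and xs :: "('a \<times> 'b) list"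
    let ?f = "\<lambda>c. map (map_prod (scaleC c) (id :: 'b \<Rightarrow> 'b))"
    show "tensor_eq (?f (c + d) xs) (?f c xs @ ?f d xs)"
    proof (induction xs)
      case Nil
      show ?case by (simp add: tensor_eq.refl)
    next
      case (Cons p xs)
      obtain x y where p: "p = (x, y)" by fastforce
      have "tensor_eq ([((c + d) *\<^sub>C x, y)] @ ?f (c + d) xs)
              ([(c *\<^sub>C x, y), (d *\<^sub>C x, y)] @ (?f c xs @ ?f d xs))"
        using tensor_eq.add_left[of "c *\<^sub>C x" "d *\<^sub>C x" y]
        by (intro tensor_eq.append Cons.IH) (simp only: scaleC_add_left)
      also have "\<dots> = [(c *\<^sub>C x, y)] @ ([(d *\<^sub>C x, y)] @ ?f c xs) @ ?f d xs" by simp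
      finally have 1: "tensor_eq ([((c + d) *\<^sub>C x, y)] @ ?f (c + d) xs)
        ([(c *\<^sub>C x, y)] @ ([(d *\<^sub>C x, y)] @ ?f c xs) @ ?f d xs)" .
      have "tensor_eq ([(c *\<^sub>C x, y)] @ ([(d *\<^sub>C x, y)] @ ?f c xs) @ ?f d xs)
         ([(c *\<^sub>C x, y)] @ (?f c xs @ [(d *\<^sub>C x, y)]) @ ?f d xs)"
        by (intro tensor_eq.append tensor_eq.refl tensor_eq.comm)
      from tensor_eq.trans[OF 1 this] show ?case by (simp add: p id_def)
    qed
  qed
  show "OFCLASS(('a, 'b) atensor, complex_vector_class)"
  proof
    fix u v w :: "('a, 'b) atensor" and r s :: real and c d :: complex
    show "u + v + w = u + (v + w)" by transfer (simp add: tensor_eq.refl)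
    show "u + v = v + u" by (rule comm)
    show "0 + u = u" by transfer (simp add: tensor_eq.refl)
    show "- u + u = 0" by transfer (rule tensor_eq_negate)
    show "u - v = u + - v" by (rule minus_atensor_def)
    show "c *\<^sub>C (u + v) = c *\<^sub>C u + c *\<^sub>C v" by (rule addC)
    show "(c + d) *\<^sub>C u = c *\<^sub>C u + d *\<^sub>C u" by (rule Cadd)
    show "c *\<^sub>C (d *\<^sub>C u) = (c * d) *\<^sub>C u" by (rule CC)
    show "r *\<^sub>R u = complex_of_real r *\<^sub>C u" by (rule scaleR_atensor_def)
    show "r *\<^sub>R (u + v) = r *\<^sub>R u + r *\<^sub>R v" by (simp add: scaleR_atensor_def addC)
    show "(r + s) *\<^sub>R u = r *\<^sub>R u + s *\<^sub>R u" by (simp add: scaleR_atensor_def Cadd)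
    show "r *\<^sub>R s *\<^sub>R u = (r * s) *\<^sub>R u" by (simp add: scaleR_atensor_def CC)
    show "1 *\<^sub>R u = u" by (simp add: scaleR_atensor_def one)
  qed
qed

end

lift_definition elem_tensor :: "'a::complex_vector \<Rightarrow> 'b::complex_vector \<Rightarrow> ('a, 'b) atensor"
    (infixr "\<otimes>\<^sub>a" 75)
  is "\<lambda>x y. [(x, y)]" .

lemma elem_tensor_add_left: "(x + x') \<otimes>\<^sub>a y = x \<otimes>\<^sub>a y + x' \<otimes>\<^sub>a y"
  by transfer (simp add: tensor_eq.add_left)

lemma elem_tensor_add_right: "x \<otimes>\<^sub>a (y + y') = x \<otimes>\<^sub>a y + x \<otimes>\<^sub>a y'"
  by transfer (simp add: tensor_eq.add_right)

lemma elem_tensor_scaleC_left: "(c *\<^sub>C x) \<otimes>\<^sub>a y = c *\<^sub>C (x \<otimes>\<^sub>a y)"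
  by transfer (simp add: tensor_eq.refl)

lemma elem_tensor_scaleC_right: "x \<otimes>\<^sub>a (c *\<^sub>C y) = c *\<^sub>C (x \<otimes>\<^sub>a y)"
  unfolding elem_tensor_scaleC_left[symmetric] by transfer (rule tensor_eq.sym, rule tensor_eq.scale)

lemma abs_atensor_eq_sum: "abs_atensor xs = (\<Sum>(x, y)\<leftarrow>xs. x \<otimes>\<^sub>a y)"
proof (induction xs)
  case Nil
  show ?case by (simp add: zero_atensor_def)
next
  case (Cons p xs)
  obtain x y where p: "p = (x, y)" by fastforce
  have "abs_atensor (p # xs) = x \<otimes>\<^sub>a y + abs_atensor xs"
    by (simp add: p elem_tensor.abs_eq plus_atensor.abs_eq)
  then show ?case by (simp add: p Cons.IH)
qed

lemma atensor_eq_sum: "\<exists>xs. u = (\<Sum>(x, y)\<leftarrow>xs. x \<otimes>\<^sub>a y)"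
  by (metis Quotient_abs_rep Quotient_atensor abs_atensor_eq_sum)

lemma atensor_induct [case_names zero add]:
  assumes "P 0" and "\<And>x y u. P u \<Longrightarrow> P (x \<otimes>\<^sub>a y + u)"
  shows "P u"
proof -
  have "P (\<Sum>(x, y)\<leftarrow>xs. x \<otimes>\<^sub>a y)" for xs
    using assms by (induction xs) auto
  then show ?thesis using atensor_eq_sum[of u] by metis
qed

text \<open>The universal property: balanced maps into abelian groups factor through the algebraic
  tensor product.\<close>

definition balanced :: "('a::complex_vector \<Rightarrow> 'b::complex_vector \<Rightarrow> 'c::ab_group_add) \<Rightarrow> bool" where
  "balanced h \<longleftrightarrow> (\<forall>x x' y. h (x + x') y = h x y + h x' y) \<and>
     (\<forall>x y y'. h x (y + y') = h x y + h x y') \<and> (\<forall>c x y. h (c *\<^sub>C x) y = h x (c *\<^sub>C y))"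

lemma balanced_tensor_eq:
  assumes h: "balanced h" and "tensor_eq xs ys"
  shows "(\<Sum>(x, y)\<leftarrow>xs. h x y) = (\<Sum>(x, y)\<leftarrow>ys. h x y)"
proof -
  have "h 0 y = 0" for y
    using h unfolding balanced_def by (metis add_cancel_right_right)
  with assms(2) show ?thesis
    by induction (use h in \<open>auto simp: balanced_def add.commute\<close>)
qed

lemma balanced_factor:
  fixes h :: "'a::complex_vector \<Rightarrow> 'b::complex_vector \<Rightarrow> 'c::ab_group_add"
  assumes h: "balanced h"
  obtains f where "\<And>u v. f (u + v) = f u + f v" and "\<And>x y. f (x \<otimes>\<^sub>a y) = h x y"
proof
  define f where "f u = (\<Sum>(x, y)\<leftarrow>rep_atensor u. h x y)" for u
  have f: "f (abs_atensor xs) = (\<Sum>(x, y)\<leftarrow>xs. h x y)" for xs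
    unfolding f_def
    by (rule balanced_tensor_eq[OF h])
       (metis Quotient_abs_rep Quotient_atensor atensor.abs_eq_iff)
  show "f (x \<otimes>\<^sub>a y) = h x y" for x y
    by (simp add: elem_tensor.abs_eq f)
  show "f (u + v) = f u + f v" for u v
  proof -
    obtain xs ys where "u = abs_atensor xs" "v = abs_atensor ys"
      using atensor_eq_sum by (metis abs_atensor_eq_sum)
    then show ?thesis by (simp add: f plus_atensor.abs_eq)
  qed
qed

lemma balanced_elem_mult:
  "balanced (\<lambda>c d. (a * c) \<otimes>\<^sub>a (b * d))" for a :: "'a::complex_algebra" and b :: "'b::complex_algebra"
  by (simp add: balanced_def distrib_left mult_scaleC_right elem_tensor_add_left elem_tensor_add_right
      elem_tensor_scaleC_left elem_tensor_scaleC_right)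

lemma balanced_sum_elem_mult:
  fixes ys :: "('a::complex_algebra \<times> 'b::complex_algebra) list"
  shows "balanced (\<lambda>a b. \<Sum>(c, d)\<leftarrow>ys. (a * c) \<otimes>\<^sub>a (b * d))"
  by (induction ys)
     (auto simp: balanced_def distrib_right mult_scaleC_left elem_tensor_add_left elem_tensor_add_right
      elem_tensor_scaleC_left elem_tensor_scaleC_right)

lemma abs_atensor_mult:
  fixes xs ys :: "('a::complex_algebra \<times> 'b::complex_algebra) list"
  shows "abs_atensor [(a * c, b * d). (a, b) \<leftarrow> xs, (c, d) \<leftarrow> ys] =
    (\<Sum>(a, b)\<leftarrow>xs. \<Sum>(c, d)\<leftarrow>ys. (a * c) \<otimes>\<^sub>a (b * d))"
proof (induction xs)
  case Nil
  show ?case by (simp add: abs_atensor_eq_sum)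
next
  case (Cons p xs)
  obtain a b where p: "p = (a, b)" by fastforce
  have "(\<Sum>(x, y)\<leftarrow>[(a * c, b * d). (c, d) \<leftarrow> ys]. x \<otimes>\<^sub>a y) = (\<Sum>(c, d)\<leftarrow>ys. (a * c) \<otimes>\<^sub>a (b * d))"
    by (induction ys) auto
  with Cons show ?case by (simp add: p abs_atensor_eq_sum)
qed

instantiation atensor :: (complex_algebra, complex_algebra) ring
begin

lift_definition times_atensor :: "('a, 'b) atensor \<Rightarrow> ('a, 'b) atensor \<Rightarrow> ('a, 'b) atensor"
  is "\<lambda>xs ys. [(a * c, b * d). (a, b) \<leftarrow> xs, (c, d) \<leftarrow> ys]"
proof -
  fix xs xs' ys ys' :: "('a \<times> 'b) list"
  assume xs: "tensor_eq xs xs'" and ys: "tensor_eq ys ys'"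
  have "(\<Sum>(a, b)\<leftarrow>xs. \<Sum>(c, d)\<leftarrow>ys. (a * c) \<otimes>\<^sub>a (b * d)) =
      (\<Sum>(a, b)\<leftarrow>xs'. \<Sum>(c, d)\<leftarrow>ys'. (a * c) \<otimes>\<^sub>a (b * d))"
    unfolding balanced_tensor_eq[OF balanced_elem_mult ys]
    by (rule balanced_tensor_eq[OF balanced_sum_elem_mult xs])
  then show "tensor_eq [(a * c, b * d). (a, b) \<leftarrow> xs, (c, d) \<leftarrow> ys]
      [(a * c, b * d). (a, b) \<leftarrow> xs', (c, d) \<leftarrow> ys']"
    unfolding abs_atensor_mult[symmetric] atensor.abs_eq_iff .
qed

instance
proof
  fix u v w :: "('a, 'b) atensor"
  have L: "(u + v) * w = u * w + v * w" for u v w :: "('a, 'b) atensor"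
    by transfer (simp add: tensor_eq.refl)
  have R: "u * (v + w) = u * v + u * w" for u v w :: "('a, 'b) atensor"
  proof -
    obtain xs ys zs where "u = abs_atensor xs" "v = abs_atensor ys" "w = abs_atensor zs"
      using atensor_eq_sum by (metis abs_atensor_eq_sum)
    then show ?thesis
      by (simp only: plus_atensor.abs_eq times_atensor.abs_eq abs_atensor_mult)
         (simp add: case_prod_unfold sum_list_addf)
  qed
  have E: "(a \<otimes>\<^sub>a b) * (c \<otimes>\<^sub>a d) = (a * c) \<otimes>\<^sub>a (b * d)" for a c :: 'a and b d :: 'b
    by transfer (simp add: tensor_eq.refl)
  have Z: "0 * w = 0" "w * 0 = 0" for w :: "('a, 'b) atensor"
    using L[of 0 0 w] R[of w 0 0] by simp_all
  show "(u + v) * w = u * w + v * w" by (rule L)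
  show "u * (v + w) = u * v + u * w" by (rule R)
  have 1: "((a \<otimes>\<^sub>a b) * (c \<otimes>\<^sub>a d)) * w = (a \<otimes>\<^sub>a b) * ((c \<otimes>\<^sub>a d) * w)" for a c :: 'a and b d :: 'b
    by (induction w rule: atensor_induct) (simp_all add: Z R E mult.assoc)
  have 2: "((a \<otimes>\<^sub>a b) * v) * w = (a \<otimes>\<^sub>a b) * (v * w)" for a :: 'a and b :: 'b
    by (induction v rule: atensor_induct) (simp_all add: Z R L 1)
  show "u * v * w = u * (v * w)"
    by (induction u rule: atensor_induct) (simp_all add: Z L 2)
qed

end

lemma elem_tensor_mult: "(a \<otimes>\<^sub>a b) * (c \<otimes>\<^sub>a d) = (a * c) \<otimes>\<^sub>a (b * d)"
  by transfer (simp add: tensor_eq.refl)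

instance atensor :: (complex_algebra, complex_algebra) complex_algebra
proof
  fix u v :: "('a, 'b) atensor" and c :: complex and r :: real
  have 1: "(c *\<^sub>C (a \<otimes>\<^sub>a b)) * v = c *\<^sub>C ((a \<otimes>\<^sub>a b) * v)" for c v and a :: 'a and b :: 'b
    by (induction v rule: atensor_induct)
       (simp_all add: distrib_left scaleC_add_right scaleC_zero_right elem_tensor_mult
          mult_scaleC_left flip: elem_tensor_scaleC_left)
  have L: "(c *\<^sub>C u) * v = c *\<^sub>C (u * v)" for c and u v :: "('a, 'b) atensor"
    by (induction u rule: atensor_induct)
       (simp_all add: distrib_right scaleC_add_right scaleC_zero_right 1)
  have 2: "(a \<otimes>\<^sub>a b) * (c *\<^sub>C v) = c *\<^sub>C ((a \<otimes>\<^sub>a b) * v)" for c v and a :: 'a and b :: 'b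
  proof (induction v rule: atensor_induct)
    case (add x y u)
    have "(a \<otimes>\<^sub>a b) * (c *\<^sub>C (x \<otimes>\<^sub>a y)) = c *\<^sub>C ((a \<otimes>\<^sub>a b) * (x \<otimes>\<^sub>a y))"
      by (simp add: elem_tensor_mult mult_scaleC_right flip: elem_tensor_scaleC_left)
    with add show ?case by (simp add: distrib_left scaleC_add_right)
  qed (simp add: scaleC_zero_right)
  have R: "u * (c *\<^sub>C v) = c *\<^sub>C (u * v)" for c and u v :: "('a, 'b) atensor"
    by (induction u rule: atensor_induct)
       (simp_all add: distrib_right scaleC_add_right scaleC_zero_right 2)
  show "(c *\<^sub>C u) * v = c *\<^sub>C (u * v)" by (rule L)
  show "u * (c *\<^sub>C v) = c *\<^sub>C (u * v)" by (rule R)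
  show "(r *\<^sub>R u) * v = r *\<^sub>R (u * v)" by (simp add: scaleR_scaleC L)
  show "u * (r *\<^sub>R v) = r *\<^sub>R (u * v)" by (simp add: scaleR_scaleC R)
qed

instantiation atensor :: (complex_star_algebra, complex_star_algebra) complex_star_algebra
begin

lift_definition star_atensor :: "('a, 'b) atensor \<Rightarrow> ('a, 'b) atensor"
  is "map (map_prod star star)"
  by (rule tensor_eq_map) (auto simp: star_add star_scaleC intro: tensor_eq.scale)

instance
proof
  fix u v :: "('a, 'b) atensor" and c :: complex
  have E: "star (a \<otimes>\<^sub>a b) = star a \<otimes>\<^sub>a star b" for a :: 'a and b :: 'b
    by transfer (simp add: tensor_eq.refl)
  have A: "star (u + v) = star u + star v" for u v :: "('a, 'b) atensor"
    by transfer (simp add: tensor_eq.refl)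
  have Z: "star 0 = (0 :: ('a, 'b) atensor)"
    by transfer (simp add: tensor_eq.refl)
  show "star (u + v) = star u + star v" by (rule A)
  show "star (star u) = u"
    by (induction u rule: atensor_induct) (simp_all add: Z A E star_star)
  have S: "star (c *\<^sub>C (a \<otimes>\<^sub>a b)) = cnj c *\<^sub>C (star (a \<otimes>\<^sub>a b))" for a :: 'a and b :: 'b
    by (simp add: E star_scaleC flip: elem_tensor_scaleC_left)
  show "star (c *\<^sub>C u) = cnj c *\<^sub>C star u"
    by (induction u rule: atensor_induct) (simp_all add: Z A S scaleC_add_right scaleC_zero_right)
  have M: "star ((a \<otimes>\<^sub>a b) * v) = star v * star (a \<otimes>\<^sub>a b)" for a :: 'a and b :: 'b
    by (induction v rule: atensor_induct)
       (simp_all add: Z A E elem_tensor_mult star_mult distrib_left distrib_right)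
  show "star (u * v) = star v * star u"
    by (induction u rule: atensor_induct) (simp_all add: Z A M distrib_left distrib_right)
qed

end

lemma star_elem_tensor: "star (a \<otimes>\<^sub>a b) = star a \<otimes>\<^sub>a star b"
  by transfer (simp add: tensor_eq.refl)


section \<open>The projective norm\<close>

definition proj_norm :: "('a::complex_normed_vector, 'b::complex_normed_vector) atensor \<Rightarrow> real" where
  "proj_norm u = Inf {(\<Sum>(x, y)\<leftarrow>xs. norm x * norm y) |xs. u = (\<Sum>(x, y)\<leftarrow>xs. x \<otimes>\<^sub>a y)}"

lemma sum_norms_nonneg: "0 \<le> (\<Sum>(x, y)\<leftarrow>xs. norm x * norm y)"
  by (rule sum_list_nonneg) auto

lemma bdd_below_proj_norm:
  "bdd_below {(\<Sum>(x, y)\<leftarrow>xs. norm x * norm y) |xs. u = (\<Sum>(x, y)\<leftarrow>xs. x \<otimes>\<^sub>a y)}"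
  by (rule bdd_belowI[of _ 0]) (auto simp: sum_norms_nonneg)

lemma proj_norm_le: "proj_norm (\<Sum>(x, y)\<leftarrow>xs. x \<otimes>\<^sub>a y) \<le> (\<Sum>(x, y)\<leftarrow>xs. norm x * norm y)"
  unfolding proj_norm_def by (rule cInf_lower[OF _ bdd_below_proj_norm]) auto

lemma le_proj_norm:
  assumes "\<And>xs. u = (\<Sum>(x, y)\<leftarrow>xs. x \<otimes>\<^sub>a y) \<Longrightarrow> r \<le> (\<Sum>(x, y)\<leftarrow>xs. norm x * norm y)"
  shows "r \<le> proj_norm u"
  unfolding proj_norm_def using atensor_eq_sum[of u] assms by (intro cInf_greatest) auto

lemma proj_norm_nonneg: "0 \<le> proj_norm u"
  by (rule le_proj_norm) (rule sum_norms_nonneg)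

lemma proj_norm_elem_le: "proj_norm (x \<otimes>\<^sub>a y) \<le> norm x * norm y"
  using proj_norm_le[of "[(x, y)]"] by simp

lemma proj_norm_zero: "proj_norm 0 = 0"
  by (rule antisym[OF _ proj_norm_nonneg]) (use proj_norm_le[of "[]"] in simp)

lemma proj_norm_triangle: "proj_norm (u + v) \<le> proj_norm u + proj_norm v"
proof -
  have "proj_norm (u + v) - proj_norm u \<le> proj_norm v"
  proof (rule le_proj_norm)
    fix ys assume ys: "v = (\<Sum>(x, y)\<leftarrow>ys. x \<otimes>\<^sub>a y)"
    have "proj_norm (u + v) - (\<Sum>(x, y)\<leftarrow>ys. norm x * norm y) \<le> proj_norm u"
    proof (rule le_proj_norm)
      fix xs assume xs: "u = (\<Sum>(x, y)\<leftarrow>xs. x \<otimes>\<^sub>a y)"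
      show "proj_norm (u + v) - (\<Sum>(x, y)\<leftarrow>ys. norm x * norm y) \<le> (\<Sum>(x, y)\<leftarrow>xs. norm x * norm y)"
        using proj_norm_le[of "xs @ ys"] by (simp add: xs ys)
    qed
    then show "proj_norm (u + v) - proj_norm u \<le> (\<Sum>(x, y)\<leftarrow>ys. norm x * norm y)" by simp
  qed
  then show ?thesis by simp
qed

lemma proj_norm_bound:
  fixes f :: "('a::complex_normed_vector, 'b::complex_normed_vector) atensor \<Rightarrow> 'c::ab_group_add"
    and q :: "'c \<Rightarrow> real"
  assumes q: "q 0 = 0" "\<And>x y. q (x + y) \<le> q x + q y"
    and f: "\<And>u v. f (u + v) = f u + f v"
    and K: "0 \<le> K" "\<And>x y. q (f (x \<otimes>\<^sub>a y)) \<le> K * (norm x * norm y)"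
  shows "q (f u) \<le> K * proj_norm u"
proof -
  have f0: "f 0 = 0" using f[of 0 0] by simp
  have *: "q (f (\<Sum>(x, y)\<leftarrow>xs. x \<otimes>\<^sub>a y)) \<le> K * (\<Sum>(x, y)\<leftarrow>xs. norm x * norm y)" for xs
  proof (induction xs)
    case (Cons p xs)
    obtain x y where p: "p = (x, y)" by fastforce
    have "q (f (x \<otimes>\<^sub>a y) + f (\<Sum>(x, y)\<leftarrow>xs. x \<otimes>\<^sub>a y)) \<le>
        K * (norm x * norm y) + K * (\<Sum>(x, y)\<leftarrow>xs. norm x * norm y)"
      using q(2) K(2) Cons.IH by (meson add_mono order_trans)
    then show ?case by (simp add: p f distrib_left)
  qed (simp add: f0 q)
  show ?thesis
  proof (cases "K = 0")
    case True
    then show ?thesis using * atensor_eq_sum[of u] by auto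
  next
    case False
    with K(1) have "K > 0" by simp
    have "q (f u) / K \<le> proj_norm u"
      by (rule le_proj_norm) (use * \<open>K > 0\<close> in \<open>auto simp: field_simps\<close>)
    with \<open>K > 0\<close> show ?thesis by (simp add: field_simps)
  qed
qed

lemma proj_norm_bound_atensor:
  fixes f :: "('a::complex_normed_vector, 'b::complex_normed_vector) atensor \<Rightarrow>
    ('c::complex_normed_vector, 'd::complex_normed_vector) atensor"
  assumes "\<And>u v. f (u + v) = f u + f v" "0 \<le> K"
    and "\<And>x y. proj_norm (f (x \<otimes>\<^sub>a y)) \<le> K * (norm x * norm y)"
  shows "proj_norm (f u) \<le> K * proj_norm u"
  using assms by (intro proj_norm_bound[where q = proj_norm] proj_norm_zero proj_norm_triangle)

lemma proj_norm_scaleC_le: "proj_norm (c *\<^sub>C u) \<le> cmod c * proj_norm u"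
proof (rule proj_norm_bound_atensor)
  fix x :: 'a and y :: 'b
  show "proj_norm (c *\<^sub>C (x \<otimes>\<^sub>a y)) \<le> cmod c * (norm x * norm y)"
    using proj_norm_elem_le[of "c *\<^sub>C x" y] by (simp add: elem_tensor_scaleC_left norm_scaleC mult.assoc)
qed (auto simp: scaleC_add_right)

lemma proj_norm_scaleC: "proj_norm (c *\<^sub>C u) = cmod c * proj_norm u"
proof (cases "c = 0")
  case True
  then show ?thesis by (simp add: scaleC_zero_left proj_norm_zero)
next
  case False
  have "proj_norm u = proj_norm (inverse c *\<^sub>C c *\<^sub>C u)"
    using False by (simp add: scaleC_scaleC scaleC_one)
  also have "\<dots> \<le> inverse (cmod c) * proj_norm (c *\<^sub>C u)"
    using proj_norm_scaleC_le[of "inverse c"] by (simp add: norm_inverse)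
  finally have "cmod c * proj_norm u \<le> proj_norm (c *\<^sub>C u)"
    using False by (simp add: field_simps)
  with proj_norm_scaleC_le[of c u] show ?thesis by simp
qed

lemma proj_norm_minus: "proj_norm (- u) = proj_norm u"
  using proj_norm_scaleC[of "-1" u] by (simp add: scaleC_minus_left)

lemma proj_norm_minus_commute: "proj_norm (u - v) = proj_norm (v - u)"
  using proj_norm_minus[of "u - v"] by simp

lemma proj_norm_triangle_diff: "proj_norm (u - w) \<le> proj_norm (u - v) + proj_norm (v - w)"
  using proj_norm_triangle[of "u - v" "v - w"] by simp

lemma proj_norm_diff: "\<bar>proj_norm u - proj_norm v\<bar> \<le> proj_norm (u - v)"
  using proj_norm_triangle[of "u - v" v] proj_norm_triangle[of "v - u" u]
  by (simp add: proj_norm_minus_commute)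

lemma proj_norm_mult:
  fixes u v :: "('a::complex_normed_algebra, 'b::complex_normed_algebra) atensor"
  shows "proj_norm (u * v) \<le> proj_norm u * proj_norm v"
proof -
  have "proj_norm ((a \<otimes>\<^sub>a b) * v) \<le> (norm a * norm b) * proj_norm v" for a :: 'a and b :: 'b
  proof (rule proj_norm_bound_atensor)
    fix c :: 'a and d :: 'b
    have "proj_norm ((a * c) \<otimes>\<^sub>a (b * d)) \<le> norm (a * c) * norm (b * d)"
      by (rule proj_norm_elem_le)
    also have "\<dots> \<le> (norm a * norm c) * (norm b * norm d)"
      by (intro mult_mono norm_mult_ineq) auto
    finally show "proj_norm ((a \<otimes>\<^sub>a b) * (c \<otimes>\<^sub>a d)) \<le> (norm a * norm b) * (norm c * norm d)"
      by (simp add: elem_tensor_mult ac_simps)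
  qed (auto simp: distrib_left)
  then have "proj_norm (u * v) \<le> proj_norm v * proj_norm u"
    by (intro proj_norm_bound_atensor) (auto simp: distrib_right proj_norm_nonneg mult.commute)
  then show ?thesis by (simp add: mult.commute)
qed

lemma proj_norm_star_le:
  fixes u :: "('a::complex_normed_star_algebra, 'b::complex_normed_star_algebra) atensor"
  shows "proj_norm (star u) \<le> proj_norm u"
proof -
  have "proj_norm (star u) \<le> 1 * proj_norm u"
  proof (rule proj_norm_bound_atensor)
    fix x :: 'a and y :: 'b
    show "proj_norm (star (x \<otimes>\<^sub>a y)) \<le> 1 * (norm x * norm y)"
      using proj_norm_elem_le[of "star x" "star y"] by (simp add: star_elem_tensor norm_star)
  qed (auto simp: star_add)
  then show ?thesis by simp
qed

lemma proj_norm_star: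
  fixes u :: "('a::complex_normed_star_algebra, 'b::complex_normed_star_algebra) atensor"
  shows "proj_norm (star u) = proj_norm u"
  using proj_norm_star_le[of u] proj_norm_star_le[of "star u"] by (simp add: star_star)


section \<open>The projective tensor product\<close>

definition proj_Cauchy :: "(nat \<Rightarrow> ('a::complex_normed_vector, 'b::complex_normed_vector) atensor) \<Rightarrow> bool" where
  "proj_Cauchy X \<longleftrightarrow> (\<forall>e>0. \<exists>N. \<forall>m\<ge>N. \<forall>n\<ge>N. proj_norm (X m - X n) < e)"

text \<open>The completion consists of the Cauchy sequences modulo null sequences. Vectors of projective
  norm zero are identified by the construction, so that it does not need the fact that there are
  none but zero.\<close>

definition ptensor_rel ::
  "(nat \<Rightarrow> ('a::complex_normed_vector, 'b::complex_normed_vector) atensor) \<Rightarrow>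
    (nat \<Rightarrow> ('a, 'b) atensor) \<Rightarrow> bool" where
  "ptensor_rel X Y \<longleftrightarrow> proj_Cauchy X \<and> proj_Cauchy Y \<and> (\<lambda>n. proj_norm (X n - Y n)) \<longlonglongrightarrow> 0"

lemma proj_Cauchy_const: "proj_Cauchy (\<lambda>n. u)"
  by (simp add: proj_Cauchy_def proj_norm_zero)

lemma ptensor_rel_refl: "ptensor_rel X X \<longleftrightarrow> proj_Cauchy X"
  by (simp add: ptensor_rel_def proj_norm_zero)

lemma ptensor_rel_const: "ptensor_rel (\<lambda>n. u) (\<lambda>n. u)"
  by (simp add: ptensor_rel_refl proj_Cauchy_const)

lemma null_le:
  fixes f g :: "nat \<Rightarrow> real"
  assumes "g \<longlonglongrightarrow> 0" and "\<And>n. 0 \<le> f n" and "\<And>n. f n \<le> g n"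
  shows "f \<longlonglongrightarrow> 0"
  using assms by (intro tendsto_sandwich[OF _ _ tendsto_const assms(1)]) auto

lemma part_equivp_ptensor_rel:
  "part_equivp (ptensor_rel ::
    (nat \<Rightarrow> ('a::complex_normed_vector, 'b::complex_normed_vector) atensor) \<Rightarrow> _)" (is "part_equivp ?R")
proof (rule part_equivpI)
  show "\<exists>X. ?R X X" using ptensor_rel_const by blast
  show "symp ?R"
    by (rule sympI) (simp add: ptensor_rel_def proj_norm_minus_commute)
  show "transp ?R"
  proof (rule transpI)
    fix X Y Z :: "nat \<Rightarrow> ('a, 'b) atensor"
    assume "ptensor_rel X Y" "ptensor_rel Y Z"
    then have "(\<lambda>n. proj_norm (X n - Y n) + proj_norm (Y n - Z n)) \<longlonglongrightarrow> 0 + 0"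
      unfolding ptensor_rel_def by (intro tendsto_add) auto
    then have "(\<lambda>n. proj_norm (X n - Z n)) \<longlonglongrightarrow> 0"
      by (intro null_le[OF _ proj_norm_nonneg proj_norm_triangle_diff]) simp
    with \<open>ptensor_rel X Y\<close> \<open>ptensor_rel Y Z\<close> show "ptensor_rel X Z"
      by (simp add: ptensor_rel_def)
  qed
qed

quotient_type (overloaded) ('a, 'b) ptensor =
  "nat \<Rightarrow> ('a::complex_normed_vector, 'b::complex_normed_vector) atensor" / partial: ptensor_rel
  by (rule part_equivp_ptensor_rel)

lemma proj_Cauchy_bound:
  fixes f :: "('a::complex_normed_vector, 'b::complex_normed_vector) atensor \<Rightarrow>
    ('c::complex_normed_vector, 'd::complex_normed_vector) atensor"
  assumes X: "proj_Cauchy X" and f: "\<And>u v. f (u - v) = f u - f v"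
    and K: "\<And>u. proj_norm (f u) \<le> K * proj_norm u"
  shows "proj_Cauchy (\<lambda>n. f (X n))"
  unfolding proj_Cauchy_def
proof (intro allI impI)
  fix e :: real assume "e > 0"
  then have "e / (\<bar>K\<bar> + 1) > 0" by simp
  then obtain N where N: "proj_norm (X m - X n) < e / (\<bar>K\<bar> + 1)" if "m \<ge> N" "n \<ge> N" for m n
    using X unfolding proj_Cauchy_def by blast
  have "proj_norm (f (X m) - f (X n)) < e" if "m \<ge> N" "n \<ge> N" for m n
  proof -
    have "proj_norm (f (X m) - f (X n)) \<le> K * proj_norm (X m - X n)"
      using K[of "X m - X n"] by (simp add: f)
    also have "\<dots> \<le> (\<bar>K\<bar> + 1) * proj_norm (X m - X n)"
      by (intro mult_right_mono proj_norm_nonneg) auto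
    also have "\<dots> < e"
      using N[OF that] by (simp add: field_simps)
    finally show ?thesis .
  qed
  then show "\<exists>N. \<forall>m\<ge>N. \<forall>n\<ge>N. proj_norm (f (X m) - f (X n)) < e" by blast
qed

lemma ptensor_rel_bound:
  fixes f :: "('a::complex_normed_vector, 'b::complex_normed_vector) atensor \<Rightarrow>
    ('c::complex_normed_vector, 'd::complex_normed_vector) atensor"
  assumes X: "ptensor_rel X Y" and f: "\<And>u v. f (u - v) = f u - f v"
    and K: "\<And>u. proj_norm (f u) \<le> K * proj_norm u"
  shows "ptensor_rel (\<lambda>n. f (X n)) (\<lambda>n. f (Y n))"
proof -
  have "(\<lambda>n. K * proj_norm (X n - Y n)) \<longlonglongrightarrow> K * 0"
    using X unfolding ptensor_rel_def by (intro tendsto_mult tendsto_const) auto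
  then have "(\<lambda>n. proj_norm (f (X n) - f (Y n))) \<longlonglongrightarrow> 0"
    using K by (intro null_le[OF _ proj_norm_nonneg]) (auto simp flip: f)
  with X proj_Cauchy_bound[OF _ f K] show ?thesis
    unfolding ptensor_rel_def by blast
qed

lemma proj_Cauchy_add:
  assumes X: "proj_Cauchy X" and Y: "proj_Cauchy Y"
  shows "proj_Cauchy (\<lambda>n. X n + Y n)"
  unfolding proj_Cauchy_def
proof (intro allI impI)
  fix e :: real assume e: "e > 0"
  have "e / 2 > 0" using e by simp
  obtain M where M: "proj_norm (X m - X n) < e / 2" if "m \<ge> M" "n \<ge> M" for m n
    using X \<open>e / 2 > 0\<close> unfolding proj_Cauchy_def by blast
  obtain N where N: "proj_norm (Y m - Y n) < e / 2" if "m \<ge> N" "n \<ge> N" for m n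
    using Y \<open>e / 2 > 0\<close> unfolding proj_Cauchy_def by blast
  have "proj_norm ((X m + Y m) - (X n + Y n)) < e" if "m \<ge> max M N" "n \<ge> max M N" for m n
    using M[of m n] N[of m n] that proj_norm_triangle[of "X m - X n" "Y m - Y n"]
    by (simp add: algebra_simps)
  then show "\<exists>N. \<forall>m\<ge>N. \<forall>n\<ge>N. proj_norm ((X m + Y m) - (X n + Y n)) < e" by blast
qed

lemma ptensor_rel_add:
  assumes X: "ptensor_rel X X'" and Y: "ptensor_rel Y Y'"
  shows "ptensor_rel (\<lambda>n. X n + Y n) (\<lambda>n. X' n + Y' n)"
proof -
  have "(\<lambda>n. proj_norm (X n - X' n) + proj_norm (Y n - Y' n)) \<longlonglongrightarrow> 0 + 0"
    using X Y unfolding ptensor_rel_def by (intro tendsto_add) auto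
  moreover have "proj_norm ((X n + Y n) - (X' n + Y' n)) \<le>
      proj_norm (X n - X' n) + proj_norm (Y n - Y' n)" for n
    using proj_norm_triangle[of "X n - X' n" "Y n - Y' n"] by (simp add: algebra_simps)
  ultimately have "(\<lambda>n. proj_norm ((X n + Y n) - (X' n + Y' n))) \<longlonglongrightarrow> 0"
    by (intro null_le[OF _ proj_norm_nonneg]) auto
  with X Y show ?thesis by (simp add: ptensor_rel_def proj_Cauchy_add)
qed

lemma proj_Cauchy_convergent:
  assumes "proj_Cauchy X"
  shows "convergent (\<lambda>n. proj_norm (X n))"
proof (rule Cauchy_convergent, rule metric_CauchyI)
  fix e :: real assume "e > 0"
  then obtain N where N: "proj_norm (X m - X n) < e" if "m \<ge> N" "n \<ge> N" for m n
    using assms unfolding proj_Cauchy_def by blast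
  then have "dist (proj_norm (X m)) (proj_norm (X n)) < e" if "m \<ge> N" "n \<ge> N" for m n
    using N[OF that] proj_norm_diff[of "X m" "X n"] by (simp add: dist_real_def)
  then show "\<exists>N. \<forall>m\<ge>N. \<forall>n\<ge>N. dist (proj_norm (X m)) (proj_norm (X n)) < e" by blast
qed

lemma ptensor_rel_lim:
  assumes "ptensor_rel X Y"
  shows "lim (\<lambda>n. proj_norm (X n)) = lim (\<lambda>n. proj_norm (Y n))"
proof -
  have Y: "(\<lambda>n. proj_norm (Y n)) \<longlonglongrightarrow> lim (\<lambda>n. proj_norm (Y n))"
    using assms proj_Cauchy_convergent by (auto simp: ptensor_rel_def convergent_LIMSEQ_iff)
  have "(\<lambda>n. proj_norm (X n) - proj_norm (Y n)) \<longlonglongrightarrow> 0"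
    by (rule tendsto_rabs_zero_cancel, rule null_le[where g = "\<lambda>n. proj_norm (X n - Y n)"])
       (use assms in \<open>auto simp: ptensor_rel_def proj_norm_diff\<close>)
  from tendsto_add[OF this Y] show ?thesis
    by (simp add: limI)
qed

lemma ptensor_rel_scaleC:
  "ptensor_rel X Y \<Longrightarrow> ptensor_rel (\<lambda>n. c *\<^sub>C X n) (\<lambda>n. c *\<^sub>C Y n)"
  by (erule ptensor_rel_bound[where K = "cmod c"]) (auto simp: scaleC_diff_right proj_norm_scaleC)

instantiation ptensor :: (complex_normed_vector, complex_normed_vector) complex_vector
begin

lift_definition zero_ptensor :: "('a, 'b) ptensor" is "\<lambda>n. 0"
  by (rule ptensor_rel_const)

lift_definition plus_ptensor :: "('a, 'b) ptensor \<Rightarrow> ('a, 'b) ptensor \<Rightarrow> ('a, 'b) ptensor"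
  is "\<lambda>X Y n. X n + Y n" by (rule ptensor_rel_add)

lift_definition uminus_ptensor :: "('a, 'b) ptensor \<Rightarrow> ('a, 'b) ptensor"
  is "\<lambda>X n. - X n" by (erule ptensor_rel_bound[where K = 1]) (auto simp: proj_norm_minus)

definition minus_ptensor :: "('a, 'b) ptensor \<Rightarrow> ('a, 'b) ptensor \<Rightarrow> ('a, 'b) ptensor"
  where "minus_ptensor u v = u + - v"

lift_definition scaleC_ptensor :: "complex \<Rightarrow> ('a, 'b) ptensor \<Rightarrow> ('a, 'b) ptensor"
  is "\<lambda>c X n. c *\<^sub>C X n"
  by (rule ptensor_rel_scaleC)

definition scaleR_ptensor :: "real \<Rightarrow> ('a, 'b) ptensor \<Rightarrow> ('a, 'b) ptensor"
  where "scaleR_ptensor r u = complex_of_real r *\<^sub>C u"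

instance
proof -
  have addC: "c *\<^sub>C (u + v) = c *\<^sub>C u + c *\<^sub>C v" for c and u v :: "('a, 'b) ptensor"
    by transfer (auto simp: scaleC_add_right intro!: ptensor_rel_add ptensor_rel_scaleC)
  have Cadd: "(c + d) *\<^sub>C u = c *\<^sub>C u + d *\<^sub>C u" for c d and u :: "('a, 'b) ptensor"
    by transfer (auto simp: scaleC_add_left intro!: ptensor_rel_add ptensor_rel_scaleC)
  have CC: "c *\<^sub>C d *\<^sub>C u = (c * d) *\<^sub>C u" for c d and u :: "('a, 'b) ptensor"
    by transfer (simp add: scaleC_scaleC ptensor_rel_scaleC)
  have one: "1 *\<^sub>C u = u" for u :: "('a, 'b) ptensor"
    by transfer (simp add: scaleC_one)
  show "OFCLASS(('a, 'b) ptensor, complex_vector_class)"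
  proof
    fix u v w :: "('a, 'b) ptensor" and r s :: real and c d :: complex
    show "u + v + w = u + (v + w)" by transfer (simp add: add.assoc ptensor_rel_add)
    show "u + v = v + u" by transfer (simp add: add.commute ptensor_rel_add)
    show "0 + u = u" by transfer simp
    show "- u + u = 0" by transfer (simp add: ptensor_rel_const)
    show "u - v = u + - v" by (rule minus_ptensor_def)
    show "c *\<^sub>C (u + v) = c *\<^sub>C u + c *\<^sub>C v" by (rule addC)
    show "(c + d) *\<^sub>C u = c *\<^sub>C u + d *\<^sub>C u" by (rule Cadd)
    show "c *\<^sub>C (d *\<^sub>C u) = (c * d) *\<^sub>C u" by (rule CC)
    show "r *\<^sub>R u = complex_of_real r *\<^sub>C u" by (rule scaleR_ptensor_def)
    show "r *\<^sub>R (u + v) = r *\<^sub>R u + r *\<^sub>R v" by (simp add: scaleR_ptensor_def addC)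
    show "(r + s) *\<^sub>R u = r *\<^sub>R u + s *\<^sub>R u" by (simp add: scaleR_ptensor_def Cadd)
    show "r *\<^sub>R s *\<^sub>R u = (r * s) *\<^sub>R u" by (simp add: scaleR_ptensor_def CC)
    show "1 *\<^sub>R u = u" by (simp add: scaleR_ptensor_def one)
  qed
qed

end

definition of_atensor :: "('a::complex_normed_vector, 'b::complex_normed_vector) atensor \<Rightarrow> ('a, 'b) ptensor"
  where "of_atensor u = abs_ptensor (\<lambda>n. u)"

lemma ptensor_cases:
  obtains X where "proj_Cauchy X" "z = abs_ptensor X"
  by (metis Quotient_abs_rep Quotient_ptensor Quotient_rep_reflp ptensor_rel_refl)

lemma abs_ptensor_eq_iff:
  "proj_Cauchy X \<Longrightarrow> proj_Cauchy Y \<Longrightarrow>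
    abs_ptensor X = abs_ptensor Y \<longleftrightarrow> (\<lambda>n. proj_norm (X n - Y n)) \<longlonglongrightarrow> 0"
  using Quotient_rel[OF Quotient_ptensor, of X Y] by (auto simp: ptensor_rel_def proj_norm_zero)

lemma abs_ptensor_add:
  "proj_Cauchy X \<Longrightarrow> proj_Cauchy Y \<Longrightarrow> abs_ptensor X + abs_ptensor Y = abs_ptensor (\<lambda>n. X n + Y n)"
  by (rule plus_ptensor.abs_eq) (simp_all add: eq_onp_def ptensor_rel_refl)

lemma abs_ptensor_scaleC: "proj_Cauchy X \<Longrightarrow> c *\<^sub>C abs_ptensor X = abs_ptensor (\<lambda>n. c *\<^sub>C X n)"
  by (rule scaleC_ptensor.abs_eq) (simp_all add: eq_onp_def ptensor_rel_refl)

lemma proj_Cauchy_scaleC: "proj_Cauchy X \<Longrightarrow> proj_Cauchy (\<lambda>n. c *\<^sub>C X n)"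
  by (erule proj_Cauchy_bound[where K = "cmod c"]) (auto simp: scaleC_diff_right proj_norm_scaleC)

lemma proj_Cauchy_diff: "proj_Cauchy X \<Longrightarrow> proj_Cauchy Y \<Longrightarrow> proj_Cauchy (\<lambda>n. X n - Y n)"
  using proj_Cauchy_add[of X "\<lambda>n. (-1) *\<^sub>C Y n"] proj_Cauchy_scaleC[of Y "-1"]
  by (simp add: scaleC_minus_left)

lemma abs_ptensor_diff:
  "proj_Cauchy X \<Longrightarrow> proj_Cauchy Y \<Longrightarrow> abs_ptensor X - abs_ptensor Y = abs_ptensor (\<lambda>n. X n - Y n)"
  using abs_ptensor_add[of X "\<lambda>n. (-1) *\<^sub>C Y n"] proj_Cauchy_scaleC[of Y "-1"]
    abs_ptensor_scaleC[of Y "-1"]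
  by (simp add: scaleC_minus_left diff_conv_add_uminus del: add_uminus_conv_diff)

lemma of_atensor_add: "of_atensor (u + v) = of_atensor u + of_atensor v"
  by (simp add: of_atensor_def abs_ptensor_add proj_Cauchy_const)

lemma of_atensor_diff: "of_atensor (u - v) = of_atensor u - of_atensor v"
  by (simp add: of_atensor_def abs_ptensor_diff proj_Cauchy_const)

lemma of_atensor_scaleC: "of_atensor (c *\<^sub>C u) = c *\<^sub>C of_atensor u"
  by (simp add: of_atensor_def abs_ptensor_scaleC proj_Cauchy_const)

lemma of_atensor_zero: "of_atensor 0 = 0"
  using of_atensor_add[of 0 0] by simp

instantiation ptensor :: (complex_normed_vector, complex_normed_vector) complex_normed_vector
begin

lift_definition norm_ptensor :: "('a, 'b) ptensor \<Rightarrow> real" is "\<lambda>X. lim (\<lambda>n. proj_norm (X n))"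
  by (rule ptensor_rel_lim)

definition dist_ptensor :: "('a, 'b) ptensor \<Rightarrow> ('a, 'b) ptensor \<Rightarrow> real"
  where "dist_ptensor u v = norm (u - v)"

definition sgn_ptensor :: "('a, 'b) ptensor \<Rightarrow> ('a, 'b) ptensor"
  where "sgn_ptensor u = u /\<^sub>R norm u"

definition uniformity_ptensor :: "(('a, 'b) ptensor \<times> ('a, 'b) ptensor) filter"
  where "uniformity_ptensor = (INF e\<in>{0<..}. principal {(u, v). dist u v < e})"

definition open_ptensor :: "('a, 'b) ptensor set \<Rightarrow> bool"
  where "open_ptensor U \<longleftrightarrow> (\<forall>u\<in>U. eventually (\<lambda>(u', v). u' = u \<longrightarrow> v \<in> U) uniformity)"

lemma norm_abs_ptensor:
  assumes "proj_Cauchy X"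
  shows "(\<lambda>n. proj_norm (X n)) \<longlonglongrightarrow> norm (abs_ptensor X)"
proof -
  have "norm (abs_ptensor X) = lim (\<lambda>n. proj_norm (X n))"
    by (rule norm_ptensor.abs_eq) (simp add: eq_onp_def ptensor_rel_refl assms)
  then show ?thesis
    using proj_Cauchy_convergent[OF assms] by (simp add: convergent_LIMSEQ_iff)
qed

instance
proof -
  have C: "norm (c *\<^sub>C u) = cmod c * norm u" for c and u :: "('a, 'b) ptensor"
  proof (cases u rule: ptensor_cases)
    case (1 X)
    show ?thesis
      using norm_abs_ptensor[OF proj_Cauchy_scaleC[OF 1(1)], of c]
        tendsto_mult[OF tendsto_const[of "cmod c"] norm_abs_ptensor[OF 1(1)]]
      by (auto simp: 1 abs_ptensor_scaleC proj_norm_scaleC intro: LIMSEQ_unique)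
  qed
  show "OFCLASS(('a, 'b) ptensor, complex_normed_vector_class)"
  proof
    fix u v :: "('a, 'b) ptensor" and c :: complex and r :: real
    show "dist u v = norm (u - v)" by (rule dist_ptensor_def)
    show "sgn u = u /\<^sub>R norm u" by (rule sgn_ptensor_def)
    show "(uniformity :: (('a, 'b) ptensor \<times> ('a, 'b) ptensor) filter) =
        (INF e\<in>{0<..}. principal {(u, v). dist u v < e})"
      by (rule uniformity_ptensor_def)
    show "open U \<longleftrightarrow> (\<forall>u\<in>U. eventually (\<lambda>(u', v). u' = u \<longrightarrow> v \<in> U) uniformity)"
      for U :: "('a, 'b) ptensor set"
      by (rule open_ptensor_def)
    show "norm (c *\<^sub>C u) = cmod c * norm u" by (rule C)
    show "norm (r *\<^sub>R u) = \<bar>r\<bar> * norm u" by (simp add: scaleR_scaleC C)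
    show "norm u = 0 \<longleftrightarrow> u = 0"
    proof (cases u rule: ptensor_cases)
      case (1 X)
      have "u = 0 \<longleftrightarrow> (\<lambda>n. proj_norm (X n)) \<longlonglongrightarrow> 0"
        using abs_ptensor_eq_iff[OF 1(1) proj_Cauchy_const[of 0]]
        by (simp add: 1 zero_ptensor_def)
      then show ?thesis
        using norm_abs_ptensor[OF 1(1)] 1(2) LIMSEQ_unique by metis
    qed
    show "norm (u + v) \<le> norm u + norm v"
    proof (cases u rule: ptensor_cases; cases v rule: ptensor_cases)
      fix X Y :: "nat \<Rightarrow> ('a, 'b) atensor"
      assume X: "proj_Cauchy X" "u = abs_ptensor X" and Y: "proj_Cauchy Y" "v = abs_ptensor Y"
      have "norm (abs_ptensor (\<lambda>n. X n + Y n)) \<le> norm u + norm v"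
      unfolding X(2) Y(2)
      by (rule LIMSEQ_le[OF norm_abs_ptensor[OF proj_Cauchy_add[OF X(1) Y(1)]]
            tendsto_add[OF norm_abs_ptensor[OF X(1)] norm_abs_ptensor[OF Y(1)]]])
         (auto intro: proj_norm_triangle)
      then show ?thesis by (simp add: X Y abs_ptensor_add)
    qed
  qed
qed

end

lemma norm_of_atensor: "norm (of_atensor u) = proj_norm u"
  using norm_abs_ptensor[OF proj_Cauchy_const[of u]]
  by (simp add: of_atensor_def LIMSEQ_const_iff)

lemma abs_ptensor_limit:
  assumes X: "proj_Cauchy X"
  shows "(\<lambda>n. of_atensor (X n)) \<longlonglongrightarrow> abs_ptensor X"
proof (rule metric_LIMSEQ_I)
  fix e :: real assume "e > 0"
  then have "e / 2 > 0" by simp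
  then obtain N where N: "proj_norm (X m - X n) < e / 2" if "m \<ge> N" "n \<ge> N" for m n
    using X unfolding proj_Cauchy_def by blast
  have "dist (of_atensor (X n)) (abs_ptensor X) < e" if "n \<ge> N" for n
  proof -
    have C: "proj_Cauchy (\<lambda>m. X n - X m)"
      by (rule proj_Cauchy_diff[OF proj_Cauchy_const X])
    have "norm (abs_ptensor (\<lambda>m. X n - X m)) \<le> e / 2"
      by (rule LIMSEQ_le_const2[OF norm_abs_ptensor[OF C]])
         (use N[OF that] in \<open>auto intro!: exI[of _ N] less_imp_le\<close>)
    then show ?thesis
      using \<open>e > 0\<close> by (simp add: dist_norm of_atensor_def abs_ptensor_diff proj_Cauchy_const X)
  qed
  then show "\<exists>N. \<forall>n\<ge>N. dist (of_atensor (X n)) (abs_ptensor X) < e" by blast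
qed

lemma closure_range_of_atensor: "closure (range of_atensor) = UNIV"
proof -
  have "z \<in> closure (range of_atensor)" for z :: "('a, 'b) ptensor"
  proof (cases z rule: ptensor_cases)
    case (1 X)
    show ?thesis
      unfolding closure_sequential 1(2)
      by (rule exI[of _ "\<lambda>n. of_atensor (X n)"]) (simp add: abs_ptensor_limit[OF 1(1)])
  qed
  then show ?thesis by auto
qed

lemma proj_Cauchy_iff: "proj_Cauchy X \<longleftrightarrow> Cauchy (\<lambda>n. of_atensor (X n))"
  by (simp add: proj_Cauchy_def Cauchy_def dist_norm norm_of_atensor flip: of_atensor_diff)

instance ptensor :: (complex_normed_vector, complex_normed_vector) complex_banach
proof
  fix Z :: "nat \<Rightarrow> ('a, 'b) ptensor"
  assume Z: "Cauchy Z"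
  have "\<exists>u. dist (of_atensor u) (Z n) < inverse (real (Suc n))" for n
    using closure_range_of_atensor closure_approachable[of "Z n" "range of_atensor"] by auto
  then obtain u where u: "dist (of_atensor (u n)) (Z n) < inverse (real (Suc n))" for n
    by metis
  have "(\<lambda>n. dist (of_atensor (u n)) (Z n)) \<longlonglongrightarrow> 0"
    by (rule null_le[OF LIMSEQ_inverse_real_of_nat zero_le_dist less_imp_le[OF u]])
  then have d: "(\<lambda>n. of_atensor (u n) - Z n) \<longlonglongrightarrow> 0"
    by (simp add: dist_norm tendsto_norm_zero_iff)
  have "Cauchy (\<lambda>n. of_atensor (u n))"
  proof (rule metric_CauchyI)
    fix e :: real assume "e > 0"
    then have e: "e / 2 > 0" by simp
    obtain M where M: "dist (Z m) (Z n) < e / 2" if "m \<ge> M" "n \<ge> M" for m n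
      using metric_CauchyD[OF Z e] by blast
    obtain N where N: "norm ((of_atensor (u m) - Z m) - (of_atensor (u n) - Z n)) < e / 2"
      if "m \<ge> N" "n \<ge> N" for m n
      using CauchyD[OF LIMSEQ_imp_Cauchy[OF d] e] by blast
    have "dist (of_atensor (u m)) (of_atensor (u n)) < e" if "m \<ge> max M N" "n \<ge> max M N" for m n
      using M[of m n] N[of m n] that
        norm_triangle_ineq[of "(of_atensor (u m) - Z m) - (of_atensor (u n) - Z n)" "Z m - Z n"]
      by (simp add: dist_norm)
    then show "\<exists>N. \<forall>m\<ge>N. \<forall>n\<ge>N. dist (of_atensor (u m)) (of_atensor (u n)) < e" by blast
  qed
  then have "proj_Cauchy u" by (simp add: proj_Cauchy_iff)
  from tendsto_diff[OF abs_ptensor_limit[OF this] d] show "convergent Z"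
    by (auto simp: convergent_def)
qed

lemma proj_Cauchy_bounded:
  assumes "proj_Cauchy X"
  obtains B where "0 < B" "\<And>n. proj_norm (X n) \<le> B"
proof -
  have "Bseq (\<lambda>n. proj_norm (X n))"
    using proj_Cauchy_convergent[OF assms] by (rule convergent_imp_Bseq)
  then show ?thesis
    using that by (auto simp: Bseq_def proj_norm_nonneg)
qed

lemma proj_Cauchy_mult:
  fixes X Y :: "nat \<Rightarrow> ('a::complex_normed_algebra, 'b::complex_normed_algebra) atensor"
  assumes X: "proj_Cauchy X" and Y: "proj_Cauchy Y"
  shows "proj_Cauchy (\<lambda>n. X n * Y n)"
  unfolding proj_Cauchy_def
proof (intro allI impI)
  fix e :: real assume e: "e > 0"
  obtain A where A: "0 < A" "\<And>n. proj_norm (X n) \<le> A" by (rule proj_Cauchy_bounded[OF X]) (rule that)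
  obtain B where B: "0 < B" "\<And>n. proj_norm (Y n) \<le> B" by (rule proj_Cauchy_bounded[OF Y]) (rule that)
  have "e / (2 * B) > 0" "e / (2 * A) > 0" using e A B by auto
  obtain M where M: "proj_norm (X m - X n) < e / (2 * B)" if "m \<ge> M" "n \<ge> M" for m n
    using X \<open>e / (2 * B) > 0\<close> unfolding proj_Cauchy_def by blast
  obtain N where N: "proj_norm (Y m - Y n) < e / (2 * A)" if "m \<ge> N" "n \<ge> N" for m n
    using Y \<open>e / (2 * A) > 0\<close> unfolding proj_Cauchy_def by blast
  have "proj_norm (X m * Y m - X n * Y n) < e" if mn: "m \<ge> max M N" "n \<ge> max M N" for m n
  proof -
    have "X m * Y m - X n * Y n = (X m - X n) * Y m + X n * (Y m - Y n)"
      by (simp add: algebra_simps)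
    then have "proj_norm (X m * Y m - X n * Y n) \<le>
        proj_norm (X m - X n) * proj_norm (Y m) + proj_norm (X n) * proj_norm (Y m - Y n)"
      by (simp only:) (rule order_trans[OF proj_norm_triangle add_mono[OF proj_norm_mult proj_norm_mult]])
    also have "\<dots> \<le> proj_norm (X m - X n) * B + A * proj_norm (Y m - Y n)"
      by (intro add_mono mult_left_mono mult_right_mono A B proj_norm_nonneg)
    also have "\<dots> < e / (2 * B) * B + A * (e / (2 * A))"
      using mn M[of m n] N[of m n] A(1) B(1)
      by (intro add_strict_mono mult_strict_right_mono mult_strict_left_mono) auto
    also have "\<dots> = e" using A(1) B(1) by simp
    finally show ?thesis .
  qed
  then show "\<exists>N. \<forall>m\<ge>N. \<forall>n\<ge>N. proj_norm (X m * Y m - X n * Y n) < e" by blast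
qed

lemma ptensor_rel_mult:
  fixes X Y X' Y' :: "nat \<Rightarrow> ('a::complex_normed_algebra, 'b::complex_normed_algebra) atensor"
  assumes X: "ptensor_rel X X'" and Y: "ptensor_rel Y Y'"
  shows "ptensor_rel (\<lambda>n. X n * Y n) (\<lambda>n. X' n * Y' n)"
proof -
  obtain A where A: "\<And>n. proj_norm (X' n) \<le> A"
    by (rule proj_Cauchy_bounded[of X']) (use X that in \<open>auto simp: ptensor_rel_def\<close>)
  obtain B where B: "\<And>n. proj_norm (Y n) \<le> B"
    by (rule proj_Cauchy_bounded[of Y]) (use Y that in \<open>auto simp: ptensor_rel_def\<close>)
  have "(\<lambda>n. proj_norm (X n - X' n) * B + A * proj_norm (Y n - Y' n)) \<longlonglongrightarrow> 0 * B + A * 0"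
    using X Y unfolding ptensor_rel_def by (intro tendsto_intros) auto
  moreover have "proj_norm (X n * Y n - X' n * Y' n) \<le>
      proj_norm (X n - X' n) * B + A * proj_norm (Y n - Y' n)" for n
  proof -
    have "X n * Y n - X' n * Y' n = (X n - X' n) * Y n + X' n * (Y n - Y' n)"
      by (simp add: algebra_simps)
    then have "proj_norm (X n * Y n - X' n * Y' n) \<le>
        proj_norm (X n - X' n) * proj_norm (Y n) + proj_norm (X' n) * proj_norm (Y n - Y' n)"
      by (simp only:) (rule order_trans[OF proj_norm_triangle add_mono[OF proj_norm_mult proj_norm_mult]])
    also have "\<dots> \<le> proj_norm (X n - X' n) * B + A * proj_norm (Y n - Y' n)"
      by (intro add_mono mult_left_mono mult_right_mono A B proj_norm_nonneg)
    finally show ?thesis .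
  qed
  ultimately have "(\<lambda>n. proj_norm (X n * Y n - X' n * Y' n)) \<longlonglongrightarrow> 0"
    by (intro null_le[OF _ proj_norm_nonneg]) auto
  with X Y show ?thesis by (simp add: ptensor_rel_def proj_Cauchy_mult)
qed

instantiation ptensor :: (complex_normed_algebra, complex_normed_algebra) complex_normed_algebra
begin

lift_definition times_ptensor :: "('a, 'b) ptensor \<Rightarrow> ('a, 'b) ptensor \<Rightarrow> ('a, 'b) ptensor"
  is "\<lambda>X Y n. X n * Y n" by (rule ptensor_rel_mult)

lemma abs_ptensor_mult:
  "proj_Cauchy X \<Longrightarrow> proj_Cauchy Y \<Longrightarrow> abs_ptensor X * abs_ptensor Y = abs_ptensor (\<lambda>n. X n * Y n)"
  by (rule times_ptensor.abs_eq) (simp_all add: eq_onp_def ptensor_rel_refl)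

instance
proof
  fix u v w :: "('a, 'b) ptensor" and c :: complex and r :: real
  obtain X where X: "proj_Cauchy X" "u = abs_ptensor X" by (rule ptensor_cases)
  obtain Y where Y: "proj_Cauchy Y" "v = abs_ptensor Y" by (rule ptensor_cases)
  obtain Z where Z: "proj_Cauchy Z" "w = abs_ptensor Z" by (rule ptensor_cases)
  note cauchy = X Y Z proj_Cauchy_add proj_Cauchy_mult proj_Cauchy_scaleC
  note abs = abs_ptensor_add abs_ptensor_mult abs_ptensor_scaleC
  show "u * v * w = u * (v * w)" by (simp add: cauchy abs mult.assoc)
  show "(u + v) * w = u * w + v * w" by (simp add: cauchy abs distrib_right)
  show "u * (v + w) = u * v + u * w" by (simp add: cauchy abs distrib_left)
  show "(c *\<^sub>C u) * v = c *\<^sub>C (u * v)" by (simp add: cauchy abs mult_scaleC_left)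
  show "u * (c *\<^sub>C v) = c *\<^sub>C (u * v)" by (simp add: cauchy abs mult_scaleC_right)
  show "(r *\<^sub>R u) * v = r *\<^sub>R (u * v)" by (simp add: scaleR_scaleC cauchy abs mult_scaleC_left)
  show "u * (r *\<^sub>R v) = r *\<^sub>R (u * v)" by (simp add: scaleR_scaleC cauchy abs mult_scaleC_right)
  have "norm (abs_ptensor (\<lambda>n. X n * Y n)) \<le> norm u * norm v"
      unfolding X(2) Y(2)
      by (rule LIMSEQ_le[OF norm_abs_ptensor[OF proj_Cauchy_mult[OF X(1) Y(1)]]
            tendsto_mult[OF norm_abs_ptensor[OF X(1)] norm_abs_ptensor[OF Y(1)]]])
         (auto intro: proj_norm_mult)
  then show "norm (u * v) \<le> norm u * norm v" by (simp add: cauchy abs)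
qed

end

instantiation ptensor ::
  (complex_normed_star_algebra, complex_normed_star_algebra) complex_normed_star_algebra
begin

lift_definition star_ptensor :: "('a, 'b) ptensor \<Rightarrow> ('a, 'b) ptensor" is "\<lambda>X n. star (X n)"
  by (erule ptensor_rel_bound[where K = 1]) (auto simp: star_diff proj_norm_star)

lemma proj_Cauchy_star: "proj_Cauchy X \<Longrightarrow> proj_Cauchy (\<lambda>n. star (X n :: ('a, 'b) atensor))"
  by (erule proj_Cauchy_bound[where K = 1]) (auto simp: star_diff proj_norm_star)

lemma abs_ptensor_star: "proj_Cauchy X \<Longrightarrow> star (abs_ptensor X) = abs_ptensor (\<lambda>n. star (X n))"
  by (rule star_ptensor.abs_eq) (simp_all add: eq_onp_def ptensor_rel_refl)

instance
proof
  fix u v :: "('a, 'b) ptensor" and c :: complex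
  obtain X where X: "proj_Cauchy X" "u = abs_ptensor X" by (rule ptensor_cases)
  obtain Y where Y: "proj_Cauchy Y" "v = abs_ptensor Y" by (rule ptensor_cases)
  note cauchy = X Y proj_Cauchy_add proj_Cauchy_mult proj_Cauchy_scaleC proj_Cauchy_star
  note abs = abs_ptensor_add abs_ptensor_mult abs_ptensor_scaleC abs_ptensor_star
  show "star (star u) = u" by (simp add: cauchy abs star_star)
  show "star (u + v) = star u + star v" by (simp add: cauchy abs star_add)
  show "star (c *\<^sub>C u) = cnj c *\<^sub>C star u" by (simp add: cauchy abs star_scaleC)
  show "star (u * v) = star v * star u" by (simp add: cauchy abs star_mult)
  show "norm (star u) = norm u"
    using norm_abs_ptensor[OF X(1)] norm_abs_ptensor[OF proj_Cauchy_star[OF X(1)]]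
    by (auto simp: cauchy abs proj_norm_star intro: LIMSEQ_unique)
qed

end

instance ptensor :: (complex_normed_star_algebra, complex_normed_star_algebra) banach_star_algebra ..

definition ptensor_elem ::
  "'a::complex_normed_vector \<Rightarrow> 'b::complex_normed_vector \<Rightarrow> ('a, 'b) ptensor"  (infixr "\<otimes>\<^sub>\<gamma>" 75) where
  "x \<otimes>\<^sub>\<gamma> y = of_atensor (x \<otimes>\<^sub>a y)"

lemma ptensor_elem_mult: "(a \<otimes>\<^sub>\<gamma> b) * (c \<otimes>\<^sub>\<gamma> d) = (a * c) \<otimes>\<^sub>\<gamma> (b * d)"
  by (simp add: ptensor_elem_def of_atensor_def abs_ptensor_mult proj_Cauchy_const elem_tensor_mult)

lemma star_ptensor_elem: "star (a \<otimes>\<^sub>\<gamma> b) = star a \<otimes>\<^sub>\<gamma> star b"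
  by (simp add: ptensor_elem_def of_atensor_def abs_ptensor_star proj_Cauchy_const star_elem_tensor)


section \<open>Linear maps and isomorphisms\<close>

definition clinear :: "('a::complex_vector \<Rightarrow> 'b::complex_vector) \<Rightarrow> bool" where
  "clinear f \<longleftrightarrow> (\<forall>x y. f (x + y) = f x + f y) \<and> (\<forall>c x. f (c *\<^sub>C x) = c *\<^sub>C f x)"

definition isometric :: "('a::real_normed_vector \<Rightarrow> 'b::real_normed_vector) \<Rightarrow> bool" where
  "isometric f \<longleftrightarrow> (\<forall>x y. dist (f x) (f y) = dist x y)"

definition algebra_iso :: "('a::complex_algebra \<Rightarrow> 'b::complex_algebra) \<Rightarrow> bool" where
  "algebra_iso f \<longleftrightarrow> bij f \<and> clinear f \<and> (\<forall>x y. f (x * y) = f x * f y)"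

definition star_iso :: "('a::complex_star_algebra \<Rightarrow> 'b::complex_star_algebra) \<Rightarrow> bool" where
  "star_iso f \<longleftrightarrow> algebra_iso f \<and> (\<forall>x. f (star x) = star (f x))"

text \<open>Existence and uniqueness of the described maps are shown in the lemmas \<open>ptensor_map\<close>
  (for bounded linear \<open>\<phi>\<close> and \<open>\<psi>\<close>) and \<open>ptensor_flip\<close> below.\<close>

definition ptensor_map ::
  "('a::complex_normed_vector \<Rightarrow> 'c::complex_normed_vector) \<Rightarrow>
   ('b::complex_normed_vector \<Rightarrow> 'd::complex_normed_vector) \<Rightarrow> ('a, 'b) ptensor \<Rightarrow> ('c, 'd) ptensor" where
  "ptensor_map \<phi> \<psi> =
    (THE f. clinear f \<and> continuous_on UNIV f \<and> (\<forall>x y. f (x \<otimes>\<^sub>\<gamma> y) = \<phi> x \<otimes>\<^sub>\<gamma> \<psi> y))"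

definition ptensor_flip ::
  "('a::complex_normed_vector, 'b::complex_normed_vector) ptensor \<Rightarrow> ('b, 'a) ptensor" where
  "ptensor_flip = (THE f. clinear f \<and> continuous_on UNIV f \<and> (\<forall>x y. f (x \<otimes>\<^sub>\<gamma> y) = y \<otimes>\<^sub>\<gamma> x))"

lemma ptensor_ext:
  fixes f g :: "('a::complex_normed_vector, 'b::complex_normed_vector) ptensor \<Rightarrow> 'c::complex_normed_vector"
  assumes f: "clinear f" "continuous_on UNIV f" and g: "clinear g" "continuous_on UNIV g"
    and eq: "\<And>x y. f (x \<otimes>\<^sub>\<gamma> y) = g (x \<otimes>\<^sub>\<gamma> y)"
  shows "f = g"
proof
  fix z :: "('a, 'b) ptensor"
  have 0: "f 0 = 0" "g 0 = 0"
    using f(1) g(1) by (metis clinear_def scaleC_zero_left)+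
  have *: "f (of_atensor u) = g (of_atensor u)" for u
  proof (induction u rule: atensor_induct)
    case (add x y u)
    then show ?case
      using f(1) g(1) eq[of x y] by (simp add: clinear_def of_atensor_add ptensor_elem_def)
  qed (simp add: of_atensor_zero 0)
  obtain X where X: "proj_Cauchy X" "z = abs_ptensor X" by (rule ptensor_cases)
  have "(\<lambda>n. f (of_atensor (X n))) \<longlonglongrightarrow> f z" "(\<lambda>n. g (of_atensor (X n))) \<longlonglongrightarrow> g z"
    unfolding X(2)
    by (auto intro!: continuous_on_tendsto_compose[OF f(2)] continuous_on_tendsto_compose[OF g(2)]
        abs_ptensor_limit X(1))
  then show "f z = g z" by (auto simp: * intro: LIMSEQ_unique)
qed

lemma ptensor_extension:
  fixes h :: "'a::complex_normed_vector \<Rightarrow> 'b::complex_normed_vector \<Rightarrow> 'c::complex_banach"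
  assumes l: "\<And>y. clinear (\<lambda>x. h x y)" and r: "\<And>x. clinear (h x)"
    and K: "0 \<le> K" "\<And>x y. norm (h x y) \<le> K * (norm x * norm y)"
  shows "\<exists>!f. clinear f \<and> continuous_on UNIV f \<and> (\<forall>x y. f (x \<otimes>\<^sub>\<gamma> y) = h x y)"
proof -
  have "balanced h"
    using l r unfolding balanced_def clinear_def by auto
  then obtain f where add: "\<And>u v. f (u + v) = f u + f v" and E: "\<And>x y. f (x \<otimes>\<^sub>a y) = h x y"
    using balanced_factor by blast
  have f0: "f 0 = 0" using add[of 0 0] by simp
  have S: "f (c *\<^sub>C u) = c *\<^sub>C f u" for c u
  proof (induction u rule: atensor_induct)
    case (add x y u)
    have "f (c *\<^sub>C (x \<otimes>\<^sub>a y)) = c *\<^sub>C f (x \<otimes>\<^sub>a y)"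
      using l by (simp add: E clinear_def flip: elem_tensor_scaleC_left)
    with add show ?case by (simp add: scaleC_add_right \<open>\<And>u v. f (u + v) = f u + f v\<close>)
  qed (simp add: scaleC_zero_right f0)
  have D: "f (u - v) = f u - f v" for u v
    using add[of "u - v" v] by simp
  have B: "norm (f u) \<le> K * proj_norm u" for u
    by (rule proj_norm_bound[where q = norm]) (auto simp: add E K norm_triangle_ineq)
  define F where "F z = lim (\<lambda>n. f (rep_ptensor z n))" for z
  have cauchy: "Cauchy (\<lambda>n. f (X n))" if X: "proj_Cauchy X" for X
  proof (rule metric_CauchyI)
    fix e :: real assume "e > 0"
    then have "e / (K + 1) > 0" using K by simp
    then obtain N where N: "proj_norm (X m - X n) < e / (K + 1)" if "m \<ge> N" "n \<ge> N" for m n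
      using X unfolding proj_Cauchy_def by blast
    have "dist (f (X m)) (f (X n)) < e" if "m \<ge> N" "n \<ge> N" for m n
    proof -
      have "norm (f (X m) - f (X n)) \<le> K * proj_norm (X m - X n)"
        using B[of "X m - X n"] by (simp add: D)
      also have "\<dots> \<le> (K + 1) * proj_norm (X m - X n)"
        by (intro mult_right_mono proj_norm_nonneg) auto
      also have "\<dots> < e"
        using N[OF that] K(1) by (simp add: field_simps)
      finally show ?thesis by (simp add: dist_norm)
    qed
    then show "\<exists>N. \<forall>m\<ge>N. \<forall>n\<ge>N. dist (f (X m)) (f (X n)) < e" by blast
  qed
  have F: "(\<lambda>n. f (X n)) \<longlonglongrightarrow> F (abs_ptensor X)" if X: "proj_Cauchy X" for X
  proof -
    let ?R = "rep_ptensor (abs_ptensor X)"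
    have "ptensor_rel ?R X"
      using Quotient_rep_abs[OF Quotient_ptensor] X by (simp add: ptensor_rel_refl)
    then have R: "proj_Cauchy ?R" and n: "(\<lambda>n. proj_norm (?R n - X n)) \<longlonglongrightarrow> 0"
      by (auto simp: ptensor_rel_def)
    have RF: "(\<lambda>n. f (?R n)) \<longlonglongrightarrow> F (abs_ptensor X)"
      unfolding F_def using Cauchy_convergent[OF cauchy[OF R]] by (simp add: convergent_LIMSEQ_iff)
    have "(\<lambda>n. norm (f (?R n) - f (X n))) \<longlonglongrightarrow> 0"
    proof (rule null_le)
      show "(\<lambda>n. K * proj_norm (?R n - X n)) \<longlonglongrightarrow> 0"
        using tendsto_mult[OF tendsto_const[of K] n] by simp
    qed (use B in \<open>auto simp flip: D\<close>)
    then have "(\<lambda>n. f (?R n) - f (X n)) \<longlonglongrightarrow> 0" by (simp add: tendsto_norm_zero_iff)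
    from tendsto_diff[OF RF this] show ?thesis by simp
  qed
  have Fadd: "F (u + v) = F u + F v" for u v
  proof -
    obtain X where X: "proj_Cauchy X" "u = abs_ptensor X" by (rule ptensor_cases)
    obtain Y where Y: "proj_Cauchy Y" "v = abs_ptensor Y" by (rule ptensor_cases)
    show ?thesis
      using F[OF proj_Cauchy_add[OF X(1) Y(1)]] tendsto_add[OF F[OF X(1)] F[OF Y(1)]]
      by (auto simp: X Y abs_ptensor_add add intro: LIMSEQ_unique)
  qed
  have FB: "norm (F u) \<le> norm u * K" for u
  proof -
    obtain X where X: "proj_Cauchy X" "u = abs_ptensor X" by (rule ptensor_cases)
    have "norm (F u) \<le> K * norm u"
      unfolding X(2)
      by (rule LIMSEQ_le[OF tendsto_norm[OF F[OF X(1)]]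
            tendsto_mult[OF tendsto_const norm_abs_ptensor[OF X(1)]]])
         (auto simp: B)
    then show ?thesis by (simp add: mult.commute)
  qed
  have FS: "F (c *\<^sub>C u) = c *\<^sub>C F u" for c u
  proof -
    obtain X where X: "proj_Cauchy X" "u = abs_ptensor X" by (rule ptensor_cases)
    have "(\<lambda>n. c *\<^sub>C f (X n) - c *\<^sub>C F u) \<longlonglongrightarrow> 0"
    proof -
      have "(\<lambda>n. cmod c * norm (f (X n) - F u)) \<longlonglongrightarrow> cmod c * 0"
        using F[OF X(1)] unfolding X(2)
        by (intro tendsto_mult tendsto_const tendsto_norm_zero) (simp add: LIM_zero)
      then show ?thesis
        by (subst tendsto_norm_zero_iff[symmetric]) (simp add: norm_scaleC flip: scaleC_diff_right)
    qed
    then have "(\<lambda>n. c *\<^sub>C f (X n)) \<longlonglongrightarrow> c *\<^sub>C F u" by (simp add: LIM_zero_iff)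
    with F[OF proj_Cauchy_scaleC[OF X(1)], of c] show ?thesis
      by (auto simp: X abs_ptensor_scaleC S intro: LIMSEQ_unique)
  qed
  have FE: "F (x \<otimes>\<^sub>\<gamma> y) = h x y" for x y
    using F[OF proj_Cauchy_const[of "x \<otimes>\<^sub>a y"]]
    by (simp add: ptensor_elem_def of_atensor_def E LIMSEQ_const_iff)
  have "bounded_linear F"
    by (rule bounded_linear_intro[where K = K]) (simp_all add: Fadd FS FB scaleR_scaleC)
  then have "continuous_on UNIV F"
    by (simp add: linear_continuous_on)
  with Fadd FS FE have "clinear F \<and> continuous_on UNIV F \<and> (\<forall>x y. F (x \<otimes>\<^sub>\<gamma> y) = h x y)"
    by (simp add: clinear_def)
  then show ?thesis
  proof (rule ex1I[of _ F])
    fix G assume "clinear G \<and> continuous_on UNIV G \<and> (\<forall>x y. G (x \<otimes>\<^sub>\<gamma> y) = h x y)"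
    with \<open>clinear F \<and> _\<close> show "G = F"
      by (intro ptensor_ext) simp_all
  qed
qed

lemma ptensor_elem_clinear_left: "clinear (\<lambda>x. x \<otimes>\<^sub>\<gamma> y)"
  by (simp add: clinear_def ptensor_elem_def elem_tensor_add_left elem_tensor_scaleC_left
      of_atensor_add of_atensor_scaleC)

lemma ptensor_elem_clinear_right: "clinear (\<lambda>y. x \<otimes>\<^sub>\<gamma> y)"
  by (simp add: clinear_def ptensor_elem_def elem_tensor_add_right elem_tensor_scaleC_right
      of_atensor_add of_atensor_scaleC)

lemma norm_ptensor_elem_le: "norm (x \<otimes>\<^sub>\<gamma> y) \<le> norm x * norm y"
  by (simp add: ptensor_elem_def norm_of_atensor proj_norm_elem_le)

lemma ptensor_map:
  assumes \<phi>: "clinear \<phi>" "0 \<le> K" "\<And>x. norm (\<phi> x) \<le> K * norm x"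
    and \<psi>: "clinear \<psi>" "0 \<le> L" "\<And>x. norm (\<psi> x) \<le> L * norm x"
  shows "clinear (ptensor_map \<phi> \<psi>)" "continuous_on UNIV (ptensor_map \<phi> \<psi>)"
    "ptensor_map \<phi> \<psi> (x \<otimes>\<^sub>\<gamma> y) = \<phi> x \<otimes>\<^sub>\<gamma> \<psi> y"
proof -
  have "\<exists>!f. clinear f \<and> continuous_on UNIV f \<and> (\<forall>x y. f (x \<otimes>\<^sub>\<gamma> y) = \<phi> x \<otimes>\<^sub>\<gamma> \<psi> y)"
  proof (rule ptensor_extension)
    show "clinear (\<lambda>x. \<phi> x \<otimes>\<^sub>\<gamma> \<psi> y)" "clinear (\<lambda>y. \<phi> x \<otimes>\<^sub>\<gamma> \<psi> y)" for x y
      using \<phi>(1) \<psi>(1)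
      by (simp_all add: clinear_def ptensor_elem_clinear_left[unfolded clinear_def]
          ptensor_elem_clinear_right[unfolded clinear_def])
    show "0 \<le> K * L" using \<phi>(2) \<psi>(2) by simp
    fix x y
    have "norm (\<phi> x \<otimes>\<^sub>\<gamma> \<psi> y) \<le> (K * norm x) * (L * norm y)"
      by (rule order_trans[OF norm_ptensor_elem_le]) (intro mult_mono \<phi> \<psi>; simp add: \<phi>)
    then show "norm (\<phi> x \<otimes>\<^sub>\<gamma> \<psi> y) \<le> K * L * (norm x * norm y)" by (simp add: ac_simps)
  qed
  from theI'[OF this] show "clinear (ptensor_map \<phi> \<psi>)" "continuous_on UNIV (ptensor_map \<phi> \<psi>)"
    "ptensor_map \<phi> \<psi> (x \<otimes>\<^sub>\<gamma> y) = \<phi> x \<otimes>\<^sub>\<gamma> \<psi> y"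
    unfolding ptensor_map_def by auto
qed

lemma ptensor_flip:
  shows "clinear ptensor_flip" "continuous_on UNIV ptensor_flip" "ptensor_flip (x \<otimes>\<^sub>\<gamma> y) = y \<otimes>\<^sub>\<gamma> x"
proof -
  have "\<exists>!f. clinear f \<and> continuous_on UNIV f \<and> (\<forall>x y. f (x \<otimes>\<^sub>\<gamma> y) = y \<otimes>\<^sub>\<gamma> x)"
    by (rule ptensor_extension[where K = 1])
       (auto simp: ptensor_elem_clinear_left ptensor_elem_clinear_right
          intro: order_trans[OF norm_ptensor_elem_le])
  from theI'[OF this] show "clinear ptensor_flip" "continuous_on UNIV ptensor_flip"
    "ptensor_flip (x \<otimes>\<^sub>\<gamma> y) = y \<otimes>\<^sub>\<gamma> x"
    unfolding ptensor_flip_def by auto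
qed

end

theory Submission
  imports Defs
begin

text \<open>
  Write \<open>T\<close> for \<open>A \<otimes>\<^sub>\<gamma> B\<close>. A state of a unital normed algebra is a linear functional of norm one
  that is \<open>1\<close> at \<open>1\<close>; an element is Hermitian if every state is real at it. An isometric
  isomorphism fixes \<open>1\<close>, so composition with it turns states into states, and therefore it preserves
  Hermitian elements. The self-adjoint elements of a C*-algebra are Hermitian, and so are the
  \<open>a \<otimes> 1\<close> and \<open>1 \<otimes> b\<close> in \<open>T\<close> with \<open>a\<close>, \<open>b\<close> self-adjoint. The theorem follows from a description of the
  Hermitian elements of \<open>T\<close> that can be images of these.

  Let \<open>F\<close> be a state of \<open>T\<close> that respects the involution, and let \<open>f = F(\<cdot> \<otimes> 1)\<close> and \<open>g = F(1 \<otimes> \<cdot>)\<close>. For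
  self-adjoint \<open>a\<close>, \<open>b\<close> the inequality \<open>|F(e\<^sup>i\<^sup>r\<^sup>a \<otimes> e\<^sup>i\<^sup>r\<^sup>b)| \<le> 1\<close>, expanded to second order in \<open>r\<close>, says that the
  covariance \<open>F(a \<otimes> b) - f(a) g(b)\<close> is dominated by the variances of \<open>a\<close> under \<open>f\<close> and of \<open>b\<close> under \<open>g\<close>
  (\<open>state_covariance_bound\<close>). Hence \<open>f \<otimes> g + (\<i>/2) (F - f \<otimes> g)\<close> is again a state. A Hermitian \<open>u\<close> makes
  all of \<open>F\<close>, \<open>f \<otimes> g\<close> and this state real, which leaves only \<open>F(u) = (f \<otimes> g)(u)\<close>
  (\<open>hermitian_state_factor\<close>). Taking for \<open>F\<close> the mean of two product states one finds that every
  \<open>(f - f') \<otimes> (g - g')\<close> vanishes at \<open>u\<close>. States separate the points (\<open>states_separate\<close>), so a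
  Hermitian \<open>u\<close> with \<open>u* = u\<close> has the form \<open>a \<otimes> 1 + 1 \<otimes> b\<close> (\<open>hermitian_self_adjoint_sum\<close>).

  If \<open>u = \<theta>(a \<otimes> 1)\<close> with \<open>a\<close> self-adjoint, then \<open>u\<^sup>2\<close> is Hermitian as well. The mixed term of the square of
  \<open>a' \<otimes> 1 + 1 \<otimes> b'\<close> is \<open>2 a' \<otimes> b'\<close>, and it can have the required form only if \<open>a'\<close> or \<open>b'\<close> is a scalar. As \<open>\<theta>\<close>
  is not known to respect the involution, \<open>u\<close> may a priori have a skew part \<open>w\<close>; product functionals
  vanish at \<open>w\<close>, which gives \<open>w\<^sup>2 = 0\<close>, and a Hermitian element of square zero is zero
  (\<open>hermitian_with_square\<close>). So \<open>\<theta>(a \<otimes> 1)\<close> lies in \<open>A \<otimes> 1\<close> or in \<open>1 \<otimes> B\<close>, and by linearity the same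
  alternative holds for all \<open>a\<close>; likewise for \<open>\<theta>(1 \<otimes> b)\<close>. If the two legs go to different legs, \<open>\<theta>\<close> is
  \<open>\<phi> \<otimes> \<psi>\<close> or its flipped form. If both go to the same leg, the algebra of the other leg consists of
  scalars, and this is a special case of \<open>\<phi> \<otimes> \<psi>\<close>.

  The second part reduces to the first: between unital C*-algebras the *-isomorphisms are the
  isometric isomorphisms (\<open>star_iso_iff_isometric\<close>).
\<close>

section \<open>Unital normed algebras and their states\<close>

text \<open>The norm of the unit is only bounded by one, so that the zero algebra is an instance.\<close>

class complex_normed_unital_algebra = complex_normed_algebra + monoid_mult +
  assumes norm_one_le: "norm 1 \<le> 1"

instance unital_cstar_algebra \<subseteq> complex_normed_unital_algebra
proof
  have "star (1::'a) = 1"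
    by (metis mult_1_left mult_1_right star_mult star_star)
  then have "(norm (1::'a))\<^sup>2 = norm (1::'a)"
    using cstar_identity[of "1::'a"] by simp
  then have "(1::'a) = 0 \<or> norm (1::'a) = 1"
    by (simp add: power2_eq_square)
  then show "norm (1::'a) \<le> 1"
    by auto
qed

lemma star_one: "star 1 = (1::'a::unital_cstar_algebra)"
  by (metis mult_1_left mult_1_right star_mult star_star)

text \<open>With this instance functionals are linear maps like any other, and the universal property of
  the projective tensor product applies to them.\<close>

instantiation complex :: complex_banach
begin

definition scaleC_complex :: "complex \<Rightarrow> complex \<Rightarrow> complex"
  where "scaleC_complex c z = c * z"

instance
  by standard
     (simp_all add: scaleC_complex_def distrib_left distrib_right mult.assoc norm_mult scaleR_conv_of_real)

end

definition state :: "('x::complex_normed_unital_algebra \<Rightarrow> complex) \<Rightarrow> bool" where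
  "state F \<longleftrightarrow> clinear F \<and> (\<forall>x. cmod (F x) \<le> norm x) \<and> F 1 = 1"

lemma clinear_add: "clinear f \<Longrightarrow> f (x + y) = f x + f y"
  by (simp add: clinear_def)

lemma clinear_scaleC: "clinear f \<Longrightarrow> f (c *\<^sub>C x) = c *\<^sub>C f x"
  by (simp add: clinear_def)

lemma clinear_zero: "clinear f \<Longrightarrow> f 0 = 0"
  by (metis clinear_scaleC scaleC_zero_left)

lemma clinear_diff: "clinear f \<Longrightarrow> f (x - y) = f x - f y"
  by (metis clinear_add add_diff_cancel_right' diff_add_cancel)

lemma clinear_minus: "clinear f \<Longrightarrow> f (- x) = - f x"
  using clinear_diff[of f 0 x] by (simp add: clinear_zero)

lemma clinear_sum: "clinear f \<Longrightarrow> f (\<Sum>i\<in>S. g i) = (\<Sum>i\<in>S. f (g i))"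
  by (induction S rule: infinite_finite_induct) (auto simp: clinear_zero clinear_add)

lemma clinear_scaleR: "clinear f \<Longrightarrow> f (r *\<^sub>R x) = r *\<^sub>R f x"
  by (simp add: scaleR_scaleC clinear_scaleC)

lemma clinear_complexD:
  fixes f :: "'x::complex_vector \<Rightarrow> complex"
  assumes "clinear f"
  shows "f (c *\<^sub>C x) = c * f x"
  using clinear_scaleC[OF assms] by (simp add: scaleC_complex_def)

lemma stateD:
  assumes "state F"
  shows "clinear F" "cmod (F x) \<le> norm x" "F 1 = 1"
  using assms by (auto simp: state_def)

lemma norm_one: "(1::'x::complex_normed_unital_algebra) \<noteq> 0 \<Longrightarrow> norm (1::'x) = 1"
proof -
  assume "(1::'x) \<noteq> 0"
  moreover have "norm (1::'x) \<le> norm (1::'x) * norm (1::'x)"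
    using norm_mult_ineq[of "1::'x" 1] by simp
  ultimately have "1 \<le> norm (1::'x)" by simp
  with norm_one_le show ?thesis by (rule antisym)
qed

lemma zero_if_one_zero: "(1::'x::complex_normed_unital_algebra) = 0 \<Longrightarrow> (x::'x) = 0"
  by (metis mult_1_left mult_zero_left)

section \<open>The Hahn-Banach theorem and existence of states\<close>

definition sublinear :: "('x::real_vector \<Rightarrow> real) \<Rightarrow> bool" where
  "sublinear q \<longleftrightarrow> (\<forall>x y. q (x + y) \<le> q x + q y) \<and> (\<forall>c x. 0 \<le> c \<longrightarrow> q (c *\<^sub>R x) = c * q x)"

text \<open>The infimum makes a sublinear \<open>q\<close> linear in the direction of \<open>y\<close>. The Hahn-Banach theorem needs
  no other construction, since a minimal sublinear functional cannot be lowered in any direction.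
  The tilt of the norm in the direction of the unit, \<open>inf\<^sub>t (\<parallel>z + t 1\<parallel> - t)\<close>, is the one-sided
  derivative of the norm at \<open>1\<close> towards \<open>z\<close>, and a linear functional below it is automatically \<open>1\<close> at \<open>1\<close>.\<close>

definition tilt :: "('x::real_vector \<Rightarrow> real) \<Rightarrow> 'x \<Rightarrow> 'x \<Rightarrow> real" where
  "tilt q y x = (INF t\<in>{0..}. q (x + t *\<^sub>R y) - t * q y)"

lemma sublinear_ge: "sublinear q \<Longrightarrow> - q (- x) \<le> q x"
proof -
  assume q: "sublinear q"
  have "q 0 = 0"
    using q unfolding sublinear_def by (metis mult_zero_left order_refl scaleR_zero_left)
  moreover have "q (x + - x) \<le> q x + q (- x)"
    using q unfolding sublinear_def by blast
  ultimately show ?thesis by simp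
qed

lemma tilt_bdd:
  assumes q: "sublinear q"
  shows "bdd_below ((\<lambda>t. q (x + t *\<^sub>R y) - t * q y) ` {0..})"
proof (rule bdd_belowI2[where m = "- q (- x)"])
  fix t :: real assume t: "t \<in> {0..}"
  have "q (t *\<^sub>R y) \<le> q (x + t *\<^sub>R y) + q (- x)"
    using q unfolding sublinear_def by (metis add.commute add_minus_cancel)
  moreover have "q (t *\<^sub>R y) = t * q y"
    using q t unfolding sublinear_def by simp
  ultimately show "- q (- x) \<le> q (x + t *\<^sub>R y) - t * q y" by simp
qed

lemma tilt_le:
  assumes "sublinear q" "0 \<le> t"
  shows "tilt q y x \<le> q (x + t *\<^sub>R y) - t * q y"
  unfolding tilt_def by (rule cINF_lower[OF tilt_bdd[OF assms(1)]]) (use assms in auto)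

lemma le_tilt: "(\<And>t. 0 \<le> t \<Longrightarrow> r \<le> q (x + t *\<^sub>R y) - t * q y) \<Longrightarrow> r \<le> tilt q y x"
  unfolding tilt_def by (rule cINF_greatest) auto

lemma tilt_le_self: "sublinear q \<Longrightarrow> tilt q y x \<le> q x"
  using tilt_le[of q 0 y x] by simp

lemma tilt_uminus: "sublinear q \<Longrightarrow> tilt q y (- y) \<le> - q y"
proof -
  assume q: "sublinear q"
  have "q 0 = 0"
    using q unfolding sublinear_def by (metis mult_zero_left order_refl scaleR_zero_left)
  then show ?thesis using tilt_le[OF q, of 1 y "- y"] by simp
qed

lemma sublinear_tilt:
  assumes q: "sublinear q"
  shows "sublinear (tilt q y)"
  unfolding sublinear_def
proof (intro conjI allI impI)
  have add: "q (a + b) \<le> q a + q b" for a b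
    using q unfolding sublinear_def by blast
  fix x x'
  have "tilt q y (x + x') - (q (x + t *\<^sub>R y) - t * q y) \<le> tilt q y x'" if t: "0 \<le> t" for t
  proof (rule le_tilt)
    fix s :: real assume s: "0 \<le> s"
    have "tilt q y (x + x') \<le> q ((x + x') + (t + s) *\<^sub>R y) - (t + s) * q y"
      using s t by (intro tilt_le q) simp
    also have "(x + x') + (t + s) *\<^sub>R y = (x + t *\<^sub>R y) + (x' + s *\<^sub>R y)"
      by (simp add: algebra_simps)
    also have "q \<dots> \<le> q (x + t *\<^sub>R y) + q (x' + s *\<^sub>R y)" by (rule add)
    finally show "tilt q y (x + x') - (q (x + t *\<^sub>R y) - t * q y) \<le> q (x' + s *\<^sub>R y) - s * q y"
      by (simp add: algebra_simps)
  qed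
  then have "tilt q y (x + x') - tilt q y x' \<le> tilt q y x"
    by (intro le_tilt) (simp add: algebra_simps)
  then show "tilt q y (x + x') \<le> tilt q y x + tilt q y x'" by simp
next
  have scale: "q (c *\<^sub>R a) = c * q a" if "0 \<le> c" for c a
    using q that unfolding sublinear_def by blast
  have le: "tilt q y (c *\<^sub>R x) \<le> c * tilt q y x" if c: "0 < c" for c x
  proof -
    have "tilt q y (c *\<^sub>R x) / c \<le> tilt q y x"
    proof (rule le_tilt)
      fix t :: real assume t: "0 \<le> t"
      have "tilt q y (c *\<^sub>R x) \<le> q (c *\<^sub>R x + (c * t) *\<^sub>R y) - (c * t) * q y"
        using c t by (intro tilt_le q) simp
      also have "c *\<^sub>R x + (c * t) *\<^sub>R y = c *\<^sub>R (x + t *\<^sub>R y)" by (simp add: algebra_simps)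
      also have "q \<dots> = c * q (x + t *\<^sub>R y)" using c by (intro scale) simp
      finally show "tilt q y (c *\<^sub>R x) / c \<le> q (x + t *\<^sub>R y) - t * q y"
        using c by (simp add: field_simps)
    qed
    then show ?thesis using c by (simp add: field_simps)
  qed
  fix c :: real and x assume c: "0 \<le> c"
  show "tilt q y (c *\<^sub>R x) = c * tilt q y x"
  proof (cases "c = 0")
    case True
    have "q (t *\<^sub>R y) - t * q y = 0" if "0 \<le> t" for t using scale that by simp
    then have "tilt q y 0 = (INF t\<in>{0..}::real set. 0)"
      unfolding tilt_def by (intro INF_cong) auto
    with True show ?thesis by simp
  next
    case False
    with c have c: "0 < c" by simp
    have "tilt q y (inverse c *\<^sub>R c *\<^sub>R x) \<le> inverse c * tilt q y (c *\<^sub>R x)"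
      using c by (intro le) simp
    then have "c * tilt q y x \<le> tilt q y (c *\<^sub>R x)" using c by (simp add: field_simps)
    with le[OF c, of x] show ?thesis by simp
  qed
qed

text \<open>By Zorn's lemma there is a minimal sublinear functional below the tilt of \<open>p\<close> towards \<open>z\<close>. It equals
  all its tilts, hence is linear, and lying below \<open>tilt p z\<close> it attains \<open>p\<close> at \<open>z\<close>.\<close>

lemma hahn_banach:
  fixes p :: "'x::real_vector \<Rightarrow> real"
  assumes p: "sublinear p"
  obtains F where "linear F" "\<And>x. F x \<le> p x" "F z = p z"
proof -
  define A where "A = {q. sublinear q \<and> q \<le> tilt p z}"
  have "\<exists>m\<in>A. \<forall>a\<in>A. a \<le> m \<longrightarrow> a = m"
  proof (rule predicate_Zorn[where P = "\<lambda>a b. b \<le> a", simplified])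
    show "partial_order_on A (relation_of (\<lambda>a b. b \<le> a) A)"
      by (auto simp: partial_order_on_def preorder_on_def refl_on_def trans_def antisym_def
          relation_of_def)
  next
    fix C assume C: "C \<in> Chains (relation_of (\<lambda>a b::'x \<Rightarrow> real. b \<le> a) A)"
    have CA: "C \<subseteq> A" and tot: "\<And>a b. a \<in> C \<Longrightarrow> b \<in> C \<Longrightarrow> a \<le> b \<or> b \<le> a"
      using C unfolding Chains_def relation_of_def by blast+
    show "\<exists>u\<in>A. \<forall>a\<in>C. u \<le> a"
    proof (cases "C = {}")
      case True
      then show ?thesis using sublinear_tilt[OF p] by (auto simp: A_def)
    next
      case False
      define u where "u x = (INF q\<in>C. q x)" for x
      have qs: "sublinear q" "q x \<le> tilt p z x" if "q \<in> C" for q x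
        using that CA by (auto simp: A_def le_fun_def)
      have bdd: "bdd_below ((\<lambda>q. q x) ` C)" for x
      proof (rule bdd_belowI2)
        fix q assume "q \<in> C"
        from sublinear_ge[OF qs(1)[OF this], of x] qs(2)[OF this, of "- x"]
        show "- tilt p z (- x) \<le> q x" by simp
      qed
      have u_le: "u x \<le> q x" if "q \<in> C" for q x
        unfolding u_def by (rule cINF_lower[OF bdd that])
      have le_u: "r \<le> u x" if "\<And>q. q \<in> C \<Longrightarrow> r \<le> q x" for r x
        unfolding u_def by (rule cINF_greatest[OF False that])
      have "sublinear u"
        unfolding sublinear_def
      proof (intro conjI allI impI)
        fix x y
        have "u (x + y) - q x \<le> q' y" if q: "q \<in> C" "q' \<in> C" for q q'
        proof -
          obtain m where m: "m \<in> C" "m \<le> q" "m \<le> q'"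
            using tot[OF q] q by blast
          have "u (x + y) \<le> m (x + y)" by (rule u_le[OF m(1)])
          also have "\<dots> \<le> m x + m y" using qs(1)[OF m(1)] unfolding sublinear_def by blast
          also have "\<dots> \<le> q x + q' y" using m(2,3) by (intro add_mono) (auto simp: le_fun_def)
          finally show ?thesis by simp
        qed
        then have "u (x + y) - q x \<le> u y" if "q \<in> C" for q using that by (intro le_u) auto
        then have "u (x + y) - u y \<le> u x" by (intro le_u) (simp add: algebra_simps)
        then show "u (x + y) \<le> u x + u y" by simp
      next
        fix c :: real and x assume c: "0 \<le> c"
        have *: "q (c *\<^sub>R x) = c * q x" if "q \<in> C" "0 \<le> c" for q c x
          using qs(1)[OF that(1)] that(2) unfolding sublinear_def by blast
        show "u (c *\<^sub>R x) = c * u x"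
        proof (cases "c = 0")
          case True
          have "q 0 = 0" if "q \<in> C" for q using *[OF that, of 0] by simp
          then have "(\<lambda>q. q 0) ` C = {0}" using False by force
          then have "u 0 = 0" by (simp add: u_def)
          with True show ?thesis by simp
        next
          case False
          with c have c: "0 < c" by simp
          have "u (c *\<^sub>R x) / c \<le> u x"
            using u_le[of _ "c *\<^sub>R x"] c by (intro le_u) (auto simp: * field_simps)
          moreover have "c * u x \<le> u (c *\<^sub>R x)"
            using u_le[of _ x] c by (intro le_u) (auto simp: *)
          ultimately show ?thesis using c by (simp add: field_simps)
        qed
      qed
      moreover have "u \<le> tilt p z"
        using False u_le qs(2) by (fastforce simp: le_fun_def intro: order_trans)
      ultimately show ?thesis using u_le by (auto simp: A_def le_fun_def)
    qed
  qed
  then obtain F where F: "sublinear F" "F \<le> tilt p z" and min: "\<And>a. sublinear a \<Longrightarrow> a \<le> F \<Longrightarrow> a = F"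
    unfolding A_def by (auto intro: order_trans)
  have minus: "F (- y) = - F y" for y
  proof -
    have "tilt F y = F"
      by (rule min[OF sublinear_tilt[OF F(1)]]) (auto simp: le_fun_def tilt_le_self F(1))
    then show ?thesis using tilt_uminus[OF F(1), of y] sublinear_ge[OF F(1), of "- y"] by simp
  qed
  have sub: "F (x + y) \<le> F x + F y" for x y using F(1) unfolding sublinear_def by blast
  have add: "F (x + y) = F x + F y" for x y
    using sub[of x y] sub[of "x + y" "- y"] by (simp add: minus)
  have pos: "F (c *\<^sub>R x) = c * F x" if "0 \<le> c" for c x
    using F(1) that unfolding sublinear_def by blast
  have "linear F"
  proof (rule linearI)
    show "F (x + y) = F x + F y" for x y by (rule add)
    show "F (c *\<^sub>R x) = c *\<^sub>R F x" for c x
      using pos[of c x] pos[of "- c" x] minus[of "c *\<^sub>R x"] by (cases "0 \<le> c") auto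
  qed
  moreover have F_le: "F x \<le> p x" for x
    using F(2) tilt_le_self[OF p, of z x] by (auto simp: le_fun_def intro: order_trans)
  moreover have "F z = p z"
  proof -
    have "F (- z) \<le> - p z"
      using F(2) tilt_uminus[OF p, of z] by (auto simp: le_fun_def intro: order_trans)
    with F_le[of z] show ?thesis by (simp add: minus)
  qed
  ultimately show ?thesis using that by blast
qed

lemma sublinear_norm: "sublinear (norm :: 'x::real_normed_vector \<Rightarrow> real)"
  by (simp add: sublinear_def norm_triangle_ineq)

text \<open>The real functional that the Hahn-Banach theorem gives for the tilted norm is the real part of a
  complex one; it has the bound of the norm after multiplication with a phase.\<close>

lemma state_exists:
  fixes z :: "'x::complex_normed_unital_algebra"
  assumes "norm (1::'x) = 1"
  obtains F where "state F" "Re (F z) = tilt norm 1 z"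
proof -
  let ?p = "tilt norm (1::'x)"
  obtain G where G: "linear G" "\<And>x. G x \<le> ?p x" "G z = ?p z"
    using hahn_banach[OF sublinear_tilt[OF sublinear_norm]] by metis
  have G_le: "G x \<le> norm x" for x
    using G(2) tilt_le_self[OF sublinear_norm] by (rule order_trans)
  define F where "F x = Complex (G x) (- G (\<i> *\<^sub>C x))" for x
  have lin: "clinear F"
    unfolding clinear_def
  proof (intro conjI allI)
    show "F (x + y) = F x + F y" for x y
      by (simp add: F_def scaleC_add_right linear_add[OF G(1)] complex_eq_iff)
    fix c x
    have split: "d *\<^sub>C y = Re d *\<^sub>R y + Im d *\<^sub>R \<i> *\<^sub>C y" for d and y :: 'x
    proof -
      have "d = complex_of_real (Re d) + complex_of_real (Im d) * \<i>" by (simp add: complex_eq_iff)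
      then have "d *\<^sub>C y = (complex_of_real (Re d) + complex_of_real (Im d) * \<i>) *\<^sub>C y" by simp
      then show ?thesis by (simp only: scaleC_add_left scaleR_scaleC scaleC_scaleC)
    qed
    have G_split: "G (d *\<^sub>C y) = Re d * G y + Im d * G (\<i> *\<^sub>C y)" for d y
      by (subst split) (simp add: linear_add[OF G(1)] linear_scale[OF G(1)])
    show "F (c *\<^sub>C x) = c *\<^sub>C F x"
      using G_split[of c x] G_split[of "\<i> * c" x]
      by (simp add: F_def scaleC_complex_def complex_eq_iff scaleC_scaleC)
  qed
  have bound: "cmod (F x) \<le> norm x" for x
  proof (cases "F x = 0")
    case False
    define c where "c = cnj (sgn (F x))"
    have c: "c * F x = cmod (F x)" "cmod c = 1"
      using False by (auto simp: c_def sgn_eq complex_norm_square[symmetric] power2_eq_square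
          norm_divide mult.commute)
    have "cmod (F x) = Re (F (c *\<^sub>C x))"
      using lin c(1) by (simp add: clinear_def scaleC_complex_def)
    also have "\<dots> = G (c *\<^sub>C x)" by (simp add: F_def)
    also have "\<dots> \<le> norm x" using G_le[of "c *\<^sub>C x"] by (simp add: norm_scaleC c(2))
    finally show ?thesis .
  qed simp
  have "G (- 1) \<le> - 1"
    using G(2)[of "- 1"] tilt_uminus[OF sublinear_norm, of "1::'x"] assms by simp
  then have "Re (F 1) = 1"
    using G_le[of 1] assms by (simp add: F_def linear_neg[OF G(1)])
  moreover have "cmod (F 1) \<le> 1" using bound[of 1] assms by simp
  ultimately have "F 1 = 1"
    by (simp add: cmod_def complex_eq_iff)
  then have "state F" using lin bound by (simp add: state_def)
  moreover have "Re (F z) = ?p z" by (simp add: F_def G(3))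
  ultimately show ?thesis by (rule that)
qed

section \<open>Elements are determined by the states\<close>

lemma states_exist:
  assumes "(1::'x::complex_normed_unital_algebra) \<noteq> 0"
  obtains F where "state (F :: 'x \<Rightarrow> complex)"
  using state_exists[OF norm_one[OF assms]] by metis

lemma norm_power_le: "norm ((x::'x::complex_normed_unital_algebra) ^ n) \<le> norm x ^ n"
proof (induction n)
  case (Suc n)
  have "norm (x * x ^ n) \<le> norm x * norm (x ^ n)" by (rule norm_mult_ineq)
  also have "\<dots> \<le> norm x * norm x ^ n" by (intro mult_left_mono Suc.IH) simp
  finally show ?case by simp
qed (simp add: norm_one_le)

text \<open>Lets a value of the infimum in \<open>tilt norm 1 z\<close> persist for all larger arguments.\<close>

lemma norm_shift_antimono:
  fixes z :: "'x::complex_normed_unital_algebra"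
  assumes "s \<le> t"
  shows "norm (z + t *\<^sub>R 1) - t \<le> norm (z + s *\<^sub>R 1) - s"
proof -
  have "norm (z + t *\<^sub>R 1) = norm ((z + s *\<^sub>R 1) + (t - s) *\<^sub>R 1)"
    by (simp add: algebra_simps)
  also have "\<dots> \<le> norm (z + s *\<^sub>R 1) + norm ((t - s) *\<^sub>R (1::'x))" by (rule norm_triangle_ineq)
  also have "norm ((t - s) *\<^sub>R (1::'x)) \<le> t - s"
    using assms norm_one_le mult_left_mono[OF norm_one_le, of "t - s"] by simp
  finally show ?thesis by simp
qed

text \<open>The tilted norm at \<open>z\<close> is the largest real part of a state at \<open>z\<close>. If it is not positive, then
  \<open>\<parallel>1 + z/n\<parallel>\<close> exceeds \<open>1\<close> by no more than \<open>e/n\<close>.\<close>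

lemma shift_growth:
  fixes z :: "'x::complex_normed_unital_algebra"
  assumes F: "\<And>F. state F \<Longrightarrow> Re (F z) \<le> 0" and e: "0 < e"
  shows "eventually (\<lambda>n. norm (z + real n *\<^sub>R 1) \<le> real n + e) sequentially"
proof (cases "(1::'x) = 0")
  case True
  have "norm (z + real n *\<^sub>R 1) \<le> real n + e" for n
    using zero_if_one_zero[OF True, of "z + real n *\<^sub>R 1"] e by simp
  then show ?thesis by simp
next
  case False
  obtain G where "state G" "Re (G z) = tilt norm 1 z"
    using state_exists[OF norm_one[OF False]] by metis
  with F have "tilt norm 1 z \<le> 0" by metis
  have "\<exists>t\<ge>0. norm (z + t *\<^sub>R 1) - t < e"
  proof (rule ccontr)
    assume "\<not> ?thesis"
    then have "e \<le> tilt norm 1 z"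
      by (intro le_tilt) (auto simp: norm_one[OF False] not_less)
    with \<open>tilt norm 1 z \<le> 0\<close> e show False by simp
  qed
  then obtain t where t: "t \<ge> 0" "norm (z + t *\<^sub>R 1) - t < e" by blast
  obtain N :: nat where N: "t \<le> real N" using real_arch_simple by blast
  show ?thesis
    unfolding eventually_sequentially
  proof (intro exI allI impI)
    fix n assume "N \<le> n"
    with N have "t \<le> real n" by linarith
    from norm_shift_antimono[OF this, of z] t(2) show "norm (z + real n *\<^sub>R 1) \<le> real n + e" by simp
  qed
qed

text \<open>The powers \<open>(1 + z/n)\<^sup>n\<close> take the place of \<open>exp z\<close>: polynomials in \<open>z\<close> allow Cauchy's estimate
  without power series.\<close>

lemma power_growth:
  fixes z :: "'x::complex_normed_unital_algebra"
  assumes z: "norm (z + real n *\<^sub>R 1) \<le> real n + e" and e: "0 < e" and n: "0 < n"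
  shows "norm ((1 + (1 / real n) *\<^sub>R z) ^ n) \<le> exp e"
proof -
  have "1 + (1 / real n) *\<^sub>R z = (1 / real n) *\<^sub>R (z + real n *\<^sub>R 1)"
    using n by (simp add: algebra_simps)
  then have "norm (1 + (1 / real n) *\<^sub>R z) = norm (z + real n *\<^sub>R 1) / real n" by simp
  also have "\<dots> \<le> 1 + e / real n"
    using z n by (simp add: field_simps)
  also have "\<dots> \<le> exp (e / real n)" by (rule exp_ge_add_one_self)
  finally have "norm (1 + (1 / real n) *\<^sub>R z) ^ n \<le> exp (e / real n) ^ n"
    by (intro power_mono) auto
  also have "\<dots> = exp e" using n by (simp flip: exp_of_nat_mult)
  finally show ?thesis using norm_power_le by (rule order_trans[rotated])
qed

lemma power_coefficients:
  fixes y :: "'x::complex_normed_unital_algebra"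
  shows "\<exists>a. a 1 = real n *\<^sub>R y \<and> (\<forall>c. (1 + c *\<^sub>C y) ^ n = (\<Sum>k\<le>n. c ^ k *\<^sub>C a k))"
proof -
  have "\<exists>a. a 0 = 1 \<and> a 1 = real n *\<^sub>R y \<and> a (Suc n) = 0 \<and>
    (\<forall>c. (1 + c *\<^sub>C y) ^ n = (\<Sum>k\<le>n. c ^ k *\<^sub>C a k))"
  proof (induction n)
    case 0
    show ?case by (rule exI[of _ "\<lambda>k. if k = 0 then 1 else 0"]) (simp add: scaleC_one)
  next
    case (Suc n)
    then obtain a where a: "a 0 = 1" "a 1 = real n *\<^sub>R y" "a (Suc n) = 0"
      "\<And>c. (1 + c *\<^sub>C y) ^ n = (\<Sum>k\<le>n. c ^ k *\<^sub>C a k)" by blast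
    \<comment> \<open>The sum is the product with \<open>1 + c y\<close>; the guards keep the coefficients zero beyond the degree.\<close>
    define b where "b k = (if k \<le> n then a k else 0) + (if k = 0 \<or> k > Suc n then 0 else y * a (k - 1))" for k
    have "(1 + c *\<^sub>C y) ^ Suc n = (\<Sum>k\<le>Suc n. c ^ k *\<^sub>C b k)" for c
    proof -
      have 1: "y * (\<Sum>k\<le>n. c ^ k *\<^sub>C a k) = (\<Sum>k\<le>n. c ^ k *\<^sub>C (y * a k))"
        by (simp add: sum_distrib_left mult_scaleC_right)
      have 2: "c *\<^sub>C (\<Sum>k\<le>n. c ^ k *\<^sub>C (y * a k)) = (\<Sum>k\<le>n. c ^ Suc k *\<^sub>C (y * a k))"
        by (subst clinear_sum[of "(*\<^sub>C) c"])
           (auto simp: clinear_def scaleC_add_right scaleC_scaleC mult.commute)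
      have "(\<Sum>k\<le>Suc n. c ^ k *\<^sub>C b k) = (\<Sum>k\<le>Suc n. c ^ k *\<^sub>C (if k \<le> n then a k else 0)) +
         (\<Sum>k\<le>Suc n. c ^ k *\<^sub>C (if k = 0 \<or> k > Suc n then 0 else y * a (k - 1)))"
        by (simp add: b_def scaleC_add_right sum.distrib)
      also have "(\<Sum>k\<le>Suc n. c ^ k *\<^sub>C (if k \<le> n then a k else 0)) = (\<Sum>k\<le>n. c ^ k *\<^sub>C a k)"
        by (simp add: scaleC_zero_right)
      also have "(\<Sum>k\<le>Suc n. c ^ k *\<^sub>C (if k = 0 \<or> k > Suc n then 0 else y * a (k - 1))) =
          (\<Sum>k\<le>n. c ^ Suc k *\<^sub>C (y * a k))"
        by (subst sum.atMost_Suc_shift) (simp add: scaleC_zero_right)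
      finally show ?thesis
        by (simp add: a(4) distrib_right mult_scaleC_left 1 2)
    qed
    moreover have "b 0 = 1" "b 1 = real (Suc n) *\<^sub>R y" "b (Suc (Suc n)) = 0"
      using a by (auto simp: b_def algebra_simps)
    ultimately show ?case by blast
  qed
  then show ?thesis by blast
qed

text \<open>The linear coefficient \<open>n y\<close> of the polynomial \<open>c \<mapsto> (1 + c y)\<^sup>n\<close> is a mean over the roots of unity of
  order \<open>n + 1\<close>, weighted by their inverses, so it is bounded by the maximum on the unit circle.\<close>

lemma cauchy_estimate:
  fixes y :: "'x::complex_normed_unital_algebra"
  assumes n: "0 < n" and B: "\<And>c. cmod c = 1 \<Longrightarrow> norm ((1 + c *\<^sub>C y) ^ n) \<le> B"
  shows "norm (real n *\<^sub>R y) \<le> B"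
proof -
  obtain a where a: "a 1 = real n *\<^sub>R y" "\<And>c. (1 + c *\<^sub>C y) ^ n = (\<Sum>k\<le>n. c ^ k *\<^sub>C a k)"
    using power_coefficients[of n y] by blast
  define M where "M = Suc n"
  define w where "w = exp (2 * of_real pi * \<i> * of_nat 1 / of_nat M)"
  have M: "1 \<le> M" "2 \<le> M" using n by (auto simp: M_def)
  have w_pow: "w ^ j = exp (2 * of_real pi * \<i> * of_nat j / of_nat M)" for j
    unfolding w_def exp_of_nat_mult[symmetric] by (simp add: mult_ac)
  have w_one: "w ^ j = 1 \<longleftrightarrow> M dvd j" for j
    unfolding w_pow by (rule complex_root_unity_eq_1[OF M(1)])
  have norm_w: "cmod w = 1" by (simp add: w_def)
  have filter: "(\<Sum>j<M. (w ^ j) ^ (M - 1) * (w ^ j) ^ k) = (if k = 1 then of_nat M else 0)" if k: "k \<le> n" for k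
  proof -
    have "(\<Sum>j<M. (w ^ j) ^ (M - 1) * (w ^ j) ^ k) = (\<Sum>j<M. (w ^ (k + n)) ^ j)"
      by (intro sum.cong) (auto simp: M_def algebra_simps simp flip: power_add power_mult)
    also have "\<dots> = (if k = 1 then of_nat M else 0)"
    proof (cases "k = 1")
      case True
      then have "k + n = M" by (simp add: M_def)
      then have "w ^ (k + n) = 1" unfolding w_one by simp
      then show ?thesis using True by simp
    next
      case False
      have "\<not> M dvd k + n"
      proof
        assume "M dvd k + n"
        then obtain q where q: "k + n = M * q" by (auto elim: dvdE)
        have "q < 2"
        proof (rule ccontr)
          assume "\<not> q < 2"
          then have "M * 2 \<le> M * q" by simp
          with q k show False by (simp add: M_def)
        qed
        moreover have "q \<noteq> 0" using q n by (cases q) auto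
        ultimately have "q = 1" by simp
        with q False show False by (simp add: M_def)
      qed
      then have "w ^ (k + n) \<noteq> 1" by (simp add: w_one)
      moreover have "(w ^ (k + n)) ^ M = 1"
        by (simp add: w_one flip: power_mult)
      ultimately show ?thesis using False by (simp add: sum_gp_strict)
    qed
    finally show ?thesis .
  qed
  have scaleC_sum_left: "(\<Sum>j\<in>S. f j) *\<^sub>C (x::'x) = (\<Sum>j\<in>S. f j *\<^sub>C x)" for f :: "nat \<Rightarrow> complex" and S x
    by (induction S rule: infinite_finite_induct) (auto simp: scaleC_zero_left scaleC_add_left)
  have scaleC_sum_right: "c *\<^sub>C (\<Sum>j\<in>S. f j) = (\<Sum>j\<in>S. c *\<^sub>C (f j::'x))" for f :: "nat \<Rightarrow> 'x" and S c
    by (induction S rule: infinite_finite_induct) (auto simp: scaleC_zero_right scaleC_add_right)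
  have "(\<Sum>j<M. (w ^ j) ^ (M - 1) *\<^sub>C (1 + w ^ j *\<^sub>C y) ^ n) =
      (\<Sum>j<M. \<Sum>k\<le>n. ((w ^ j) ^ (M - 1) * (w ^ j) ^ k) *\<^sub>C a k)"
    by (simp add: a(2) scaleC_sum_right scaleC_scaleC)
  also have "\<dots> = (\<Sum>k\<le>n. (\<Sum>j<M. (w ^ j) ^ (M - 1) * (w ^ j) ^ k) *\<^sub>C a k)"
    by (subst sum.swap) (simp add: scaleC_sum_left)
  also have "\<dots> = (\<Sum>k\<le>n. if k = 1 then of_nat M *\<^sub>C a k else 0)"
  proof (rule sum.cong)
    fix k assume "k \<in> {..n}"
    then have "k \<le> n" by simp
    from filter[OF this] show "(\<Sum>j<M. (w ^ j) ^ (M - 1) * (w ^ j) ^ k) *\<^sub>C a k =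
        (if k = 1 then of_nat M *\<^sub>C a k else 0)"
      by (simp only:) (simp add: scaleC_zero_left)
  qed simp
  also have "\<dots> = of_nat M *\<^sub>C a 1" using n by simp
  finally have "real M * norm (a 1) = norm (\<Sum>j<M. (w ^ j) ^ (M - 1) *\<^sub>C (1 + w ^ j *\<^sub>C y) ^ n)"
    by (simp add: norm_scaleC)
  also have "\<dots> \<le> (\<Sum>j<M. B)"
    by (rule order_trans[OF norm_sum sum_mono]) (simp add: norm_scaleC norm_power norm_w B)
  finally have "real M * norm (a 1) \<le> real M * B" by simp
  with M have "norm (a 1) \<le> B" by simp
  then show ?thesis unfolding a(1) .
qed

text \<open>If all states vanish at \<open>z\<close>, then \<open>shift_growth\<close> applies to all complex multiples of \<open>z\<close>, and \<open>(1 + c z/n)\<^sup>n\<close>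
  stays bounded on circles of any radius. As with Liouville's theorem, Cauchy's estimate gives \<open>z = 0\<close>.\<close>

lemma states_separate:
  fixes z :: "'x::complex_normed_unital_algebra"
  assumes F: "\<And>F. state F \<Longrightarrow> F z = 0"
  shows "z = 0"
proof (rule ccontr)
  assume z: "z \<noteq> 0"
  \<comment> \<open>Chosen so that the linear coefficient on the circle of radius \<open>R/2\<close> has norm \<open>exp 1 + 1\<close>.\<close>
  define R where "R = 2 * (exp 1 + 1) / norm z"
  have "eventually (\<lambda>n. norm ((c * R) *\<^sub>C z + real n *\<^sub>R 1) \<le> real n + 1) sequentially" for c :: complex
  proof (rule shift_growth)
    fix F :: "'x \<Rightarrow> complex" assume "state F"
    then have "F ((c * R) *\<^sub>C z) = 0"
      by (simp only: clinear_scaleC[OF stateD(1)] F scaleC_zero_right)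
    then show "Re (F ((c * R) *\<^sub>C z)) \<le> 0" by simp
  qed simp
  then have "eventually (\<lambda>n. norm ((1 * complex_of_real R) *\<^sub>C z + real n *\<^sub>R 1) \<le> real n + 1 \<and>
      norm ((\<i> * complex_of_real R) *\<^sub>C z + real n *\<^sub>R 1) \<le> real n + 1 \<and>
      norm ((-1 * complex_of_real R) *\<^sub>C z + real n *\<^sub>R 1) \<le> real n + 1 \<and>
      norm ((- \<i> * complex_of_real R) *\<^sub>C z + real n *\<^sub>R 1) \<le> real n + 1 \<and> n > 0) sequentially"
    by (intro eventually_conj eventually_gt_at_top) blast+
  then obtain n where n: "norm ((1 * complex_of_real R) *\<^sub>C z + real n *\<^sub>R 1) \<le> real n + 1"
      "norm ((\<i> * complex_of_real R) *\<^sub>C z + real n *\<^sub>R 1) \<le> real n + 1"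
      "norm ((-1 * complex_of_real R) *\<^sub>C z + real n *\<^sub>R 1) \<le> real n + 1"
      "norm ((- \<i> * complex_of_real R) *\<^sub>C z + real n *\<^sub>R 1) \<le> real n + 1" "n > 0"
    by (metis (no_types, lifting) eventually_happens' sequentially_bot)
  let ?y = "(1 / (2 * real n) * R) *\<^sub>R z"
  have "norm ((1 + c *\<^sub>C ?y) ^ n) \<le> exp 1" if c: "cmod c = 1" for c
  proof -
    define p where "p = Re c / 2"
    define q where "q = Im c / 2"
    have pq: "\<bar>p\<bar> + \<bar>q\<bar> \<le> 1"
      using abs_Re_le_cmod[of c] abs_Im_le_cmod[of c] c by (simp add: p_def q_def)
    have ex: "norm ((d * complex_of_real R) *\<^sub>C z + real n *\<^sub>R 1) \<le> real n + 1" if "d \<in> {1, \<i>, -1, -\<i>}" for d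
      using n that by auto
    \<comment> \<open>The point \<open>c/2\<close> is a convex combination of zero and of two fourth roots of unity, so one \<open>n\<close>
      serves for the whole circle.\<close>
    define d1 where "d1 = (if 0 \<le> p then 1 else -1 :: complex)"
    define d2 where "d2 = (if 0 \<le> q then \<i> else -\<i>)"
    have cd: "c / 2 = \<bar>p\<bar> * d1 + \<bar>q\<bar> * d2"
      by (auto simp: complex_eq_iff p_def q_def d1_def d2_def)
    define r where "r = 1 - \<bar>p\<bar> - \<bar>q\<bar>"
    have r: "0 \<le> r" "\<bar>p\<bar> + \<bar>q\<bar> + r = 1" using pq by (auto simp: r_def)
    let ?g = "\<lambda>d. (d * complex_of_real R) *\<^sub>C z + real n *\<^sub>R 1"
    have g0: "norm (?g 0) \<le> real n + 1"
      using mult_left_mono[OF norm_one_le[where ?'a = 'x], of "real n"]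
      by (simp add: scaleC_zero_left del: mult_le_cancel_left1)
    have "?g (c / 2) = \<bar>p\<bar> *\<^sub>R ?g d1 + \<bar>q\<bar> *\<^sub>R ?g d2 + r *\<^sub>R ?g 0"
    proof -
      have unit: "real n *\<^sub>R (1::'x) =
          \<bar>p\<bar> *\<^sub>R real n *\<^sub>R 1 + \<bar>q\<bar> *\<^sub>R real n *\<^sub>R 1 + r *\<^sub>R real n *\<^sub>R 1"
        by (simp only: r(2) scaleR_one flip: scaleR_add_left)
      have arg: "(c / 2 * complex_of_real R) *\<^sub>C z =
          \<bar>p\<bar> *\<^sub>R (d1 * complex_of_real R) *\<^sub>C z + \<bar>q\<bar> *\<^sub>R (d2 * complex_of_real R) *\<^sub>C z"
        by (simp only: cd scaleR_scaleC scaleC_scaleC distrib_right mult.assoc flip: scaleC_add_left)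
      have regroup: "b + a = (y1 + x1) + (y2 + x2) + x3"
        if "a = x1 + x2 + x3" "b = y1 + y2" for a b x1 x2 x3 y1 y2 :: 'x
        using that by (simp add: add_ac)
      show ?thesis
        by (simp only: scaleR_add_right scaleC_zero_left mult_zero_left add_0_left)
           (rule regroup[OF unit arg])
    qed
    then have "norm (?g (c / 2)) \<le> \<bar>p\<bar> * norm (?g d1) + \<bar>q\<bar> * norm (?g d2) + r * norm (?g 0)"
      using r(1)
        norm_triangle_ineq[of "\<bar>p\<bar> *\<^sub>R ?g d1 + \<bar>q\<bar> *\<^sub>R ?g d2" "r *\<^sub>R ?g 0"]
        norm_triangle_ineq[of "\<bar>p\<bar> *\<^sub>R ?g d1" "\<bar>q\<bar> *\<^sub>R ?g d2"]
      by (simp only: norm_scaleR abs_abs abs_of_nonneg)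
    also have "\<dots> \<le> \<bar>p\<bar> * (real n + 1) + \<bar>q\<bar> * (real n + 1) + r * (real n + 1)"
      by (intro add_mono mult_left_mono ex g0 r) (auto simp: d1_def d2_def)
    also have "\<dots> = real n + 1" using r(2) by (metis distrib_right mult_1_left)
    finally have "norm ((c / 2 * complex_of_real R) *\<^sub>C z + real n *\<^sub>R 1) \<le> real n + 1" .
    from power_growth[OF this _ n(5)]
    have "norm ((1 + (1 / real n) *\<^sub>R (c / 2 * complex_of_real R) *\<^sub>C z) ^ n) \<le> exp 1" by simp
    moreover have "(1 / real n) *\<^sub>R (c / 2 * complex_of_real R) *\<^sub>C z = c *\<^sub>C ?y"
      by (simp add: scaleR_scaleC scaleC_scaleC mult_ac)
    ultimately show ?thesis by simp
  qed
  from cauchy_estimate[OF n(5) this] have "norm (real n *\<^sub>R ?y) \<le> exp 1" .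
  moreover have "norm (real n *\<^sub>R ?y) = exp 1 + 1"
  proof -
    have "0 < exp 1 + (1::real)" by (simp add: add_pos_pos)
    then have "0 < R" using z by (simp add: R_def)
    then show ?thesis using z n(5) by (simp add: R_def abs_mult)
  qed
  ultimately show False by simp
qed

definition hermitian :: "'x::complex_normed_unital_algebra \<Rightarrow> bool" where
  "hermitian x \<longleftrightarrow> (\<forall>F. state F \<longrightarrow> Im (F x) = 0)"

text \<open>Here \<open>(1 + \<i> t w/n)\<^sup>n = 1 + \<i> t w\<close>, which is bounded in \<open>t\<close> if \<open>w\<close> is Hermitian.\<close>

lemma hermitian_square_zero:
  fixes w :: "'x::complex_normed_unital_algebra"
  assumes w: "hermitian w" and sq: "w * w = 0"
  shows "w = 0"
proof (rule ccontr)
  assume "w \<noteq> 0"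
  \<comment> \<open>By \<open>power_growth\<close> the norm of \<open>\<i> t w\<close> is at most \<open>exp 1 + 1\<close>, which is less than five.\<close>
  define t where "t = 5 / norm w"
  let ?z = "(\<i> * of_real t) *\<^sub>C w"
  have "eventually (\<lambda>n. norm (?z + real n *\<^sub>R 1) \<le> real n + 1) sequentially"
  proof (rule shift_growth)
    fix F :: "'x \<Rightarrow> complex" assume "state F"
    then have "F ?z = (\<i> * of_real t) * F w"
      by (simp only: clinear_scaleC[OF stateD(1)] scaleC_complex_def)
    with \<open>state F\<close> w show "Re (F ?z) \<le> 0" by (simp add: hermitian_def)
  qed simp
  with eventually_gt_at_top[of 0]
  have "eventually (\<lambda>n. 0 < n \<and> norm (?z + real n *\<^sub>R 1) \<le> real n + 1) sequentially"
    by (rule eventually_conj)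
  then obtain n where n: "0 < n" "norm (?z + real n *\<^sub>R 1) \<le> real n + 1"
    using eventually_happens' sequentially_bot by blast
  have "(1 + y) ^ m = 1 + real m *\<^sub>R y" if "y * y = 0" for y :: 'x and m
    by (induction m) (simp_all add: algebra_simps that)
  moreover have "((1 / real n) *\<^sub>R ?z) * ((1 / real n) *\<^sub>R ?z) = 0"
    by (simp add: mult_scaleC_left mult_scaleC_right sq scaleC_zero_right)
  ultimately have "(1 + (1 / real n) *\<^sub>R ?z) ^ n = 1 + real n *\<^sub>R (1 / real n) *\<^sub>R ?z"
    by blast
  also have "\<dots> = 1 + ?z" using n by simp
  finally have "norm (1 + ?z) \<le> exp 1" using power_growth[OF n(2) _ n(1)] by simp
  moreover have "norm ?z \<le> norm (1 + ?z) + norm (1::'x)"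
    using norm_triangle_ineq4[of "1 + ?z" 1] by simp
  moreover have "norm ?z = 5"
    using \<open>w \<noteq> 0\<close> by (simp add: norm_scaleC t_def norm_mult norm_divide)
  ultimately show False using norm_one_le[where ?'a = 'x] exp_le by linarith
qed

section \<open>Unital C*-algebras\<close>

lemma star_scaleR: "star (r *\<^sub>R x) = r *\<^sub>R star (x :: 'x::complex_star_algebra)"
  by (simp add: scaleR_scaleC star_scaleC)

lemma scaleC_uminus_left: "(- c) *\<^sub>C x = - (c *\<^sub>C (x :: 'x::complex_vector))"
  using scaleC_scaleC[of "-1" c x] by (simp add: scaleC_minus_left)

lemma self_adjoint_decomp:
  fixes x :: "'x::complex_star_algebra"
  obtains a b where "star a = a" "star b = b" "x = a + \<i> *\<^sub>C b"
proof
  let ?a = "(1/2) *\<^sub>C (x + star x)" and ?b = "(- \<i>/2) *\<^sub>C (x - star x)"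
  show "star ?a = ?a" by (simp add: star_scaleC star_add star_star add.commute)
  show "star ?b = ?b"
    by (simp add: star_scaleC star_diff star_star scaleC_diff_right scaleC_uminus_left star_minus)
  have "?a + \<i> *\<^sub>C ?b = (1/2) *\<^sub>C x + (1/2) *\<^sub>C x"
    by (simp add: scaleC_scaleC scaleC_add_right scaleC_diff_right scaleC_uminus_left)
  then show "x = ?a + \<i> *\<^sub>C ?b" by (simp add: scaleC_one flip: scaleC_add_left)
qed

lemma star_shift_mult_shift:
  fixes a :: "'a::unital_cstar_algebra"
  assumes a: "star a = a"
  shows "star (1 + (\<i> * of_real t) *\<^sub>C a) * (1 + (\<i> * of_real t) *\<^sub>C a) = 1 + t\<^sup>2 *\<^sub>R (a * a)"
proof -
  define c where "c = \<i> * complex_of_real t"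
  have "cnj c = - c" "c * c = - complex_of_real (t\<^sup>2)"
    by (simp_all add: c_def power2_eq_square complex_eq_iff)
  then show ?thesis
    unfolding c_def[symmetric]
    by (simp add: star_add star_scaleC a star_one distrib_left distrib_right mult_scaleC_left
        mult_scaleC_right scaleC_scaleC scaleC_uminus_left scaleR_scaleC left_diff_distrib scaleC_diff_right)
qed

text \<open>By the C*-identity \<open>\<parallel>1 + \<i> t a\<parallel>\<close> exceeds \<open>1\<close> only to second order in \<open>t\<close>, whereas an imaginary part of \<open>f a\<close>
  would contribute to first order.\<close>

lemma state_self_adjoint:
  fixes f :: "'a::unital_cstar_algebra \<Rightarrow> complex"
  assumes f: "state f" and a: "star a = a"
  shows "Im (f a) = 0"
proof (rule ccontr)
  assume "Im (f a) \<noteq> 0"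
  define t where "t = - Im (f a) / ((norm a)\<^sup>2 + 1)"
  have pos: "0 < (norm a)\<^sup>2 + 1" by (simp add: add_nonneg_pos)
  have "(norm (1 + (\<i> * t) *\<^sub>C a))\<^sup>2 = norm (1 + t\<^sup>2 *\<^sub>R (a * a))"
    using star_shift_mult_shift[OF a, of t] by (simp flip: cstar_identity)
  also have "\<dots> \<le> 1 + t\<^sup>2 * (norm a)\<^sup>2"
  proof -
    have "norm (t\<^sup>2 *\<^sub>R (a * a)) \<le> t\<^sup>2 * (norm a)\<^sup>2"
      by (simp add: mult_left_mono norm_mult_ineq power2_eq_square)
    then show ?thesis
      using norm_triangle_ineq[of 1 "t\<^sup>2 *\<^sub>R (a * a)"] norm_one_le[where ?'a = 'a] by linarith
  qed
  finally have 1: "(norm (1 + (\<i> * t) *\<^sub>C a))\<^sup>2 \<le> 1 + t\<^sup>2 * (norm a)\<^sup>2" .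
  have "f (1 + (\<i> * t) *\<^sub>C a) = 1 + (\<i> * t) * f a"
    using stateD[OF f] by (simp add: clinear_add clinear_complexD)
  then have "(cmod (1 + (\<i> * t) * f a))\<^sup>2 \<le> (norm (1 + (\<i> * t) *\<^sub>C a))\<^sup>2"
    using stateD(2)[OF f, of "1 + (\<i> * t) *\<^sub>C a"] by (simp add: power_mono)
  moreover have "(1 - t * Im (f a))\<^sup>2 \<le> (cmod (1 + (\<i> * t) * f a))\<^sup>2"
    by (simp add: cmod_power2)
  ultimately have "(1 - t * Im (f a))\<^sup>2 \<le> 1 + t\<^sup>2 * (norm a)\<^sup>2" using 1 by linarith
  then have "- 2 * t * Im (f a) \<le> t\<^sup>2 * (norm a)\<^sup>2"
    by (simp add: power2_eq_square algebra_simps)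
       (smt (verit) zero_le_square mult.assoc mult.commute)
  moreover have "t\<^sup>2 * (norm a)\<^sup>2 \<le> t\<^sup>2 * ((norm a)\<^sup>2 + 1)" by (intro mult_left_mono) auto
  moreover have "t\<^sup>2 * ((norm a)\<^sup>2 + 1) = - t * Im (f a)"
    using pos by (simp add: t_def power2_eq_square)
  ultimately have "- t * Im (f a) \<le> 0" by simp
  moreover have "- t * Im (f a) = (Im (f a))\<^sup>2 / ((norm a)\<^sup>2 + 1)"
    by (simp add: t_def power2_eq_square)
  moreover have "0 < (Im (f a))\<^sup>2 / ((norm a)\<^sup>2 + 1)"
    using pos \<open>Im (f a) \<noteq> 0\<close> by simp
  ultimately show False by simp
qed

lemma state_star:
  fixes f :: "'a::unital_cstar_algebra \<Rightarrow> complex"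
  assumes f: "state f"
  shows "f (star x) = cnj (f x)"
proof -
  obtain a b where ab: "star a = a" "star b = b" "x = a + \<i> *\<^sub>C b"
    by (rule self_adjoint_decomp)
  have "Im (f a) = 0" "Im (f b) = 0" using state_self_adjoint[OF f] ab by auto
  then show ?thesis
    using stateD(1)[OF f]
    by (simp add: ab star_add star_scaleC clinear_add clinear_complexD complex_eq_iff)
qed

lemma algebra_iso_one:
  fixes \<phi> :: "'x::complex_normed_unital_algebra \<Rightarrow> 'y::complex_normed_unital_algebra"
  assumes "algebra_iso \<phi>"
  shows "\<phi> 1 = 1"
proof -
  have bij: "bij \<phi>" and mult: "\<phi> (x * y) = \<phi> x * \<phi> y" for x y
    using assms by (auto simp: algebra_iso_def)
  obtain e where "\<phi> e = 1" using bij by (metis bij_pointE)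
  with mult[of 1 e] show ?thesis by simp
qed

lemma norm_isometric:
  fixes f :: "'x::complex_normed_vector \<Rightarrow> 'y::complex_normed_vector"
  assumes "clinear f"
  shows "isometric f \<longleftrightarrow> (\<forall>x. norm (f x) = norm x)"
  unfolding isometric_def dist_norm clinear_diff[OF assms, symmetric]
  by (metis diff_zero)

lemma state_compose:
  fixes \<phi> :: "'x::complex_normed_unital_algebra \<Rightarrow> 'y::complex_normed_unital_algebra"
  assumes F: "state F" and \<phi>: "clinear \<phi>" "\<And>x. norm (\<phi> x) \<le> norm x" "\<phi> 1 = 1"
  shows "state (\<lambda>x. F (\<phi> x))"
  unfolding state_def
proof (intro conjI allI)
  show "clinear (\<lambda>x. F (\<phi> x))"
    using stateD(1)[OF F] \<phi>(1) by (simp add: clinear_def)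
  show "cmod (F (\<phi> x)) \<le> norm x" for x
    using stateD(2)[OF F] \<phi>(2) by (rule order_trans)
qed (simp add: \<phi> stateD[OF F])

text \<open>Composition with the map turns states into states, and states of C*-algebras respect the involution.
  Since states separate the points, so does the map.\<close>

lemma isometric_imp_star_iso:
  fixes \<phi> :: "'a::unital_cstar_algebra \<Rightarrow> 'b::unital_cstar_algebra"
  assumes iso: "algebra_iso \<phi>" and "isometric \<phi>"
  shows "star_iso \<phi>"
proof -
  have lin: "clinear \<phi>" using iso by (simp add: algebra_iso_def)
  have norm: "norm (\<phi> x) \<le> norm x" for x
    using assms(2) by (simp add: norm_isometric[OF lin])
  have "\<phi> (star x) - star (\<phi> x) = 0" for x
  proof (rule states_separate)
    fix F :: "'b \<Rightarrow> complex" assume F: "state F"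
    have "state (\<lambda>x. F (\<phi> x))"
      by (rule state_compose[OF F lin norm algebra_iso_one[OF iso]])
    from state_star[OF this, of x] have "F (\<phi> (star x)) = F (star (\<phi> x))"
      by (simp add: state_star[OF F])
    then show "F (\<phi> (star x) - star (\<phi> x)) = 0"
      by (simp add: clinear_diff[OF stateD(1)[OF F]])
  qed
  with iso show ?thesis by (simp add: star_iso_def)
qed

text \<open>The binomial series of \<open>\<surd>(1 - x)\<close>; Vandermonde's identity evaluates its square.\<close>

lemma sqrt_one_minus:
  fixes x :: "'a::unital_cstar_algebra"
  assumes x: "star x = x" "norm x < 1"
  obtains s where "star s = s" "s * s = 1 - x" "\<And>y. y * x = x * y \<Longrightarrow> y * s = s * y"
proof -
  define b :: "nat \<Rightarrow> real" where "b n = ((1/2) gchoose n) * (-1) ^ n" for n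
  define a where "a n = b n *\<^sub>R x ^ n" for n
  define r where "r = (1 + norm x) / 2"
  have r: "\<bar>r\<bar> < 1" "norm x < r" using x(2) by (auto simp: r_def)
  have "summable (\<lambda>n. ((1/2) gchoose n) * r ^ n)"
    using gen_binomial_real[OF r(1), of "1/2"] by (rule sums_summable)
  then have "summable (\<lambda>n. norm (((1/2::real) gchoose n) * norm x ^ n))"
    by (rule powser_insidea) (use r x in auto)
  then have abs: "summable (\<lambda>n. norm (a n))"
  proof (rule summable_comparison_test[rotated])
    have "norm (norm (a n)) \<le> norm (((1/2::real) gchoose n) * norm x ^ n)" for n
      using norm_power_le[of x n] by (simp add: a_def b_def abs_mult mult_left_mono)
    then show "\<exists>N. \<forall>n\<ge>N. norm (norm (a n)) \<le> norm (((1/2::real) gchoose n) * norm x ^ n)" by blast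
  qed
  then have a: "summable a" by (rule summable_norm_cancel)
  define s where "s = suminf a"
  have star_pow: "star (x ^ n) = x ^ n" for n
    by (induction n) (simp_all add: star_one star_mult x power_commutes)
  have "bounded_linear (star :: 'a \<Rightarrow> 'a)"
    by (rule bounded_linear_intro[where K = 1]) (auto simp: star_add star_scaleR norm_star)
  moreover have "star (a n) = a n" for n
    by (simp add: a_def star_scaleR star_pow)
  ultimately have "star s = s"
    using bounded_linear.suminf[OF _ a, of star] by (simp add: s_def)
  moreover have "s * s = 1 - x"
  proof -
    \<comment> \<open>The coefficients of the square are those of \<open>1 - x\<close>, because one half and one half add up to one.\<close>
    have "(\<Sum>i\<le>k. a i * a (k - i)) = (if k = 0 then 1 else if k = 1 then - x else 0)" for k
    proof -
      have "(\<Sum>i\<le>k. a i * a (k - i)) = (\<Sum>i\<le>k. (((1/2) gchoose i) * ((1/2) gchoose (k - i))) *\<^sub>R ((-1) ^ k *\<^sub>R x ^ k))"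
      proof (rule sum.cong)
        fix i assume "i \<in> {..k}"
        then have "k = i + (k - i)" by simp
        then have "(-1::real) ^ k = (-1) ^ i * (-1) ^ (k - i)" "x ^ k = x ^ i * x ^ (k - i)"
          by (metis power_add)+
        then show "a i * a (k - i) = (((1/2) gchoose i) * ((1/2) gchoose (k - i))) *\<^sub>R ((-1) ^ k *\<^sub>R x ^ k)"
          by (simp add: a_def b_def mult_ac)
      qed simp
      also have "\<dots> = (\<Sum>i\<le>k. ((1/2) gchoose i) * ((1/2) gchoose (k - i))) *\<^sub>R ((-1) ^ k *\<^sub>R x ^ k)"
        by (rule scaleR_sum_left[symmetric])
      also have "(\<Sum>i\<le>k. ((1/2) gchoose i) * ((1/2) gchoose (k - i))) = (1::real) gchoose k"
        using gbinomial_Vandermonde[of "1/2::real" "1/2" k] by (simp add: atLeast0AtMost)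
      also have "(1::real) gchoose k = of_nat (1 choose k)"
        using binomial_gbinomial[of 1 k, where ?'a = real] by simp
      finally show ?thesis
        by (cases k; cases "k - 1") (auto simp: binomial_eq_0)
    qed
    then have "(\<lambda>k. if k = 0 then 1 else if k = 1 then - x else 0) sums (s * s)"
      using Cauchy_product_sums[OF abs abs] by (simp add: s_def)
    moreover have "(\<lambda>k. if k = 0 then 1 else if k = 1 then - x else 0) sums
        (\<Sum>k\<in>{0, 1}. if k = (0::nat) then 1 else if k = 1 then - x else 0)"
      by (rule sums_finite) auto
    ultimately have "s * s = (\<Sum>k\<in>{0, 1}. if k = (0::nat) then 1 else if k = 1 then - x else 0)"
      by (rule sums_unique2)
    then show ?thesis by simp
  qed
  moreover have "y * s = s * y" if y: "y * x = x * y" for y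
  proof -
    have "y * x ^ n = x ^ n * y" for n
      by (induction n) (simp_all add: y mult.assoc, metis y mult.assoc)
    then have "y * a n = a n * y" for n by (simp add: a_def)
    then show ?thesis
      using suminf_mult[OF a, of y] suminf_mult2[OF a, of y] by (simp add: s_def)
  qed
  ultimately show ?thesis by (rule that)
qed

text \<open>A self-adjoint \<open>h\<close> of norm less than one is the real part of the unitary \<open>u = h + \<i> \<surd>(1 - h\<^sup>2)\<close>. Being unitary
  is an algebraic property, so \<open>\<phi> u\<close> is unitary, and \<open>\<phi> h\<close>, the real part of \<open>\<phi> u\<close>, has norm at most one. The
  C*-identity reduces the general case to self-adjoint elements.\<close>

lemma star_iso_norm_le:
  fixes \<phi> :: "'a::unital_cstar_algebra \<Rightarrow> 'b::unital_cstar_algebra"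
  assumes "star_iso \<phi>"
  shows "norm (\<phi> x) \<le> norm x"
proof -
  have iso: "algebra_iso \<phi>" and star: "\<phi> (star x) = star (\<phi> x)" for x
    using assms by (auto simp: star_iso_def)
  have lin: "clinear \<phi>" and mult: "\<phi> (x * y) = \<phi> x * \<phi> y" for x y
    using iso by (auto simp: algebra_iso_def)
  have one: "\<phi> 1 = 1" by (rule algebra_iso_one[OF iso])
  have sa1: "norm (\<phi> h) \<le> 1" if h: "star h = h" "norm h < 1" for h
  proof -
    have lt: "norm (h * h) < 1"
      using norm_mult_ineq[of h h] h(2) mult_strict_mono'[of "norm h" 1 "norm h" 1] by simp
    have sa: "star (h * h) = h * h" by (simp add: star_mult h)
    obtain s where s: "star s = s" "s * s = 1 - h * h"
      and comm: "\<And>y. y * (h * h) = (h * h) * y \<Longrightarrow> y * s = s * y"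
      by (rule sqrt_one_minus[OF sa lt]) (rule that)
    have hs: "h * s = s * h" by (rule comm) (simp add: mult.assoc)
    define u where "u = h + \<i> *\<^sub>C s"
    have star_u: "star u = h - \<i> *\<^sub>C s"
      by (simp add: u_def star_add star_scaleC h s scaleC_uminus_left)
    have "star u * u = 1"
      unfolding star_u
      by (simp add: u_def s hs distrib_left left_diff_distrib mult_scaleC_left mult_scaleC_right
          scaleC_scaleC scaleC_minus_left scaleC_diff_right)
    then have "star (\<phi> u) * \<phi> u = 1" by (simp add: one flip: star mult)
    then have "(norm (\<phi> u))\<^sup>2 \<le> 1"
      using norm_one_le[where ?'a = 'b] by (simp flip: cstar_identity)
    then have u1: "norm (\<phi> u) \<le> 1" by (simp add: abs_square_le_1)
    have "h = (1/2) *\<^sub>R (u + star u)"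
    proof -
      have "u + star u = h + h" by (simp add: star_u) (simp add: u_def)
      then show ?thesis by (simp flip: scaleR_2)
    qed
    then have "\<phi> h = (1/2) *\<^sub>R (\<phi> u + star (\<phi> u))"
      by (metis lin clinear_scaleR clinear_add star)
    then have "norm (\<phi> h) \<le> (1/2) * (norm (\<phi> u) + norm (star (\<phi> u)))"
      by (simp add: norm_triangle_ineq)
    with u1 show ?thesis by (simp add: norm_star)
  qed
  have sa: "norm (\<phi> h) \<le> norm h" if h: "star h = h" for h
  proof (rule field_le_epsilon)
    fix e :: real assume e: "0 < e"
    define r where "r = norm h + e"
    have r: "0 < r" using e by (simp add: r_def add_nonneg_pos)
    have "norm (\<phi> ((1 / r) *\<^sub>R h)) \<le> 1"
      using r e by (intro sa1) (auto simp: star_scaleR h r_def)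
    then show "norm (\<phi> h) \<le> norm h + e"
      using r by (simp add: clinear_scaleR[OF lin] field_simps r_def)
  qed
  have "(norm (\<phi> x))\<^sup>2 = norm (\<phi> (star x * x))"
    by (simp add: mult star cstar_identity)
  also have "\<dots> \<le> norm (star x * x)"
    by (rule sa) (simp add: star_mult star_star)
  finally show ?thesis
    by (simp add: cstar_identity power2_le_iff_abs_le)
qed

lemma algebra_iso_inv:
  assumes "algebra_iso \<phi>"
  shows "algebra_iso (inv \<phi>)"
proof -
  have bij: "bij \<phi>" and lin: "clinear \<phi>" and mult: "\<phi> (x * y) = \<phi> x * \<phi> y" for x y
    using assms by (auto simp: algebra_iso_def)
  note inv = bij_inv_eq_iff[OF bij] bij_is_surj[OF bij, THEN surj_f_inv_f]
  have *: "inv \<phi> y = x \<longleftrightarrow> y = \<phi> x" for x y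
    using bij by (metis bij_inv_eq_iff)
  have surj: "\<phi> (inv \<phi> y) = y" for y using bij by (metis *)
  show ?thesis
    unfolding algebra_iso_def clinear_def
    using bij by (auto simp: * surj mult clinear_add[OF lin] clinear_scaleC[OF lin] bij_imp_bij_inv)
qed

lemma star_iso_imp_isometric:
  fixes \<phi> :: "'a::unital_cstar_algebra \<Rightarrow> 'b::unital_cstar_algebra"
  assumes \<phi>: "star_iso \<phi>"
  shows "isometric \<phi>"
proof -
  have iso: "algebra_iso \<phi>" and star: "\<phi> (star x) = star (\<phi> x)" for x
    using \<phi> by (auto simp: star_iso_def)
  have bij: "bij \<phi>" and lin: "clinear \<phi>" using iso by (auto simp: algebra_iso_def)
  have inv: "inv \<phi> (\<phi> x) = x" "\<phi> (inv \<phi> y) = y" for x y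
    using bij by (auto simp: bij_is_inj bij_is_surj surj_f_inv_f)
  have "star_iso (inv \<phi>)"
    unfolding star_iso_def using algebra_iso_inv[OF iso] by (metis inv star)
  from star_iso_norm_le[OF this] star_iso_norm_le[OF \<phi>] show ?thesis
    by (metis norm_isometric[OF lin] inv(1) antisym)
qed

theorem star_iso_iff_isometric:
  fixes \<phi> :: "'a::unital_cstar_algebra \<Rightarrow> 'b::unital_cstar_algebra"
  shows "star_iso \<phi> \<longleftrightarrow> algebra_iso \<phi> \<and> isometric \<phi>"
  using isometric_imp_star_iso star_iso_imp_isometric by (auto simp: star_iso_def)

section \<open>Functionals and slice maps on the projective tensor product\<close>

definition bounded_clinear :: "('x::complex_normed_vector \<Rightarrow> 'y::complex_normed_vector) \<Rightarrow> bool" where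
  "bounded_clinear f \<longleftrightarrow> clinear f \<and> (\<exists>K. \<forall>x. norm (f x) \<le> K * norm x)"

lemma bounded_clinearI: "clinear f \<Longrightarrow> (\<And>x. norm (f x) \<le> K * norm x) \<Longrightarrow> bounded_clinear f"
  by (auto simp: bounded_clinear_def)

lemma bounded_clinear_clinear: "bounded_clinear f \<Longrightarrow> clinear f"
  by (simp add: bounded_clinear_def)

lemma bounded_clinear_bound:
  assumes "bounded_clinear f"
  obtains K where "0 \<le> K" "\<And>x. norm (f x) \<le> K * norm x"
proof -
  obtain K where K: "\<And>x. norm (f x) \<le> K * norm x"
    using assms by (auto simp: bounded_clinear_def)
  show ?thesis
  proof (rule that[of "\<bar>K\<bar>"])
    show "norm (f x) \<le> \<bar>K\<bar> * norm x" for x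
      using K[of x] mult_right_mono[OF abs_ge_self[of K] norm_ge_zero[of x]] by linarith
  qed simp
qed

lemma bounded_clinear_continuous: "bounded_clinear f \<Longrightarrow> continuous_on UNIV f"
proof -
  assume f: "bounded_clinear f"
  then have "clinear f" by (rule bounded_clinear_clinear)
  moreover obtain K where "\<And>x. norm (f x) \<le> K * norm x"
    using f by (auto simp: bounded_clinear_def)
  ultimately have "bounded_linear f"
    by (intro bounded_linear_intro[where K = K])
       (auto simp: clinear_add clinear_scaleR mult.commute)
  then show ?thesis by (rule linear_continuous_on)
qed

lemma bounded_clinear_id: "bounded_clinear (\<lambda>x. x)"
  by (rule bounded_clinearI[where K = 1]) (auto simp: clinear_def)

lemma bounded_clinear_zero: "bounded_clinear (\<lambda>x. 0)"
  by (rule bounded_clinearI[where K = 0]) (auto simp: clinear_def scaleC_zero_right)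

lemma bounded_clinear_compose:
  assumes "bounded_clinear g" "bounded_clinear f"
  shows "bounded_clinear (\<lambda>x. g (f x))"
proof -
  obtain K where K: "0 \<le> K" "\<And>x. norm (g x) \<le> K * norm x"
    by (rule bounded_clinear_bound[OF assms(1)]) (rule that)
  obtain L where L: "0 \<le> L" "\<And>x. norm (f x) \<le> L * norm x"
    by (rule bounded_clinear_bound[OF assms(2)]) (rule that)
  show ?thesis
  proof (rule bounded_clinearI)
    show "clinear (\<lambda>x. g (f x))"
      using assms by (simp add: bounded_clinear_def clinear_def)
    show "norm (g (f x)) \<le> (K * L) * norm x" for x
      using K(2)[of "f x"] mult_left_mono[OF L(2)[of x] K(1)] by (simp add: mult.assoc)
  qed
qed

lemma bounded_clinear_add:
  assumes "bounded_clinear f" "bounded_clinear g"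
  shows "bounded_clinear (\<lambda>x. f x + g x)"
proof -
  obtain K where K: "0 \<le> K" "\<And>x. norm (f x) \<le> K * norm x"
    by (rule bounded_clinear_bound[OF assms(1)]) (rule that)
  obtain L where L: "0 \<le> L" "\<And>x. norm (g x) \<le> L * norm x"
    by (rule bounded_clinear_bound[OF assms(2)]) (rule that)
  show ?thesis
  proof (rule bounded_clinearI)
    show "clinear (\<lambda>x. f x + g x)"
      using assms by (simp add: bounded_clinear_def clinear_def scaleC_add_right add_ac)
    show "norm (f x + g x) \<le> (K + L) * norm x" for x
      using norm_triangle_ineq[of "f x" "g x"] K(2)[of x] L(2)[of x] by (simp add: distrib_right)
  qed
qed

lemma bounded_clinear_scaleC: "bounded_clinear ((*\<^sub>C) c)"
  by (rule bounded_clinearI[where K = "cmod c"])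
     (auto simp: clinear_def scaleC_add_right scaleC_scaleC mult.commute norm_scaleC)

lemma bounded_clinear_mult_left: "bounded_clinear ((*) (a :: 'x::complex_normed_algebra))"
  by (rule bounded_clinearI[where K = "norm a"])
     (auto simp: clinear_def distrib_left mult_scaleC_right norm_mult_ineq)

lemma bounded_clinear_mult_right: "bounded_clinear (\<lambda>x. x * (a :: 'x::complex_normed_algebra))"
  by (rule bounded_clinearI[where K = "norm a"])
     (auto simp: clinear_def distrib_right mult_scaleC_left norm_mult_ineq mult.commute[of "norm a"])

lemma bounded_clinear_state: "state F \<Longrightarrow> bounded_clinear F"
  by (rule bounded_clinearI[where K = 1]) (auto dest: stateD)

lemma bounded_clinear_elem_left: "bounded_clinear (\<lambda>x. x \<otimes>\<^sub>\<gamma> y)"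
  by (rule bounded_clinearI[where K = "norm y"])
     (use norm_ptensor_elem_le[of _ y] in \<open>auto simp: ptensor_elem_clinear_left mult.commute\<close>)

lemma ptensor_eqI:
  assumes "bounded_clinear f" "bounded_clinear g" "\<And>x y. f (x \<otimes>\<^sub>\<gamma> y) = g (x \<otimes>\<^sub>\<gamma> y)"
  shows "f z = g z"
  by (rule fun_cong[OF ptensor_ext])
     (use assms in \<open>auto intro: bounded_clinear_clinear bounded_clinear_continuous\<close>)

text \<open>The elementary tensors generate, and the projective norm is the largest norm with
  \<open>\<parallel>x \<otimes> y\<parallel> \<le> \<parallel>x\<parallel> \<parallel>y\<parallel>\<close>.\<close>

lemma ptensor_norm_bound:
  fixes f :: "('a::complex_normed_vector, 'b::complex_normed_vector) ptensor \<Rightarrow> 'c::complex_normed_vector"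
  assumes lin: "clinear f" and cont: "continuous_on UNIV f"
    and K: "0 \<le> K" "\<And>x y. norm (f (x \<otimes>\<^sub>\<gamma> y)) \<le> K * (norm x * norm y)"
  shows "norm (f z) \<le> K * norm z"
proof -
  obtain X where X: "proj_Cauchy X" "z = abs_ptensor X" by (rule ptensor_cases)
  have le: "norm (f (of_atensor u)) \<le> K * proj_norm u" for u
    by (rule proj_norm_bound[where q = norm and f = "\<lambda>u. f (of_atensor u)"])
       (use K in \<open>auto simp: norm_triangle_ineq of_atensor_add clinear_add[OF lin] ptensor_elem_def\<close>)
  have "(\<lambda>n. f (of_atensor (X n))) \<longlonglongrightarrow> f z"
    unfolding X(2) by (auto intro!: continuous_on_tendsto_compose[OF cont] abs_ptensor_limit X(1))
  moreover have "(\<lambda>n. K * proj_norm (X n)) \<longlonglongrightarrow> K * norm z"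
    unfolding X(2) by (intro tendsto_mult tendsto_const norm_abs_ptensor X(1))
  ultimately show ?thesis
    using le by (intro LIMSEQ_le[OF tendsto_norm]) auto
qed

definition cbilinear ::
  "('a::complex_normed_vector \<Rightarrow> 'b::complex_normed_vector \<Rightarrow> 'c::complex_normed_vector) \<Rightarrow> bool" where
  "cbilinear h \<longleftrightarrow> (\<forall>y. clinear (\<lambda>x. h x y)) \<and> (\<forall>x. clinear (h x)) \<and>
    (\<exists>K\<ge>0. \<forall>x y. norm (h x y) \<le> K * (norm x * norm y))"

lemma cbilinearI:
  assumes "\<And>y. clinear (\<lambda>x. h x y)" "\<And>x. clinear (h x)" "0 \<le> K"
    "\<And>x y. norm (h x y) \<le> K * (norm x * norm y)"
  shows "cbilinear h"
  using assms by (auto simp: cbilinear_def)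

text \<open>The linearization of a bounded bilinear map.\<close>

definition ptensor_lift ::
  "('a::complex_normed_vector \<Rightarrow> 'b::complex_normed_vector \<Rightarrow> 'c::complex_banach) \<Rightarrow> ('a, 'b) ptensor \<Rightarrow> 'c" where
  "ptensor_lift h = (THE f. clinear f \<and> continuous_on UNIV f \<and> (\<forall>x y. f (x \<otimes>\<^sub>\<gamma> y) = h x y))"

lemma ptensor_lift:
  assumes h: "cbilinear h"
  shows ptensor_lift_elem: "ptensor_lift h (x \<otimes>\<^sub>\<gamma> y) = h x y"
    and bounded_clinear_ptensor_lift: "bounded_clinear (ptensor_lift h)"
proof -
  obtain K where K: "0 \<le> K" "\<And>x y. norm (h x y) \<le> K * (norm x * norm y)"
    using h by (auto simp: cbilinear_def)
  have "\<exists>!f. clinear f \<and> continuous_on UNIV f \<and> (\<forall>x y. f (x \<otimes>\<^sub>\<gamma> y) = h x y)"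
    using h K by (intro ptensor_extension[where K = K]) (auto simp: cbilinear_def)
  from theI'[OF this] have *: "clinear (ptensor_lift h)" "continuous_on UNIV (ptensor_lift h)"
    "\<And>x y. ptensor_lift h (x \<otimes>\<^sub>\<gamma> y) = h x y"
    unfolding ptensor_lift_def by auto
  show "ptensor_lift h (x \<otimes>\<^sub>\<gamma> y) = h x y" by (rule *)
  have "norm (ptensor_lift h z) \<le> K * norm z" for z
    using K by (intro ptensor_norm_bound *) (auto simp: *)
  then show "bounded_clinear (ptensor_lift h)"
    using * by (intro bounded_clinearI) auto
qed

instantiation ptensor ::
  (complex_normed_unital_algebra, complex_normed_unital_algebra) complex_normed_unital_algebra
begin

definition one_ptensor :: "('a, 'b) ptensor" where "one_ptensor = 1 \<otimes>\<^sub>\<gamma> 1"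

instance
proof
  fix z :: "('a, 'b) ptensor"
  show "1 * z = z"
    by (rule ptensor_eqI[where g = "\<lambda>z. z"])
       (auto simp: bounded_clinear_mult_left bounded_clinear_id one_ptensor_def ptensor_elem_mult)
  show "z * 1 = z"
    by (rule ptensor_eqI[where g = "\<lambda>z. z"])
       (auto simp: bounded_clinear_mult_right bounded_clinear_id one_ptensor_def ptensor_elem_mult)
  have "norm (1 :: ('a, 'b) ptensor) \<le> norm (1::'a) * norm (1::'b)"
    unfolding one_ptensor_def by (rule norm_ptensor_elem_le)
  also have "\<dots> \<le> 1" by (intro mult_le_one norm_one_le) auto
  finally show "norm (1 :: ('a, 'b) ptensor) \<le> 1" .
qed

end

definition prod_functional ::
  "('a::complex_normed_vector \<Rightarrow> complex) \<Rightarrow> ('b::complex_normed_vector \<Rightarrow> complex) \<Rightarrow> ('a, 'b) ptensor \<Rightarrow> complex" where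
  "prod_functional f g = ptensor_lift (\<lambda>x y. f x * g y)"

definition slice_right ::
  "('b::complex_normed_vector \<Rightarrow> complex) \<Rightarrow> ('a::complex_banach, 'b) ptensor \<Rightarrow> 'a" where
  "slice_right g = ptensor_lift (\<lambda>x y. g y *\<^sub>C x)"

definition slice_left ::
  "('a::complex_normed_vector \<Rightarrow> complex) \<Rightarrow> ('a, 'b::complex_banach) ptensor \<Rightarrow> 'b" where
  "slice_left f = ptensor_lift (\<lambda>x y. f x *\<^sub>C y)"

lemma prod_functional:
  assumes f: "bounded_clinear f" and g: "bounded_clinear g"
  shows prod_functional_elem: "prod_functional f g (x \<otimes>\<^sub>\<gamma> y) = f x * g y"
    and bounded_clinear_prod_functional: "bounded_clinear (prod_functional f g)"
proof -
  obtain K where K: "0 \<le> K" "\<And>x. norm (f x) \<le> K * norm x"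
    by (rule bounded_clinear_bound[OF f]) (rule that)
  obtain L where L: "0 \<le> L" "\<And>x. norm (g x) \<le> L * norm x"
    by (rule bounded_clinear_bound[OF g]) (rule that)
  note lin = f[THEN bounded_clinear_clinear] g[THEN bounded_clinear_clinear]
  have "cbilinear (\<lambda>x y. f x * g y)"
  proof (rule cbilinearI)
    show "norm (f x * g y) \<le> (K * L) * (norm x * norm y)" for x y
      using mult_mono[OF K(2)[of x] L(2)[of y]] K(1) by (simp add: norm_mult mult_ac)
  qed (use lin K L in \<open>auto simp: clinear_def scaleC_complex_def algebra_simps\<close>)
  from ptensor_lift_elem[OF this] bounded_clinear_ptensor_lift[OF this]
  show "prod_functional f g (x \<otimes>\<^sub>\<gamma> y) = f x * g y" "bounded_clinear (prod_functional f g)"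
    by (simp_all add: prod_functional_def)
qed

lemma slice_right:
  fixes x :: "'a::complex_banach" and g :: "'b::complex_normed_vector \<Rightarrow> complex"
  assumes g: "bounded_clinear g"
  shows slice_right_elem: "slice_right g (x \<otimes>\<^sub>\<gamma> y) = g y *\<^sub>C x"
    and bounded_clinear_slice_right: "bounded_clinear (slice_right g :: ('a, 'b) ptensor \<Rightarrow> 'a)"
proof -
  obtain L where L: "0 \<le> L" "\<And>x. norm (g x) \<le> L * norm x"
    by (rule bounded_clinear_bound[OF g]) (rule that)
  note lin = g[THEN bounded_clinear_clinear]
  have "cbilinear (\<lambda>(x::'a) y. g y *\<^sub>C x)"
  proof (rule cbilinearI)
    show "norm (g y *\<^sub>C x) \<le> L * (norm x * norm y)" for x :: 'a and y
      using mult_right_mono[OF L(2)[of y], of "norm x"] by (simp add: norm_scaleC mult_ac)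
  qed (use lin L in \<open>auto simp: clinear_def scaleC_complex_def scaleC_add_left scaleC_add_right
         scaleC_scaleC mult.commute\<close>)
  from ptensor_lift_elem[OF this] bounded_clinear_ptensor_lift[OF this]
  show "slice_right g (x \<otimes>\<^sub>\<gamma> y) = g y *\<^sub>C x" "bounded_clinear (slice_right g :: ('a, 'b) ptensor \<Rightarrow> 'a)"
    by (simp_all add: slice_right_def)
qed

lemma slice_left:
  fixes y :: "'b::complex_banach" and f :: "'a::complex_normed_vector \<Rightarrow> complex"
  assumes f: "bounded_clinear f"
  shows slice_left_elem: "slice_left f (x \<otimes>\<^sub>\<gamma> y) = f x *\<^sub>C y"
    and bounded_clinear_slice_left: "bounded_clinear (slice_left f :: ('a, 'b) ptensor \<Rightarrow> 'b)"
proof -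
  obtain L where L: "0 \<le> L" "\<And>x. norm (f x) \<le> L * norm x"
    by (rule bounded_clinear_bound[OF f]) (rule that)
  note lin = f[THEN bounded_clinear_clinear]
  have "cbilinear (\<lambda>x (y::'b). f x *\<^sub>C y)"
  proof (rule cbilinearI)
    show "norm (f x *\<^sub>C y) \<le> L * (norm x * norm y)" for x and y :: 'b
      using mult_right_mono[OF L(2)[of x], of "norm y"] by (simp add: norm_scaleC mult_ac)
  qed (use lin L in \<open>auto simp: clinear_def scaleC_complex_def scaleC_add_left scaleC_add_right
         scaleC_scaleC mult.commute\<close>)
  from ptensor_lift_elem[OF this] bounded_clinear_ptensor_lift[OF this]
  show "slice_left f (x \<otimes>\<^sub>\<gamma> y) = f x *\<^sub>C y" "bounded_clinear (slice_left f :: ('a, 'b) ptensor \<Rightarrow> 'b)"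
    by (simp_all add: slice_left_def)
qed

lemma slice_right_functional:
  assumes "bounded_clinear \<phi>" "bounded_clinear g"
  shows "\<phi> (slice_right g z) = prod_functional \<phi> g z"
  by (rule ptensor_eqI)
     (auto simp: assms bounded_clinear_compose bounded_clinear_slice_right bounded_clinear_prod_functional
       slice_right_elem prod_functional_elem clinear_complexD bounded_clinear_clinear mult.commute)

lemma slice_left_functional:
  assumes "bounded_clinear f" "bounded_clinear \<psi>"
  shows "\<psi> (slice_left f z) = prod_functional f \<psi> z"
  by (rule ptensor_eqI)
     (auto simp: assms bounded_clinear_compose bounded_clinear_slice_left bounded_clinear_prod_functional
       slice_left_elem prod_functional_elem clinear_complexD bounded_clinear_clinear)

lemma state_if_contractive:
  fixes F :: "('a::complex_normed_unital_algebra, 'b::complex_normed_unital_algebra) ptensor \<Rightarrow> complex"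
  assumes F: "bounded_clinear F" "F 1 = 1"
    and le: "\<And>x y. norm x \<le> 1 \<Longrightarrow> norm y \<le> 1 \<Longrightarrow> cmod (F (x \<otimes>\<^sub>\<gamma> y)) \<le> 1"
  shows "state F"
proof -
  note lin = bounded_clinear_clinear[OF F(1)]
  have "cmod (F (x \<otimes>\<^sub>\<gamma> y)) \<le> 1 * (norm x * norm y)" for x y
  proof (cases "x = 0 \<or> y = 0")
    case True
    then have "x \<otimes>\<^sub>\<gamma> y = 0"
      using clinear_zero[OF ptensor_elem_clinear_left, of y] clinear_zero[OF ptensor_elem_clinear_right, of x] by auto
    then show ?thesis by (simp add: clinear_zero[OF lin])
  next
    case False
    define x' y' where "x' = (1 / norm x) *\<^sub>R x" and "y' = (1 / norm y) *\<^sub>R y"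
    have "x = norm x *\<^sub>R x'" "y = norm y *\<^sub>R y'" using False by (auto simp: x'_def y'_def)
    then have "F (x \<otimes>\<^sub>\<gamma> y) = norm x *\<^sub>R norm y *\<^sub>R F (x' \<otimes>\<^sub>\<gamma> y')"
      by (metis clinear_scaleR[OF ptensor_elem_clinear_left] clinear_scaleR[OF ptensor_elem_clinear_right]
          clinear_scaleR[OF lin])
    moreover have "cmod (F (x' \<otimes>\<^sub>\<gamma> y')) \<le> 1"
      using False by (intro le) (auto simp: x'_def y'_def)
    ultimately show ?thesis
      by (simp add: mult.assoc[symmetric] mult_left_le)
  qed
  from ptensor_norm_bound[OF lin bounded_clinear_continuous[OF F(1)] _ this] F(2) lin
  show ?thesis by (auto simp: state_def)
qed

lemma state_prod_functional:
  fixes f :: "'a::complex_normed_unital_algebra \<Rightarrow> complex" and g :: "'b::complex_normed_unital_algebra \<Rightarrow> complex"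
  assumes "state f" "state g"
  shows "state (prod_functional f g)"
proof (rule state_if_contractive)
  note b = assms[THEN bounded_clinear_state]
  show "bounded_clinear (prod_functional f g)" by (rule bounded_clinear_prod_functional[OF b])
  show "prod_functional f g 1 = 1"
    by (simp add: one_ptensor_def prod_functional_elem[OF b] stateD[OF assms(1)] stateD[OF assms(2)])
  fix x :: 'a and y :: 'b assume "norm x \<le> 1" "norm y \<le> 1"
  then show "cmod (prod_functional f g (x \<otimes>\<^sub>\<gamma> y)) \<le> 1"
    using stateD(2)[OF assms(1), of x] stateD(2)[OF assms(2), of y]
    by (simp add: prod_functional_elem[OF b] norm_mult mult_le_one)
qed

lemma state_marginal:
  fixes F :: "('a::complex_normed_unital_algebra, 'b::complex_normed_unital_algebra) ptensor \<Rightarrow> complex"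
  assumes F: "state F"
  shows "state (\<lambda>a. F (a \<otimes>\<^sub>\<gamma> 1))" "state (\<lambda>b. F (1 \<otimes>\<^sub>\<gamma> b))"
proof -
  have "norm (a \<otimes>\<^sub>\<gamma> (1::'b)) \<le> norm a" for a :: 'a
    using norm_ptensor_elem_le[of a "1::'b"] mult_left_mono[OF norm_one_le[where ?'a = 'b], of "norm a"] by simp
  then show "state (\<lambda>a. F (a \<otimes>\<^sub>\<gamma> 1))"
    by (intro state_compose[OF F] ptensor_elem_clinear_left) (auto simp: one_ptensor_def)
  have "norm ((1::'a) \<otimes>\<^sub>\<gamma> b) \<le> norm b" for b :: 'b
    using norm_ptensor_elem_le[of "1::'a" b] mult_right_mono[OF norm_one_le[where ?'a = 'a], of "norm b"] by simp
  then show "state (\<lambda>b. F (1 \<otimes>\<^sub>\<gamma> b))"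
    by (intro state_compose[OF F] ptensor_elem_clinear_right) (auto simp: one_ptensor_def)
qed

section \<open>Hermitian elements of the projective tensor product\<close>

text \<open>The two sides agree to first order in \<open>r\<close>; the claim compares the coefficients of \<open>r\<^sup>2\<close>.\<close>

lemma second_order_bound:
  fixes \<alpha> A B R2 R3 R4 I2 I3 I4 :: real
  assumes le: "\<And>r. 0 < r \<Longrightarrow> (1 - r\<^sup>2 * R2 + r ^ 3 * R3 + r ^ 4 * R4)\<^sup>2 +
      (r * \<alpha> + r\<^sup>2 * I2 + r ^ 3 * I3 + r ^ 4 * I4)\<^sup>2 \<le> (1 + r ^ 4 * A) * (1 + r ^ 4 * B)"
  shows "\<alpha>\<^sup>2 \<le> 2 * R2"
proof -
  \<comment> \<open>The difference of the two sides, divided by \<open>r\<^sup>2\<close>.\<close>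
  let ?P = "\<lambda>r. (- R2 + r * R3 + r\<^sup>2 * R4) * (2 - r\<^sup>2 * R2 + r ^ 3 * R3 + r ^ 4 * R4) +
    (\<alpha> + r * I2 + r\<^sup>2 * I3 + r ^ 3 * I4)\<^sup>2 - r\<^sup>2 * (A + B + r ^ 4 * (A * B))"
  have "?P r \<le> 0" if r: "0 < r" for r
  proof -
    have "r\<^sup>2 * ?P r = (1 - r\<^sup>2 * R2 + r ^ 3 * R3 + r ^ 4 * R4)\<^sup>2 +
      (r * \<alpha> + r\<^sup>2 * I2 + r ^ 3 * I3 + r ^ 4 * I4)\<^sup>2 - (1 + r ^ 4 * A) * (1 + r ^ 4 * B)"
      by algebra
    with le[OF r] have "r\<^sup>2 * ?P r \<le> 0" by linarith
    with r show ?thesis by (simp add: mult_le_0_iff)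
  qed
  then have "eventually (\<lambda>r. ?P r \<le> 0) (at_right 0)"
    by (rule eventually_mono[OF eventually_at_right_less[of 0]])
  moreover have "(?P \<longlongrightarrow> - R2 * 2 + \<alpha>\<^sup>2) (at_right 0)"
    by (auto intro!: tendsto_eq_intros)
  ultimately have "- R2 * 2 + \<alpha>\<^sup>2 \<le> 0"
    by (intro tendsto_upperbound) auto
  then show ?thesis by simp
qed

text \<open>The Taylor polynomial of degree two of \<open>exp (\<i> r a)\<close>, which is unitary up to order four in \<open>r\<close>.\<close>

definition unitary_curve :: "real \<Rightarrow> 'a::unital_cstar_algebra \<Rightarrow> 'a" where
  "unitary_curve r a = 1 + (\<i> * of_real r) *\<^sub>C a + (- of_real (r\<^sup>2 / 2)) *\<^sub>C (a * a)"

lemma norm_unitary_curve: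
  fixes a :: "'a::unital_cstar_algebra"
  assumes a: "star a = a"
  shows "(norm (unitary_curve r a))\<^sup>2 \<le> 1 + r ^ 4 * norm a ^ 4"
proof -
  define c where "c = \<i> * complex_of_real r"
  define d where "d = - complex_of_real (r\<^sup>2 / 2)"
  have cd: "cnj c = - c" "cnj d = d" by (simp_all add: c_def d_def)
  have "c * c = d + d"
    by (simp add: c_def d_def power2_eq_square complex_eq_iff)
  then have d2: "d *\<^sub>C (a * a) + d *\<^sub>C (a * a) = (c * c) *\<^sub>C (a * a)"
    by (simp only: scaleC_add_left)
  define p where "p = 1 + d *\<^sub>C (a * a)"
  define q where "q = c *\<^sub>C a"
  have x: "unitary_curve r a = p + q"
    by (simp add: unitary_curve_def c_def d_def p_def q_def add_ac)
  have star: "star p = p" "star q = - q"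
    by (simp_all add: p_def q_def star_add star_scaleC star_mult a star_one cd scaleC_uminus_left)
  have "p * q = q * p"
    by (simp add: p_def q_def distrib_left distrib_right mult_scaleC_left mult_scaleC_right
        scaleC_scaleC scaleC_add_right mult.assoc mult.commute[of c d])
  then have "star (p + q) * (p + q) = p * p - q * q"
    by (simp add: star star_add algebra_simps)
  also have "q * q = (c * c) *\<^sub>C (a * a)"
    by (simp add: q_def mult_scaleC_left mult_scaleC_right scaleC_scaleC)
  also have "p * p = 1 + (d *\<^sub>C (a * a) + d *\<^sub>C (a * a)) + (d * d) *\<^sub>C (a * a * a * a)"
    by (simp add: p_def distrib_left distrib_right mult_scaleC_left mult_scaleC_right scaleC_scaleC
        mult.assoc scaleC_add_right add_ac)
  finally have "star (p + q) * (p + q) = 1 + (d * d) *\<^sub>C (a * a * a * a)"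
    by (simp add: d2)
  then have "(norm (unitary_curve r a))\<^sup>2 = norm (1 + (d * d) *\<^sub>C (a * a * a * a))"
    by (simp add: x flip: cstar_identity)
  also have "\<dots> \<le> norm (1::'a) + norm ((d * d) *\<^sub>C (a * a * a * a))" by (rule norm_triangle_ineq)
  also have "\<dots> \<le> 1 + r ^ 4 * norm a ^ 4"
  proof -
    have "norm (a * a * a * a) \<le> norm a ^ 4"
      using norm_power_le[of a 4] by (simp add: numeral_eq_Suc mult.assoc)
    moreover have "cmod (d * d) = r ^ 4 / 4"
      by (simp add: d_def norm_mult norm_power power2_eq_square power4_eq_xxxx)
    ultimately have "norm ((d * d) *\<^sub>C (a * a * a * a)) \<le> r ^ 4 / 4 * norm a ^ 4"
      by (simp only: norm_scaleC) (intro mult_left_mono, auto)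
    also have "\<dots> \<le> r ^ 4 * norm a ^ 4" by (intro mult_right_mono) auto
    finally show ?thesis using norm_one_le[where ?'a = 'a] by simp
  qed
  finally show ?thesis .
qed

text \<open>Both sides are read off from the terms of order \<open>r\<^sup>2\<close> in \<open>|F(x\<^sub>r \<otimes> y\<^sub>r)| \<le> \<parallel>x\<^sub>r\<parallel> \<parallel>y\<^sub>r\<parallel>\<close>, where \<open>x\<^sub>r\<close> and \<open>y\<^sub>r\<close> run
  through the curves for \<open>a\<close> and \<open>b\<close>.\<close>

lemma state_covariance_bound:
  fixes F :: "('a::unital_cstar_algebra, 'b::unital_cstar_algebra) ptensor \<Rightarrow> complex"
  assumes F: "state F" and a: "star a = a" and b: "star b = b"
  shows "(Re (F (a \<otimes>\<^sub>\<gamma> 1)) + Re (F (1 \<otimes>\<^sub>\<gamma> b)))\<^sup>2 \<le>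
    Re (F ((a * a) \<otimes>\<^sub>\<gamma> 1)) + Re (F (1 \<otimes>\<^sub>\<gamma> (b * b))) + 2 * Re (F (a \<otimes>\<^sub>\<gamma> b))"
proof -
  let ?f1 = "F (a \<otimes>\<^sub>\<gamma> 1)" and ?f2 = "F ((a * a) \<otimes>\<^sub>\<gamma> 1)" and ?g1 = "F (1 \<otimes>\<^sub>\<gamma> b)"
    and ?g2 = "F (1 \<otimes>\<^sub>\<gamma> (b * b))" and ?v = "F (a \<otimes>\<^sub>\<gamma> b)" and ?p = "F (a \<otimes>\<^sub>\<gamma> (b * b))"
    and ?q = "F ((a * a) \<otimes>\<^sub>\<gamma> b)" and ?w = "F ((a * a) \<otimes>\<^sub>\<gamma> (b * b))"
  have im: "Im ?f1 = 0" "Im ?f2 = 0" "Im ?g1 = 0" "Im ?g2 = 0"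
    using state_self_adjoint[OF state_marginal(1)[OF F], of a]
      state_self_adjoint[OF state_marginal(1)[OF F], of "a * a"]
      state_self_adjoint[OF state_marginal(2)[OF F], of b]
      state_self_adjoint[OF state_marginal(2)[OF F], of "b * b"]
    by (simp_all add: a b star_mult)
  have "(Re ?f1 + Re ?g1)\<^sup>2 \<le> 2 * (Re ?f2 / 2 + Re ?g2 / 2 + Re ?v)"
  proof (rule second_order_bound)
    fix r :: real assume r: "0 < r"
    let ?z = "F (unitary_curve r a \<otimes>\<^sub>\<gamma> unitary_curve r b)"
    define c where "c = \<i> * complex_of_real r"
    define d where "d = - complex_of_real (r\<^sup>2 / 2)"
    have z: "?z = 1 + c * ?f1 + d * ?f2 + c * ?g1 + c * c * ?v + c * d * ?q + d * ?g2 + c * d * ?p + d * d * ?w"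
      unfolding unitary_curve_def c_def[symmetric] d_def[symmetric]
      using stateD[OF F]
      by (simp add: clinear_add[OF ptensor_elem_clinear_left] clinear_add[OF ptensor_elem_clinear_right]
          clinear_scaleC[OF ptensor_elem_clinear_left] clinear_scaleC[OF ptensor_elem_clinear_right]
          clinear_add clinear_complexD one_ptensor_def[symmetric] algebra_simps)
    have c2: "c * c = - complex_of_real (r\<^sup>2)" and c3: "c * d = - \<i> * complex_of_real (r ^ 3 / 2)"
      and d2: "d * d = complex_of_real (r ^ 4 / 4)"
      by (simp_all add: c_def d_def complex_eq_iff power2_eq_square power3_eq_cube power4_eq_xxxx)
    have re: "Re ?z = 1 - r\<^sup>2 * (Re ?f2 / 2 + Re ?g2 / 2 + Re ?v) + r ^ 3 * ((Im ?p + Im ?q) / 2) + r ^ 4 * (Re ?w / 4)"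
      unfolding z c2 c3 d2 by (simp add: c_def d_def im field_simps)
    have imz: "Im ?z = r * (Re ?f1 + Re ?g1) + r\<^sup>2 * (- Im ?v) + r ^ 3 * (- (Re ?p + Re ?q) / 2) + r ^ 4 * (Im ?w / 4)"
      unfolding z c2 c3 d2 by (simp add: c_def d_def im field_simps)
    have "cmod ?z \<le> norm (unitary_curve r a) * norm (unitary_curve r b)"
      using stateD(2)[OF F] norm_ptensor_elem_le by (rule order_trans)
    then have "(cmod ?z)\<^sup>2 \<le> (norm (unitary_curve r a))\<^sup>2 * (norm (unitary_curve r b))\<^sup>2"
      by (simp add: power_mono flip: power_mult_distrib)
    also have "\<dots> \<le> (1 + r ^ 4 * norm a ^ 4) * (1 + r ^ 4 * norm b ^ 4)"
      by (intro mult_mono norm_unitary_curve a b) auto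
    finally show "(1 - r\<^sup>2 * (Re ?f2 / 2 + Re ?g2 / 2 + Re ?v) + r ^ 3 * ((Im ?p + Im ?q) / 2) + r ^ 4 * (Re ?w / 4))\<^sup>2 +
        (r * (Re ?f1 + Re ?g1) + r\<^sup>2 * (- Im ?v) + r ^ 3 * (- (Re ?p + Re ?q) / 2) + r ^ 4 * (Im ?w / 4))\<^sup>2 \<le>
        (1 + r ^ 4 * norm a ^ 4) * (1 + r ^ 4 * norm b ^ 4)"
      by (simp only: cmod_power2 re imz)
  qed
  then show ?thesis by simp
qed

definition covariance ::
  "(('a::unital_cstar_algebra, 'b::unital_cstar_algebra) ptensor \<Rightarrow> complex) \<Rightarrow> 'a \<Rightarrow> 'b \<Rightarrow> complex" where
  "covariance F x y = F (x \<otimes>\<^sub>\<gamma> y) - F (x \<otimes>\<^sub>\<gamma> 1) * F (1 \<otimes>\<^sub>\<gamma> y)"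

lemma covariance_add_left:
  assumes "clinear F"
  shows "covariance F (x + x') y = covariance F x y + covariance F x' y"
  using assms by (simp add: covariance_def clinear_add clinear_add[OF ptensor_elem_clinear_left] algebra_simps)

lemma covariance_add_right:
  assumes "clinear F"
  shows "covariance F x (y + y') = covariance F x y + covariance F x y'"
  using assms by (simp add: covariance_def clinear_add clinear_add[OF ptensor_elem_clinear_right] algebra_simps)

lemma covariance_scaleC_left:
  assumes "clinear F"
  shows "covariance F (c *\<^sub>C x) y = c * covariance F x y"
  using assms
  by (simp add: covariance_def clinear_complexD clinear_scaleC[OF ptensor_elem_clinear_left] algebra_simps)

lemma covariance_scaleC_right:
  assumes "clinear F"
  shows "covariance F x (c *\<^sub>C y) = c * covariance F x y"
  using assms
  by (simp add: covariance_def clinear_complexD clinear_scaleC[OF ptensor_elem_clinear_right] algebra_simps)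

text \<open>Only the real part of \<open>F(a \<otimes> b)\<close> enters into \<open>state_covariance_bound\<close>. That \<open>F\<close> respects the involution
  makes the covariance real, and replacing \<open>b\<close> by \<open>-b\<close> bounds it from both sides.\<close>

lemma covariance_self_adjoint:
  fixes F :: "('a::unital_cstar_algebra, 'b::unital_cstar_algebra) ptensor \<Rightarrow> complex"
  assumes F: "state F" and star: "\<And>z. F (star z) = cnj (F z)" and a: "star a = a" and b: "star b = b"
  shows "2 * cmod (covariance F a b) \<le>
    (Re (F ((a * a) \<otimes>\<^sub>\<gamma> 1)) - (Re (F (a \<otimes>\<^sub>\<gamma> 1)))\<^sup>2) + (Re (F (1 \<otimes>\<^sub>\<gamma> (b * b))) - (Re (F (1 \<otimes>\<^sub>\<gamma> b)))\<^sup>2)"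
proof -
  have im: "Im (F (a \<otimes>\<^sub>\<gamma> 1)) = 0" "Im (F (1 \<otimes>\<^sub>\<gamma> b)) = 0" "Im (F (a \<otimes>\<^sub>\<gamma> b)) = 0"
    using star[of "a \<otimes>\<^sub>\<gamma> 1"] star[of "1 \<otimes>\<^sub>\<gamma> b"] star[of "a \<otimes>\<^sub>\<gamma> b"]
    by (simp_all add: star_ptensor_elem a b star_one complex_eq_iff)
  have lin: "clinear F" using F by (rule stateD)
  have neg: "F (x \<otimes>\<^sub>\<gamma> (- y)) = - F (x \<otimes>\<^sub>\<gamma> y)" for x y
    by (simp add: clinear_minus[OF ptensor_elem_clinear_right] clinear_minus[OF lin])
  have "cmod (covariance F a b) = \<bar>Re (F (a \<otimes>\<^sub>\<gamma> b)) - Re (F (a \<otimes>\<^sub>\<gamma> 1)) * Re (F (1 \<otimes>\<^sub>\<gamma> b))\<bar>"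
    by (subst cmod_eq_Re) (simp_all add: covariance_def im)
  moreover have "star (- b) = - b" by (simp add: star_minus b)
  ultimately show ?thesis
    using state_covariance_bound[OF F a b] state_covariance_bound[OF F a, of "- b"]
    by (simp add: neg power2_eq_square algebra_simps abs_if)
qed

text \<open>The covariance is expanded in the real and imaginary parts of \<open>x\<close> and \<open>y\<close>. The variances that bound
  the four terms sum up to \<open>f((x*x + xx*)/2) - |f x|\<^sup>2\<close> and the same expression in \<open>g\<close> and \<open>y\<close>.\<close>

lemma covariance_bound:
  fixes F :: "('a::unital_cstar_algebra, 'b::unital_cstar_algebra) ptensor \<Rightarrow> complex"
  assumes F: "state F" and star: "\<And>z. F (star z) = cnj (F z)" and x: "norm x \<le> 1" and y: "norm y \<le> 1"
  shows "cmod (covariance F x y) \<le> 2 - (cmod (F (x \<otimes>\<^sub>\<gamma> 1)))\<^sup>2 - (cmod (F (1 \<otimes>\<^sub>\<gamma> y)))\<^sup>2"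
proof -
  have lin: "clinear F" using F by (rule stateD)
  have var: "Re (f (a * a)) + Re (f (b * b)) \<le> 1" "(cmod (f z))\<^sup>2 = (Re (f a))\<^sup>2 + (Re (f b))\<^sup>2"
    if f: "state f" and ab: "star a = a" "star b = b" "z = a + \<i> *\<^sub>C b" and z: "norm z \<le> 1"
    for f :: "'c::unital_cstar_algebra \<Rightarrow> complex" and a b z
  proof -
    have lf: "clinear f" using f by (rule stateD)
    have "star z * z + z * star z = (a * a + b * b) + (a * a + b * b)"
      by (simp add: ab star_add star_scaleC distrib_left distrib_right mult_scaleC_left mult_scaleC_right
          scaleC_scaleC scaleC_uminus_left scaleC_one scaleC_add_right scaleC_diff_right
          scaleC_minus_left algebra_simps)
    then have "f (star z * z) + f (z * star z) = (f (a * a) + f (b * b)) + (f (a * a) + f (b * b))"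
      by (metis clinear_add[OF lf])
    then have "2 * (Re (f (a * a)) + Re (f (b * b))) = Re (f (star z * z)) + Re (f (z * star z))"
      by (simp add: complex_eq_iff)
    also have "\<dots> \<le> 1 + 1"
    proof (rule add_mono)
      have "Re (f w) \<le> 1" if "norm w \<le> 1" for w
        using complex_Re_le_cmod[of "f w"] stateD(2)[OF f, of w] that by linarith
      moreover have "norm (star z * z) \<le> 1" "norm (z * star z) \<le> 1"
        using norm_mult_ineq[of "star z" z] norm_mult_ineq[of z "star z"] z mult_le_one[of "norm z" "norm z"]
        by (simp_all add: norm_star)
      ultimately show "Re (f (star z * z)) \<le> 1" "Re (f (z * star z)) \<le> 1" by blast+
    qed
    finally show "Re (f (a * a)) + Re (f (b * b)) \<le> 1" by simp
    have "f z = Complex (Re (f a)) (Re (f b))"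
      using state_self_adjoint[OF f ab(1)] state_self_adjoint[OF f ab(2)]
      by (simp add: ab clinear_add[OF lf] clinear_complexD[OF lf] complex_eq_iff)
    then show "(cmod (f z))\<^sup>2 = (Re (f a))\<^sup>2 + (Re (f b))\<^sup>2" by (simp add: cmod_power2)
  qed
  obtain a1 a2 where a: "star a1 = a1" "star a2 = a2" "x = a1 + \<i> *\<^sub>C a2" by (rule self_adjoint_decomp)
  obtain b1 b2 where b: "star b1 = b1" "star b2 = b2" "y = b1 + \<i> *\<^sub>C b2" by (rule self_adjoint_decomp)
  note vx = var[OF state_marginal(1)[OF F] a x] and vy = var[OF state_marginal(2)[OF F] b y]
  let ?C = "covariance F"
  have "?C x y = (?C a1 b1 + \<i> * ?C a1 b2) + (\<i> * ?C a2 b1 + \<i> * (\<i> * ?C a2 b2))"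
    by (simp add: a b covariance_add_left[OF lin] covariance_add_right[OF lin]
        covariance_scaleC_left[OF lin] covariance_scaleC_right[OF lin] algebra_simps)
  then have "cmod (?C x y) \<le> (cmod (?C a1 b1) + cmod (?C a1 b2)) + (cmod (?C a2 b1) + cmod (?C a2 b2))"
    by (simp only:) (intro norm_triangle_mono, auto simp: norm_mult)
  with covariance_self_adjoint[OF F star a(1) b(1)] covariance_self_adjoint[OF F star a(1) b(2)]
    covariance_self_adjoint[OF F star a(2) b(1)] covariance_self_adjoint[OF F star a(2) b(2)]
  show ?thesis using vx vy by linarith
qed

text \<open>Write \<open>P\<close> for the product of the marginals. By \<open>covariance_bound\<close> and \<open>2pq \<le> p\<^sup>2 + q\<^sup>2\<close> the functional
  \<open>P + (\<i>/2) (F - P)\<close> is a state. At a Hermitian element it is real, and so are \<open>P\<close> and \<open>F\<close>, which forces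
  \<open>F - P\<close> to vanish there.\<close>

lemma hermitian_state_factor:
  fixes F :: "('a::unital_cstar_algebra, 'b::unital_cstar_algebra) ptensor \<Rightarrow> complex"
  assumes F: "state F" and star: "\<And>z. F (star z) = cnj (F z)" and u: "hermitian u"
  shows "F u = prod_functional (\<lambda>a. F (a \<otimes>\<^sub>\<gamma> 1)) (\<lambda>b. F (1 \<otimes>\<^sub>\<gamma> b)) u"
proof -
  let ?P = "prod_functional (\<lambda>a. F (a \<otimes>\<^sub>\<gamma> 1)) (\<lambda>b. F (1 \<otimes>\<^sub>\<gamma> b))"
  have P: "state ?P" by (intro state_prod_functional state_marginal F)
  have P_elem: "?P (x \<otimes>\<^sub>\<gamma> y) = F (x \<otimes>\<^sub>\<gamma> 1) * F (1 \<otimes>\<^sub>\<gamma> y)" for x y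
    by (intro prod_functional_elem bounded_clinear_state state_marginal F)
  let ?G = "\<lambda>z. ?P z + (\<i> / 2) *\<^sub>C (F z + (-1) *\<^sub>C ?P z)"
  have "state ?G"
  proof (rule state_if_contractive)
    show "bounded_clinear ?G"
      by (intro bounded_clinear_add bounded_clinear_compose[OF bounded_clinear_scaleC] bounded_clinear_state F P)
    show "?G 1 = 1" by (simp add: stateD(3)[OF F] stateD(3)[OF P] scaleC_complex_def)
    fix x :: 'a and y :: 'b assume xy: "norm x \<le> 1" "norm y \<le> 1"
    let ?p = "cmod (F (x \<otimes>\<^sub>\<gamma> 1))" and ?q = "cmod (F (1 \<otimes>\<^sub>\<gamma> y))"
    have "?G (x \<otimes>\<^sub>\<gamma> y) = F (x \<otimes>\<^sub>\<gamma> 1) * F (1 \<otimes>\<^sub>\<gamma> y) + (\<i> / 2) * covariance F x y"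
      by (simp add: P_elem covariance_def scaleC_complex_def)
    then have "cmod (?G (x \<otimes>\<^sub>\<gamma> y)) \<le> ?p * ?q + cmod (covariance F x y) / 2"
      by (simp only:) (rule norm_triangle_le, simp add: norm_mult norm_divide)
    also have "\<dots> \<le> ?p * ?q + (2 - ?p\<^sup>2 - ?q\<^sup>2) / 2"
      using covariance_bound[OF F star xy] by simp
    also have "\<dots> \<le> 1"
      using zero_le_power2[of "?p - ?q"] by (simp add: power2_diff field_simps)
    finally show "cmod (?G (x \<otimes>\<^sub>\<gamma> y)) \<le> 1" .
  qed
  then have "Im (?G u) = 0" by (rule u[unfolded hermitian_def, rule_format])
  moreover have "Im (F u) = 0" "Im (?P u) = 0"
    using F P u by (simp_all add: hermitian_def)
  ultimately show ?thesis by (simp add: scaleC_complex_def complex_eq_iff)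
qed

lemma bounded_clinear_adjoint:
  fixes F :: "'x::complex_normed_star_algebra \<Rightarrow> complex"
  assumes "bounded_clinear F"
  shows "bounded_clinear (\<lambda>z. cnj (F (star z)))"
proof -
  obtain K where K: "\<And>z. norm (F z) \<le> K * norm z" using assms by (auto simp: bounded_clinear_def)
  show ?thesis
  proof (rule bounded_clinearI)
    show "clinear (\<lambda>z. cnj (F (star z)))"
      using bounded_clinear_clinear[OF assms]
      by (simp add: clinear_def star_add star_scaleC scaleC_complex_def)
    show "norm (cnj (F (star z))) \<le> K * norm z" for z
      using K[of "star z"] by (simp add: norm_star)
  qed
qed

lemma prod_functional_star:
  fixes f :: "'a::unital_cstar_algebra \<Rightarrow> complex" and g :: "'b::unital_cstar_algebra \<Rightarrow> complex"
  assumes "state f" "state g"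
  shows "prod_functional f g (star z) = cnj (prod_functional f g z)"
proof -
  note b = assms[THEN bounded_clinear_state]
  have "cnj (prod_functional f g (star z)) = prod_functional f g z"
    by (rule ptensor_eqI)
       (auto simp: bounded_clinear_adjoint bounded_clinear_prod_functional b star_ptensor_elem
          prod_functional_elem state_star assms)
  then show ?thesis by (metis complex_cnj_cnj)
qed

lemma star_one_ptensor: "star 1 = (1 :: ('a::unital_cstar_algebra, 'b::unital_cstar_algebra) ptensor)"
  by (simp add: one_ptensor_def star_ptensor_elem star_one)

lemma state_adjoint:
  fixes F :: "('a::unital_cstar_algebra, 'b::unital_cstar_algebra) ptensor \<Rightarrow> complex"
  assumes F: "state F"
  shows "state (\<lambda>z. cnj (F (star z)))"
  unfolding state_def
  using bounded_clinear_clinear[OF bounded_clinear_adjoint[OF bounded_clinear_state[OF F]]]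
    stateD(2)[OF F, of "star _"] stateD(3)[OF F]
  by (auto simp: norm_star star_one_ptensor)

lemma state_average:
  assumes F: "state F" and G: "state G"
  shows "state (\<lambda>z. (1/2) *\<^sub>C (F z + G z))"
  unfolding state_def
proof (intro conjI allI)
  show "clinear (\<lambda>z. (1/2) *\<^sub>C (F z + G z))"
    by (intro bounded_clinear_clinear bounded_clinear_compose[OF bounded_clinear_scaleC]
        bounded_clinear_add bounded_clinear_state F G)
  show "cmod ((1/2) *\<^sub>C (F z + G z)) \<le> norm z" for z
    using norm_triangle_ineq[of "F z" "G z"] stateD(2)[OF F, of z] stateD(2)[OF G, of z]
    by (simp add: norm_scaleC norm_divide)
qed (simp add: stateD[OF F] stateD[OF G] scaleC_complex_def)

text \<open>For the mean \<open>F\<close> of two product states the difference of \<open>F\<close> and the product of its marginals is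
  \<open>(f - f') \<otimes> (g - g') / 4\<close>.\<close>

lemma hermitian_cross:
  fixes u :: "('a::unital_cstar_algebra, 'b::unital_cstar_algebra) ptensor"
  assumes u: "hermitian u" and f: "state f" "state f'" and g: "state g" "state g'"
  shows "prod_functional f g u + prod_functional f' g' u = prod_functional f g' u + prod_functional f' g u"
proof -
  let ?F = "\<lambda>z. (1/2) *\<^sub>C (prod_functional f g z + prod_functional f' g' z)"
  let ?h = "\<lambda>a. (1/2) *\<^sub>C (f a + f' a)" and ?k = "\<lambda>b. (1/2) *\<^sub>C (g b + g' b)"
  note b = f[THEN bounded_clinear_state] g[THEN bounded_clinear_state]
  have "state ?F" by (intro state_average state_prod_functional f g)
  moreover have "?F (star z) = cnj (?F z)" for z
    by (simp add: prod_functional_star f g scaleC_complex_def)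
  ultimately have "?F u = prod_functional (\<lambda>a. ?F (a \<otimes>\<^sub>\<gamma> 1)) (\<lambda>b. ?F (1 \<otimes>\<^sub>\<gamma> b)) u"
    by (rule hermitian_state_factor[OF _ _ u])
  also have "\<dots> = prod_functional ?h ?k u"
    by (simp add: prod_functional_elem b stateD[OF f(1)] stateD[OF f(2)] stateD[OF g(1)] stateD[OF g(2)])
  also have "\<dots> = (1/4) *\<^sub>C ((prod_functional f g u + prod_functional f' g' u) +
      (prod_functional f g' u + prod_functional f' g u))"
  proof (rule ptensor_eqI)
    have hk: "bounded_clinear ?h" "bounded_clinear ?k"
      by (intro bounded_clinear_compose[OF bounded_clinear_scaleC] bounded_clinear_add b)+
    show "bounded_clinear (prod_functional ?h ?k)" by (rule bounded_clinear_prod_functional[OF hk])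
    show "bounded_clinear (\<lambda>u. (1/4) *\<^sub>C ((prod_functional f g u + prod_functional f' g' u) +
      (prod_functional f g' u + prod_functional f' g u)))"
      by (intro bounded_clinear_compose[OF bounded_clinear_scaleC] bounded_clinear_add
          bounded_clinear_prod_functional b)
    show "prod_functional ?h ?k (x \<otimes>\<^sub>\<gamma> y) = (1/4) *\<^sub>C ((prod_functional f g (x \<otimes>\<^sub>\<gamma> y) +
        prod_functional f' g' (x \<otimes>\<^sub>\<gamma> y)) + (prod_functional f g' (x \<otimes>\<^sub>\<gamma> y) + prod_functional f' g (x \<otimes>\<^sub>\<gamma> y)))"
      for x y
      unfolding prod_functional_elem[OF hk]
      by (simp add: prod_functional_elem b scaleC_complex_def algebra_simps)
  qed
  finally have average: "?F u = (1/4) *\<^sub>C ((prod_functional f g u + prod_functional f' g' u) +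
      (prod_functional f g' u + prod_functional f' g u))" .
  have "s = t" if "(1/2) *\<^sub>C s = (1/4) *\<^sub>C (s + t)" for s t :: complex
    using that by (simp add: scaleC_complex_def complex_eq_iff)
  from this[OF average] show ?thesis .
qed

text \<open>By \<open>hermitian_cross\<close> the slices of \<open>u\<close> by fixed states determine all product states at \<open>u\<close>, and by
  \<open>hermitian_state_factor\<close> those determine all states. A state \<open>F\<close> that does not respect the involution
  may be averaged with \<open>z \<mapsto> cnj (F (star z))\<close> without changing its value at \<open>u\<close> or its marginals.\<close>

lemma hermitian_self_adjoint_sum:
  fixes u :: "('a::unital_cstar_algebra, 'b::unital_cstar_algebra) ptensor"
  assumes u: "hermitian u" "star u = u" and "(1::'a) \<noteq> 0" "(1::'b) \<noteq> 0"
  obtains a b where "u = a \<otimes>\<^sub>\<gamma> 1 + 1 \<otimes>\<^sub>\<gamma> b"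
proof -
  obtain f0 :: "'a \<Rightarrow> complex" where f0: "state f0" using states_exist[OF assms(3)] .
  obtain g0 :: "'b \<Rightarrow> complex" where g0: "state g0" using states_exist[OF assms(4)] .
  note b0 = f0[THEN bounded_clinear_state] g0[THEN bounded_clinear_state]
  let ?c = "prod_functional f0 g0 u"
  let ?s = "(slice_right g0 u - ?c *\<^sub>C 1) \<otimes>\<^sub>\<gamma> 1 + 1 \<otimes>\<^sub>\<gamma> slice_left f0 u"
  have "u - ?s = 0"
  proof (rule states_separate)
    fix F :: "('a, 'b) ptensor \<Rightarrow> complex" assume F: "state F"
    let ?f = "\<lambda>a. F (a \<otimes>\<^sub>\<gamma> 1)" and ?g = "\<lambda>b. F (1 \<otimes>\<^sub>\<gamma> b)"
    have f: "state ?f" and g: "state ?g" by (intro state_marginal F)+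
    note b = f[THEN bounded_clinear_state] g[THEN bounded_clinear_state]
    let ?R = "\<lambda>z. (1/2) *\<^sub>C (F z + cnj (F (star z)))"
    have R: "state ?R" by (intro state_average state_adjoint F)
    have "?R (star z) = cnj (?R z)" for z by (simp add: star_star scaleC_complex_def)
    from hermitian_state_factor[OF R this u(1)]
    have "?R u = prod_functional (\<lambda>a. ?R (a \<otimes>\<^sub>\<gamma> 1)) (\<lambda>b. ?R (1 \<otimes>\<^sub>\<gamma> b)) u" .
    moreover have "(\<lambda>a. ?R (a \<otimes>\<^sub>\<gamma> 1)) = ?f" "(\<lambda>b. ?R (1 \<otimes>\<^sub>\<gamma> b)) = ?g"
      using state_star[OF f] state_star[OF g]
      by (simp_all add: fun_eq_iff star_ptensor_elem star_one scaleC_complex_def)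
    moreover have "?R u = F u"
    proof -
      have "Im (F u) = 0" using u(1) F by (simp add: hermitian_def)
      then show ?thesis by (simp add: u(2) scaleC_complex_def complex_eq_iff)
    qed
    ultimately have F_u: "F u = prod_functional ?f ?g u" by simp
    have cross: "prod_functional ?f ?g u + ?c = prod_functional ?f g0 u + prod_functional f0 ?g u"
      by (rule hermitian_cross[OF u(1) f f0 g g0])
    have "F ?s = ?f (slice_right g0 u) - ?c + ?g (slice_left f0 u)"
      using stateD(3)[OF f]
      by (simp add: clinear_add[OF stateD(1)[OF F]] clinear_diff[OF stateD(1)[OF f]]
          clinear_complexD[OF stateD(1)[OF f]])
    also have "\<dots> = (prod_functional ?f g0 u + prod_functional f0 ?g u) - ?c"
      by (simp add: slice_right_functional[OF b(1) b0(2)] slice_left_functional[OF b0(1) b(2)])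
    also have "\<dots> = F u" by (simp add: F_u flip: cross)
    finally show "F (u - ?s) = 0" by (simp add: clinear_diff[OF stateD(1)[OF F]])
  qed
  then show ?thesis using that by simp
qed

section \<open>Hermitian elements with a Hermitian square\<close>

lemma hermitian_add: "hermitian u \<Longrightarrow> hermitian v \<Longrightarrow> hermitian (u + v)"
  by (simp add: hermitian_def clinear_add stateD(1))

lemma hermitian_diff: "hermitian u \<Longrightarrow> hermitian v \<Longrightarrow> hermitian (u - v)"
  by (simp add: hermitian_def clinear_diff stateD(1))

lemma hermitian_scaleR: "hermitian u \<Longrightarrow> hermitian (r *\<^sub>R u)"
  by (simp add: hermitian_def clinear_scaleR stateD(1))

lemma hermitian_star:
  fixes u :: "('a::unital_cstar_algebra, 'b::unital_cstar_algebra) ptensor"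
  assumes "hermitian u"
  shows "hermitian (star u)"
  unfolding hermitian_def
proof (intro allI impI)
  fix F :: "('a, 'b) ptensor \<Rightarrow> complex" assume "state F"
  then have "Im (cnj (F (star u))) = 0"
    using assms state_adjoint unfolding hermitian_def by blast
  then show "Im (F (star u)) = 0" by simp
qed

text \<open>The kernel of the map of \<open>A \<otimes>\<^sub>\<gamma> B\<close> to the minimal C*-tensor product.\<close>

definition product_null :: "('a::complex_normed_unital_algebra, 'b::complex_normed_unital_algebra) ptensor \<Rightarrow> bool" where
  "product_null w \<longleftrightarrow> (\<forall>f g. state f \<longrightarrow> state g \<longrightarrow> prod_functional f g w = 0)"

text \<open>A slice by a state vanishes because the states of the other algebra vanish at it. This allows to
  replace one state after the other by an arbitrary functional.\<close>

lemma product_null_functionals: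
  fixes w :: "('a::unital_cstar_algebra, 'b::unital_cstar_algebra) ptensor"
  assumes w: "product_null w" and \<phi>: "bounded_clinear \<phi>" and \<psi>: "bounded_clinear \<psi>"
  shows "prod_functional \<phi> \<psi> w = 0"
proof -
  have right: "slice_right g w = 0" if g: "state g" for g
  proof (rule states_separate)
    fix f :: "'a \<Rightarrow> complex" assume "state f"
    with g w show "f (slice_right g w) = 0"
      by (simp add: slice_right_functional bounded_clinear_state product_null_def)
  qed
  have "slice_left \<phi> w = 0"
  proof (rule states_separate)
    fix g :: "'b \<Rightarrow> complex" assume g: "state g"
    have "g (slice_left \<phi> w) = \<phi> (slice_right g w)"
      by (simp add: slice_left_functional slice_right_functional \<phi> bounded_clinear_state g)
    then show "g (slice_left \<phi> w) = 0"
      by (simp add: right[OF g] clinear_zero[OF bounded_clinear_clinear[OF \<phi>]])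
  qed
  then show ?thesis
    by (simp add: clinear_zero[OF bounded_clinear_clinear[OF \<psi>]] flip: slice_left_functional[OF \<phi> \<psi>])
qed

text \<open>Right multiplication by \<open>c \<otimes> d\<close> only changes the functionals \<open>f\<close> and \<open>g\<close>, though not into states.\<close>

lemma product_null_mult:
  fixes w :: "('a::unital_cstar_algebra, 'b::unital_cstar_algebra) ptensor"
  assumes w: "product_null w"
  shows "product_null (w * z)"
  unfolding product_null_def
proof (intro allI impI)
  fix f :: "'a \<Rightarrow> complex" and g :: "'b \<Rightarrow> complex" assume "state f" "state g"
  then have fg: "bounded_clinear f" "bounded_clinear g" by (auto intro: bounded_clinear_state)
  note P = bounded_clinear_prod_functional[OF fg]
  show "prod_functional f g (w * z) = 0"
  proof (rule ptensor_eqI[where f = "\<lambda>z. prod_functional f g (w * z)" and g = "\<lambda>z. 0"])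
    show "bounded_clinear (\<lambda>z. prod_functional f g (w * z))"
      by (rule bounded_clinear_compose[OF P bounded_clinear_mult_left])
    show "bounded_clinear (\<lambda>z :: ('a, 'b) ptensor. 0 :: complex)" by (rule bounded_clinear_zero)
    fix c :: 'a and d :: 'b
    have fc: "bounded_clinear (\<lambda>x. f (x * c))" and gd: "bounded_clinear (\<lambda>y. g (y * d))"
      by (intro bounded_clinear_compose[OF _ bounded_clinear_mult_right] fg)+
    have "prod_functional f g (w * (c \<otimes>\<^sub>\<gamma> d)) = prod_functional (\<lambda>x. f (x * c)) (\<lambda>y. g (y * d)) w"
    proof (rule ptensor_eqI)
      show "bounded_clinear (\<lambda>w. prod_functional f g (w * (c \<otimes>\<^sub>\<gamma> d)))"
        by (rule bounded_clinear_compose[OF P bounded_clinear_mult_right])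
      show "bounded_clinear (prod_functional (\<lambda>x. f (x * c)) (\<lambda>y. g (y * d)))"
        by (rule bounded_clinear_prod_functional[OF fc gd])
      show "prod_functional f g ((x \<otimes>\<^sub>\<gamma> y) * (c \<otimes>\<^sub>\<gamma> d)) =
          prod_functional (\<lambda>x. f (x * c)) (\<lambda>y. g (y * d)) (x \<otimes>\<^sub>\<gamma> y)" for x y
        by (simp add: ptensor_elem_mult prod_functional_elem fg fc gd)
    qed
    then show "prod_functional f g (w * (c \<otimes>\<^sub>\<gamma> d)) = 0"
      by (simp add: product_null_functionals[OF w fc gd])
  qed
qed

lemma prod_functional_sum:
  assumes f: "state f" and g: "state g"
  shows "prod_functional f g (a \<otimes>\<^sub>\<gamma> 1 + 1 \<otimes>\<^sub>\<gamma> b) = f a + g b"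
  by (simp add: clinear_add[OF stateD(1)[OF state_prod_functional[OF f g]]]
      prod_functional_elem bounded_clinear_state f g stateD(3)[OF f] stateD(3)[OF g])

lemma product_null_sum:
  fixes p :: "('a::unital_cstar_algebra, 'b::unital_cstar_algebra) ptensor"
  assumes p: "p = a \<otimes>\<^sub>\<gamma> 1 + 1 \<otimes>\<^sub>\<gamma> b" and null: "product_null p"
  shows "p = 0"
proof (rule states_separate)
  fix F :: "('a, 'b) ptensor \<Rightarrow> complex" assume F: "state F"
  have "F p = F (a \<otimes>\<^sub>\<gamma> 1) + F (1 \<otimes>\<^sub>\<gamma> b)"
    by (simp add: p clinear_add[OF stateD(1)[OF F]])
  also have "\<dots> = prod_functional (\<lambda>a. F (a \<otimes>\<^sub>\<gamma> 1)) (\<lambda>b. F (1 \<otimes>\<^sub>\<gamma> b)) p"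
    unfolding p by (rule prod_functional_sum[OF state_marginal[OF F], symmetric])
  also have "\<dots> = 0" using null state_marginal[OF F] by (simp add: product_null_def)
  finally show "F p = 0" .
qed

lemma scalar_if_states_agree:
  fixes a :: "'x::complex_normed_unital_algebra"
  assumes "\<And>f f'. state f \<Longrightarrow> state f' \<Longrightarrow> f a = f' a"
  obtains \<alpha> where "a = \<alpha> *\<^sub>C 1"
proof (cases "(1::'x) = 0")
  case True
  then show ?thesis using that zero_if_one_zero by metis
next
  case False
  then obtain f0 :: "'x \<Rightarrow> complex" where f0: "state f0" by (rule states_exist)
  have "a - f0 a *\<^sub>C 1 = 0"
  proof (rule states_separate)
    fix f :: "'x \<Rightarrow> complex" assume f: "state f"
    then show "f (a - f0 a *\<^sub>C 1) = 0"
      using assms[OF f f0] stateD[OF f] by (simp add: clinear_diff clinear_complexD)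
  qed
  then show ?thesis using that by simp
qed

text \<open>Let \<open>s\<close> and \<open>w\<close> be the self-adjoint and the skew part of \<open>u\<close>; then \<open>s\<^sup>2 + w\<^sup>2\<close> is the self-adjoint part of \<open>u\<^sup>2\<close>.
  Product states are real at \<open>u\<close>, so they vanish at \<open>w\<close> and at \<open>w\<^sup>2\<close>. Both \<open>s\<close> and \<open>s\<^sup>2 + w\<^sup>2\<close> are sums
  \<open>a \<otimes> 1 + 1 \<otimes> b\<close>. Product functionals therefore see the mixed term of \<open>s\<^sup>2\<close> as zero, which puts \<open>s\<close>
  into one leg. Then \<open>w\<^sup>2\<close> is such a sum too, hence zero.\<close>

lemma hermitian_with_square:
  fixes u :: "('a::unital_cstar_algebra, 'b::unital_cstar_algebra) ptensor"
  assumes u: "hermitian u" and uu: "hermitian (u * u)" and one: "(1::'a) \<noteq> 0" "(1::'b) \<noteq> 0"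
  shows "u \<in> range (\<lambda>a. a \<otimes>\<^sub>\<gamma> 1) \<union> range (\<lambda>b. 1 \<otimes>\<^sub>\<gamma> b)"
proof -
  define s where "s = (1/2) *\<^sub>R (u + star u)"
  define w where "w = (1/2) *\<^sub>R (u - star u)"
  define t where "t = (1/2) *\<^sub>R (u * u + star (u * u))"
  have u_eq: "u = s + w" "star u = s - w"
    by (simp_all add: s_def w_def algebra_simps flip: scaleR_add_left)
  have "u * u + star (u * u) = (s * s + w * w) + (s * s + w * w)"
    by (simp add: star_mult u_eq(2)) (simp add: u_eq(1) algebra_simps)
  then have t: "t = s * s + w * w" by (simp add: t_def flip: scaleR_2)
  have herm: "hermitian s" "hermitian w" "hermitian t"
    unfolding s_def w_def t_def
    by (intro hermitian_scaleR hermitian_add hermitian_diff hermitian_star u uu)+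
  have star: "star s = s" "star t = t"
    by (simp_all add: s_def t_def star_scaleR star_add star_star add.commute)
  have null_w: "product_null w"
    unfolding product_null_def
  proof (intro allI impI)
    fix f :: "'a \<Rightarrow> complex" and g :: "'b \<Rightarrow> complex" assume fg: "state f" "state g"
    let ?P = "prod_functional f g"
    have P: "state ?P" by (rule state_prod_functional[OF fg])
    have "Im (?P u) = 0" using u P by (simp add: hermitian_def)
    moreover have "?P w = (1/2) *\<^sub>R (?P u - cnj (?P u))"
      by (simp add: w_def clinear_scaleR[OF stateD(1)[OF P]] clinear_diff[OF stateD(1)[OF P]]
          prod_functional_star[OF fg])
    ultimately show "?P w = 0" by (simp add: complex_eq_iff)
  qed
  then have null: "product_null (w * w)" by (rule product_null_mult)
  obtain a b where s: "s = a \<otimes>\<^sub>\<gamma> 1 + 1 \<otimes>\<^sub>\<gamma> b"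
    by (rule hermitian_self_adjoint_sum[OF herm(1) star(1) one])
  obtain a' b' where t_sum: "t = a' \<otimes>\<^sub>\<gamma> 1 + 1 \<otimes>\<^sub>\<gamma> b'"
    by (rule hermitian_self_adjoint_sum[OF herm(3) star(2) one])
  have cross: "(f a - f' a) * (g b - g' b) = 0"
    if f: "state f" "state f'" and g: "state g" "state g'" for f f' g g'
  proof -
    have P: "prod_functional f g t = f (a * a) + g (b * b) + 2 * (f a * g b)"
      if f: "state f" and g: "state g" for f g
    proof -
      note lin = stateD(1)[OF state_prod_functional[OF f g]]
      have "prod_functional f g t = prod_functional f g (s * s)"
        using null f g by (simp add: t clinear_add[OF lin] product_null_def)
      also have "s * s = ((a * a) \<otimes>\<^sub>\<gamma> 1 + 1 \<otimes>\<^sub>\<gamma> (b * b)) + (a \<otimes>\<^sub>\<gamma> b + a \<otimes>\<^sub>\<gamma> b)"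
        by (simp add: s distrib_left distrib_right ptensor_elem_mult)
      finally show ?thesis
        by (simp add: clinear_add[OF lin, of "_ + _" "_ + _"] prod_functional_sum[OF f g])
           (simp add: clinear_add[OF lin] prod_functional_elem bounded_clinear_state f g)
    qed
    from hermitian_cross[OF herm(3) f g] have "2 * ((f a - f' a) * (g b - g' b)) = 0"
      by (simp add: P f g algebra_simps)
    then show ?thesis by simp
  qed
  have left: "\<exists>\<alpha>. a = \<alpha> *\<^sub>C 1" if "state g" "state g'" "g b \<noteq> g' b" for g g'
  proof -
    have "f a = f' a" if "state f" "state f'" for f f'
      using cross[OF that \<open>state g\<close> \<open>state g'\<close>] \<open>g b \<noteq> g' b\<close> by simp
    then obtain \<alpha> where "a = \<alpha> *\<^sub>C 1" by (rule scalar_if_states_agree)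
    then show ?thesis by blast
  qed
  have "s \<in> range (\<lambda>a. a \<otimes>\<^sub>\<gamma> 1) \<union> range (\<lambda>b. 1 \<otimes>\<^sub>\<gamma> b)"
  proof (cases "\<exists>g g'. state g \<and> state g' \<and> g b \<noteq> g' b")
    case True
    with left obtain \<alpha> where "a = \<alpha> *\<^sub>C 1" by blast
    then have "s = 1 \<otimes>\<^sub>\<gamma> (\<alpha> *\<^sub>C 1 + b)"
      by (simp add: s clinear_add[OF ptensor_elem_clinear_right] clinear_scaleC[OF ptensor_elem_clinear_left]
          clinear_scaleC[OF ptensor_elem_clinear_right])
    then show ?thesis by blast
  next
    case False
    then have "g b = g' b" if "state g" "state g'" for g g' using that by blast
    then obtain \<beta> where "b = \<beta> *\<^sub>C 1" by (rule scalar_if_states_agree)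
    then have "s = (a + \<beta> *\<^sub>C 1) \<otimes>\<^sub>\<gamma> 1"
      by (simp add: s clinear_add[OF ptensor_elem_clinear_left] clinear_scaleC[OF ptensor_elem_clinear_left]
          clinear_scaleC[OF ptensor_elem_clinear_right])
    then show ?thesis by blast
  qed
  moreover have "w = 0"
  proof -
    obtain a1 b1 where ss: "s * s = a1 \<otimes>\<^sub>\<gamma> 1 + 1 \<otimes>\<^sub>\<gamma> b1"
      using calculation
    proof
      assume "s \<in> range (\<lambda>a. a \<otimes>\<^sub>\<gamma> 1)"
      then obtain x where "s = x \<otimes>\<^sub>\<gamma> 1" by blast
      then have "s * s = (x * x) \<otimes>\<^sub>\<gamma> 1 + 1 \<otimes>\<^sub>\<gamma> 0"
        by (simp add: ptensor_elem_mult clinear_zero[OF ptensor_elem_clinear_right])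
      then show ?thesis by (rule that)
    next
      assume "s \<in> range (\<lambda>b. 1 \<otimes>\<^sub>\<gamma> b)"
      then obtain y where "s = 1 \<otimes>\<^sub>\<gamma> y" by blast
      then have "s * s = 0 \<otimes>\<^sub>\<gamma> 1 + 1 \<otimes>\<^sub>\<gamma> (y * y)"
        by (simp add: ptensor_elem_mult clinear_zero[OF ptensor_elem_clinear_left])
      then show ?thesis by (rule that)
    qed
    have "w * w = t - s * s" by (simp add: t)
    also have "\<dots> = (a' - a1) \<otimes>\<^sub>\<gamma> 1 + 1 \<otimes>\<^sub>\<gamma> (b' - b1)"
      by (simp add: t_sum ss clinear_diff[OF ptensor_elem_clinear_left] clinear_diff[OF ptensor_elem_clinear_right])
    finally have "w * w = 0" using null by (rule product_null_sum)
    with herm(2) show "w = 0" by (rule hermitian_square_zero)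
  qed
  ultimately show ?thesis by (simp add: u_eq(1))
qed

section \<open>Isometric isomorphisms between projective tensor products\<close>

text \<open>A vector space is not the union of two proper subspaces.\<close>

lemma self_adjoint_dichotomy:
  fixes j :: "'x::complex_star_algebra \<Rightarrow> ('a::complex_normed_unital_algebra, 'b::complex_normed_unital_algebra) ptensor"
  assumes j: "clinear j"
    and sa: "\<And>x. star x = x \<Longrightarrow> j x \<in> range (\<lambda>a. a \<otimes>\<^sub>\<gamma> 1) \<union> range (\<lambda>b. 1 \<otimes>\<^sub>\<gamma> b)"
  shows "range j \<subseteq> range (\<lambda>a. a \<otimes>\<^sub>\<gamma> 1) \<or> range j \<subseteq> range (\<lambda>b. 1 \<otimes>\<^sub>\<gamma> b)"
proof -
  let ?A = "range (\<lambda>a::'a. a \<otimes>\<^sub>\<gamma> (1::'b))" and ?B = "range (\<lambda>b::'b. (1::'a) \<otimes>\<^sub>\<gamma> b)"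
  have A: "u + v \<in> ?A" "u - v \<in> ?A" "c *\<^sub>C u \<in> ?A" if "u \<in> ?A" "v \<in> ?A" for u v c
    using that by (auto simp flip: clinear_add[OF ptensor_elem_clinear_left]
        clinear_diff[OF ptensor_elem_clinear_left] clinear_scaleC[OF ptensor_elem_clinear_left])
  have B: "u + v \<in> ?B" "u - v \<in> ?B" "c *\<^sub>C u \<in> ?B" if "u \<in> ?B" "v \<in> ?B" for u v c
    using that by (auto simp flip: clinear_add[OF ptensor_elem_clinear_right]
        clinear_diff[OF ptensor_elem_clinear_right] clinear_scaleC[OF ptensor_elem_clinear_right])
  have "(\<forall>x. star x = x \<longrightarrow> j x \<in> ?A) \<or> (\<forall>x. star x = x \<longrightarrow> j x \<in> ?B)"
  proof (rule ccontr)
    assume "\<not> ?thesis"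
    then obtain x y where x: "star x = x" "j x \<notin> ?A" and y: "star y = y" "j y \<notin> ?B" by blast
    have "j x \<in> ?B" "j y \<in> ?A" using sa x y by blast+
    moreover have "j (x + y) \<in> ?A \<union> ?B" by (rule sa) (simp add: star_add x y)
    ultimately show False
      using x(2) y(2) A(2)[of "j (x + y)" "j y"] B(2)[of "j (x + y)" "j x"]
      by (auto simp: clinear_add[OF j])
  qed
  moreover have "j z = j x + \<i> *\<^sub>C j y" if "z = x + \<i> *\<^sub>C y" for x y z
    using that by (simp add: clinear_add[OF j] clinear_scaleC[OF j])
  ultimately show ?thesis
    by (metis (no_types, lifting) A(1,3) B(1,3) image_subsetI self_adjoint_decomp)
qed

text \<open>Slicing by a state of the second algebra is a contractive left inverse of \<open>a \<mapsto> a \<otimes> 1\<close>.\<close>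

lemma norm_elem_one:
  fixes a :: "'a::unital_cstar_algebra"
  assumes "(1::'b::unital_cstar_algebra) \<noteq> 0"
  shows "norm (a \<otimes>\<^sub>\<gamma> (1::'b)) = norm a"
proof (rule antisym)
  show "norm (a \<otimes>\<^sub>\<gamma> (1::'b)) \<le> norm a"
    using norm_ptensor_elem_le[of a "1::'b"] by (simp add: norm_one[OF assms])
  obtain g :: "'b \<Rightarrow> complex" where g: "state g" using states_exist[OF assms] .
  note b = bounded_clinear_slice_right[OF bounded_clinear_state[OF g], where ?'a = 'a]
  have "norm (slice_right g (a \<otimes>\<^sub>\<gamma> 1)) \<le> 1 * norm (a \<otimes>\<^sub>\<gamma> (1::'b))"
  proof (rule ptensor_norm_bound)
    show "norm (slice_right g (x \<otimes>\<^sub>\<gamma> y)) \<le> 1 * (norm x * norm y)" for x :: 'a and y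
      using mult_right_mono[OF stateD(2)[OF g, of y], of "norm x"]
      by (simp add: slice_right_elem bounded_clinear_state g norm_scaleC mult.commute)
  qed (use b in \<open>auto intro: bounded_clinear_clinear bounded_clinear_continuous\<close>)
  then show "norm a \<le> norm (a \<otimes>\<^sub>\<gamma> (1::'b))"
    by (simp add: slice_right_elem bounded_clinear_state g stateD(3)[OF g] scaleC_one)
qed

lemma norm_one_elem:
  fixes b :: "'b::unital_cstar_algebra"
  assumes "(1::'a::unital_cstar_algebra) \<noteq> 0"
  shows "norm ((1::'a) \<otimes>\<^sub>\<gamma> b) = norm b"
proof (rule antisym)
  show "norm ((1::'a) \<otimes>\<^sub>\<gamma> b) \<le> norm b"
    using norm_ptensor_elem_le[of "1::'a" b] by (simp add: norm_one[OF assms])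
  obtain f :: "'a \<Rightarrow> complex" where f: "state f" using states_exist[OF assms] .
  note b = bounded_clinear_slice_left[OF bounded_clinear_state[OF f], where ?'b = 'b]
  have "norm (slice_left f (1 \<otimes>\<^sub>\<gamma> b)) \<le> 1 * norm ((1::'a) \<otimes>\<^sub>\<gamma> b)"
  proof (rule ptensor_norm_bound)
    show "norm (slice_left f (x \<otimes>\<^sub>\<gamma> y)) \<le> 1 * (norm x * norm y)" for x and y :: 'b
      using mult_right_mono[OF stateD(2)[OF f, of x], of "norm y"]
      by (simp add: slice_left_elem bounded_clinear_state f norm_scaleC)
  qed (use b in \<open>auto intro: bounded_clinear_clinear bounded_clinear_continuous\<close>)
  then show "norm b \<le> norm ((1::'a) \<otimes>\<^sub>\<gamma> b)"
    by (simp add: slice_left_elem bounded_clinear_state f stateD(3)[OF f] scaleC_one)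
qed

lemma elem_one_inject:
  fixes a a' :: "'a::unital_cstar_algebra"
  assumes "(1::'b::unital_cstar_algebra) \<noteq> 0"
  shows "a \<otimes>\<^sub>\<gamma> (1::'b) = a' \<otimes>\<^sub>\<gamma> 1 \<longleftrightarrow> a = a'"
  using norm_elem_one[OF assms, of "a - a'"]
  unfolding clinear_diff[OF ptensor_elem_clinear_left] by (metis eq_iff_diff_eq_0 norm_eq_zero)

lemma one_elem_inject:
  fixes b b' :: "'b::unital_cstar_algebra"
  assumes "(1::'a::unital_cstar_algebra) \<noteq> 0"
  shows "(1::'a) \<otimes>\<^sub>\<gamma> b = 1 \<otimes>\<^sub>\<gamma> b' \<longleftrightarrow> b = b'"
  using norm_one_elem[OF assms, of "b - b'"]
  unfolding clinear_diff[OF ptensor_elem_clinear_right] by (metis eq_iff_diff_eq_0 norm_eq_zero)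

lemma bounded_clinear_isometric: "clinear f \<Longrightarrow> isometric f \<Longrightarrow> bounded_clinear f"
  by (rule bounded_clinearI[where K = 1]) (auto simp: norm_isometric)

lemma inj_isometric:
  fixes f :: "'x::complex_normed_vector \<Rightarrow> 'y::complex_normed_vector"
  shows "isometric f \<Longrightarrow> inj f"
  by (rule injI) (metis isometric_def dist_eq_0_iff)

lemma isometric_ptensor_map:
  assumes "clinear \<phi>" "isometric \<phi>" "clinear \<psi>" "isometric \<psi>"
  shows ptensor_map_elem: "ptensor_map \<phi> \<psi> (x \<otimes>\<^sub>\<gamma> y) = \<phi> x \<otimes>\<^sub>\<gamma> \<psi> y"
    and bounded_clinear_ptensor_map: "bounded_clinear (ptensor_map \<phi> \<psi>)"
    and norm_ptensor_map_le: "norm (ptensor_map \<phi> \<psi> z) \<le> norm z"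
proof -
  have \<phi>: "norm (\<phi> x) = norm x" for x using assms norm_isometric by blast
  have \<psi>: "norm (\<psi> x) = norm x" for x using assms norm_isometric by blast
  have *: "clinear (ptensor_map \<phi> \<psi>)" "continuous_on UNIV (ptensor_map \<phi> \<psi>)"
    "ptensor_map \<phi> \<psi> (x \<otimes>\<^sub>\<gamma> y) = \<phi> x \<otimes>\<^sub>\<gamma> \<psi> y" for x y
    by (rule ptensor_map[where K = 1 and L = 1]; use assms in \<open>simp add: \<phi> \<psi>\<close>)+
  show "ptensor_map \<phi> \<psi> (x \<otimes>\<^sub>\<gamma> y) = \<phi> x \<otimes>\<^sub>\<gamma> \<psi> y" by (rule *)
  have le: "norm (ptensor_map \<phi> \<psi> z) \<le> 1 * norm z" for z
    by (rule ptensor_norm_bound[OF *(1,2)]) (use norm_ptensor_elem_le[of "\<phi> _" "\<psi> _"] in \<open>auto simp: * \<phi> \<psi>\<close>)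
  then show "norm (ptensor_map \<phi> \<psi> z) \<le> norm z" by simp
  from *(1) le show "bounded_clinear (ptensor_map \<phi> \<psi>)" by (rule bounded_clinearI)
qed

lemma isometric_inv:
  assumes "bij f" "isometric f"
  shows "isometric (inv f)"
  unfolding isometric_def
  by (metis assms isometric_def bij_inv_eq_iff)

lemma multiplicative_if_on_elems:
  fixes f :: "('a::complex_normed_algebra, 'b::complex_normed_algebra) ptensor \<Rightarrow> 'c::complex_normed_algebra"
  assumes f: "bounded_clinear f"
    and mult: "\<And>x y x' y'. f ((x \<otimes>\<^sub>\<gamma> y) * (x' \<otimes>\<^sub>\<gamma> y')) = f (x \<otimes>\<^sub>\<gamma> y) * f (x' \<otimes>\<^sub>\<gamma> y')"
  shows "f (z * w) = f z * f w"
proof (rule ptensor_eqI[where f = "\<lambda>w. f (z * w)"])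
  show "bounded_clinear (\<lambda>w. f (z * w))" "bounded_clinear (\<lambda>w. f z * f w)"
    by (intro bounded_clinear_compose[OF f bounded_clinear_mult_left]
        bounded_clinear_compose[OF bounded_clinear_mult_left f])+
  fix x' y'
  show "f (z * (x' \<otimes>\<^sub>\<gamma> y')) = f z * f (x' \<otimes>\<^sub>\<gamma> y')"
  proof (rule ptensor_eqI[where f = "\<lambda>z. f (z * (x' \<otimes>\<^sub>\<gamma> y'))"])
    show "bounded_clinear (\<lambda>z. f (z * (x' \<otimes>\<^sub>\<gamma> y')))" "bounded_clinear (\<lambda>z. f z * f (x' \<otimes>\<^sub>\<gamma> y'))"
      by (intro bounded_clinear_compose[OF f bounded_clinear_mult_right]
          bounded_clinear_compose[OF bounded_clinear_mult_right f])+
  qed (rule mult)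
qed

lemma ptensor_map_iso:
  fixes \<phi> :: "'a::complex_normed_algebra \<Rightarrow> 'c::complex_normed_algebra"
    and \<psi> :: "'b::complex_normed_algebra \<Rightarrow> 'd::complex_normed_algebra"
  assumes \<phi>: "algebra_iso \<phi>" "isometric \<phi>" and \<psi>: "algebra_iso \<psi>" "isometric \<psi>"
  shows "algebra_iso (ptensor_map \<phi> \<psi>)" "isometric (ptensor_map \<phi> \<psi>)"
proof -
  have bij: "bij \<phi>" "bij \<psi>" and lin: "clinear \<phi>" "clinear \<psi>"
    and mult: "\<And>x y. \<phi> (x * y) = \<phi> x * \<phi> y" "\<And>x y. \<psi> (x * y) = \<psi> x * \<psi> y"
    using \<phi>(1) \<psi>(1) by (auto simp: algebra_iso_def)
  have lin': "clinear (inv \<phi>)" "clinear (inv \<psi>)"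
    using algebra_iso_inv[OF \<phi>(1)] algebra_iso_inv[OF \<psi>(1)] by (auto simp: algebra_iso_def)
  have iso': "isometric (inv \<phi>)" "isometric (inv \<psi>)"
    by (intro isometric_inv bij \<phi> \<psi>)+
  let ?m = "ptensor_map \<phi> \<psi>" and ?n = "ptensor_map (inv \<phi>) (inv \<psi>)"
  note m = isometric_ptensor_map[OF lin(1) \<phi>(2) lin(2) \<psi>(2)]
  note n = isometric_ptensor_map[OF lin'(1) iso'(1) lin'(2) iso'(2)]
  have nm: "?n (?m z) = z" for z
    by (rule ptensor_eqI[OF bounded_clinear_compose[OF n(2) m(2)] bounded_clinear_id])
       (simp add: m n bij_is_inj bij)
  have mn: "?m (?n z) = z" for z
    by (rule ptensor_eqI[OF bounded_clinear_compose[OF m(2) n(2)] bounded_clinear_id])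
       (simp add: m n bij_is_surj surj_f_inv_f bij)
  have "bij ?m" by (rule o_bij[of ?n]) (auto simp: fun_eq_iff nm mn)
  moreover have "?m (z * w) = ?m z * ?m w" for z w
    by (rule multiplicative_if_on_elems[OF m(2)]) (simp add: m ptensor_elem_mult mult)
  ultimately show "algebra_iso ?m" using m(2) by (simp add: algebra_iso_def bounded_clinear_def)
  have "norm (?m z) = norm z" for z
    using m(3)[of z] n(3)[of "?m z"] by (simp add: nm)
  then show "isometric ?m" using norm_isometric[OF bounded_clinear_clinear[OF m(2)]] by blast
qed

lemma norm_ptensor_flip_le: "norm (ptensor_flip z) \<le> norm z"
proof -
  have "norm (ptensor_flip z) \<le> 1 * norm z"
    by (rule ptensor_norm_bound[OF ptensor_flip(1,2)])
       (use norm_ptensor_elem_le in \<open>auto simp: ptensor_flip(3) mult.commute\<close>)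
  then show ?thesis by simp
qed

lemma bounded_clinear_ptensor_flip: "bounded_clinear ptensor_flip"
  by (rule bounded_clinearI[where K = 1]) (simp_all add: ptensor_flip norm_ptensor_flip_le)

lemma ptensor_flip_flip: "ptensor_flip (ptensor_flip z) = z"
  by (rule ptensor_eqI[OF bounded_clinear_compose[OF bounded_clinear_ptensor_flip bounded_clinear_ptensor_flip]
        bounded_clinear_id])
     (simp add: ptensor_flip)

lemma ptensor_flip_iso:
  fixes flip :: "('a::complex_normed_algebra, 'b::complex_normed_algebra) ptensor \<Rightarrow> ('b, 'a) ptensor"
  defines "flip \<equiv> ptensor_flip"
  shows "algebra_iso flip" "isometric flip"
proof -
  have "bij flip"
    unfolding flip_def by (rule o_bij[of ptensor_flip]) (auto simp: fun_eq_iff ptensor_flip_flip)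
  moreover have "flip (z * w) = flip z * flip w" for z w
    unfolding flip_def
    by (rule multiplicative_if_on_elems[OF bounded_clinear_ptensor_flip])
       (simp add: ptensor_flip ptensor_elem_mult)
  ultimately show "algebra_iso flip" by (simp add: algebra_iso_def flip_def ptensor_flip(1))
  have "norm (flip z) = norm z" for z
    using norm_ptensor_flip_le[of z] norm_ptensor_flip_le[of "ptensor_flip z"]
    by (simp add: flip_def ptensor_flip_flip)
  then show "isometric flip"
    unfolding flip_def norm_isometric[OF ptensor_flip(1)] by simp
qed

lemma algebra_iso_comp: "algebra_iso f \<Longrightarrow> algebra_iso g \<Longrightarrow> algebra_iso (f \<circ> g)"
  by (simp add: algebra_iso_def clinear_def bij_comp)

lemma isometric_comp: "isometric f \<Longrightarrow> isometric g \<Longrightarrow> isometric (f \<circ> g)"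
  by (simp add: isometric_def)

text \<open>For self-adjoint \<open>a\<close> both \<open>\<theta>(a \<otimes> 1)\<close> and its square, the image of \<open>a\<^sup>2 \<otimes> 1\<close>, are Hermitian.\<close>

lemma iso_dichotomy:
  fixes \<theta> :: "('a::unital_cstar_algebra, 'b::unital_cstar_algebra) ptensor \<Rightarrow>
    ('c::unital_cstar_algebra, 'd::unital_cstar_algebra) ptensor"
  assumes \<theta>: "algebra_iso \<theta>" "isometric \<theta>" and one: "(1::'c) \<noteq> 0" "(1::'d) \<noteq> 0"
  shows "range (\<lambda>a. \<theta> (a \<otimes>\<^sub>\<gamma> 1)) \<subseteq> range (\<lambda>c. c \<otimes>\<^sub>\<gamma> 1) \<or>
      range (\<lambda>a. \<theta> (a \<otimes>\<^sub>\<gamma> 1)) \<subseteq> range (\<lambda>d. 1 \<otimes>\<^sub>\<gamma> d)" (is ?left)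
    and "range (\<lambda>b. \<theta> (1 \<otimes>\<^sub>\<gamma> b)) \<subseteq> range (\<lambda>c. c \<otimes>\<^sub>\<gamma> 1) \<or>
      range (\<lambda>b. \<theta> (1 \<otimes>\<^sub>\<gamma> b)) \<subseteq> range (\<lambda>d. 1 \<otimes>\<^sub>\<gamma> d)" (is ?right)
proof -
  have lin: "clinear \<theta>" and mult: "\<theta> (z * w) = \<theta> z * \<theta> w" for z w
    using \<theta>(1) by (auto simp: algebra_iso_def)
  have norm: "norm (\<theta> z) \<le> norm z" for z using \<theta>(2) norm_isometric[OF lin] by simp
  have state: "state (\<lambda>z. F (\<theta> z))" if "state F" for F
    by (rule state_compose[OF that lin norm algebra_iso_one[OF \<theta>(1)]])
  have herm_left: "hermitian (\<theta> (a \<otimes>\<^sub>\<gamma> 1))" if "star a = a" for a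
    using state_self_adjoint[OF state_marginal(1)[OF state] that] by (simp add: hermitian_def)
  have herm_right: "hermitian (\<theta> (1 \<otimes>\<^sub>\<gamma> b))" if "star b = b" for b
    using state_self_adjoint[OF state_marginal(2)[OF state] that] by (simp add: hermitian_def)
  show ?left
  proof (rule self_adjoint_dichotomy)
    show "clinear (\<lambda>a. \<theta> (a \<otimes>\<^sub>\<gamma> 1))"
      by (simp add: clinear_def clinear_add[OF lin] clinear_scaleC[OF lin]
          clinear_add[OF ptensor_elem_clinear_left] clinear_scaleC[OF ptensor_elem_clinear_left])
    fix a :: 'a assume a: "star a = a"
    have "\<theta> (a \<otimes>\<^sub>\<gamma> 1) * \<theta> (a \<otimes>\<^sub>\<gamma> 1) = \<theta> ((a * a) \<otimes>\<^sub>\<gamma> 1)"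
      by (simp add: ptensor_elem_mult flip: mult)
    moreover have "star (a * a) = a * a" by (simp add: star_mult a)
    ultimately show "\<theta> (a \<otimes>\<^sub>\<gamma> 1) \<in> range (\<lambda>c. c \<otimes>\<^sub>\<gamma> 1) \<union> range (\<lambda>d. 1 \<otimes>\<^sub>\<gamma> d)"
      using herm_left[OF a] herm_left[of "a * a"] by (intro hermitian_with_square one) simp_all
  qed
  show ?right
  proof (rule self_adjoint_dichotomy)
    show "clinear (\<lambda>b. \<theta> (1 \<otimes>\<^sub>\<gamma> b))"
      by (simp add: clinear_def clinear_add[OF lin] clinear_scaleC[OF lin]
          clinear_add[OF ptensor_elem_clinear_right] clinear_scaleC[OF ptensor_elem_clinear_right])
    fix b :: 'b assume b: "star b = b"
    have "\<theta> (1 \<otimes>\<^sub>\<gamma> b) * \<theta> (1 \<otimes>\<^sub>\<gamma> b) = \<theta> (1 \<otimes>\<^sub>\<gamma> (b * b))"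
      by (simp add: ptensor_elem_mult flip: mult)
    moreover have "star (b * b) = b * b" by (simp add: star_mult b)
    ultimately show "\<theta> (1 \<otimes>\<^sub>\<gamma> b) \<in> range (\<lambda>c. c \<otimes>\<^sub>\<gamma> 1) \<union> range (\<lambda>d. 1 \<otimes>\<^sub>\<gamma> d)"
      using herm_right[OF b] herm_right[of "b * b"] by (intro hermitian_with_square one) simp_all
  qed
qed

text \<open>The factors are the restrictions of \<open>\<theta>\<close> to the legs. They are onto because slicing \<open>\<theta> z\<close> by a state
  \<open>g\<close> gives the image under \<open>\<phi>\<close> of a slice of \<open>z\<close>, namely of that by \<open>g \<circ> \<psi>\<close>.\<close>

lemma iso_splits:
  fixes \<theta> :: "('a::unital_cstar_algebra, 'b::unital_cstar_algebra) ptensor \<Rightarrow>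
    ('c::unital_cstar_algebra, 'd::unital_cstar_algebra) ptensor"
  assumes \<theta>: "algebra_iso \<theta>" "isometric \<theta>"
    and one: "(1::'a) \<noteq> 0" "(1::'b) \<noteq> 0" "(1::'c) \<noteq> 0" "(1::'d) \<noteq> 0"
    and left: "range (\<lambda>a. \<theta> (a \<otimes>\<^sub>\<gamma> 1)) \<subseteq> range (\<lambda>c. c \<otimes>\<^sub>\<gamma> 1)"
    and right: "range (\<lambda>b. \<theta> (1 \<otimes>\<^sub>\<gamma> b)) \<subseteq> range (\<lambda>d. 1 \<otimes>\<^sub>\<gamma> d)"
  obtains \<phi> \<psi> where "algebra_iso \<phi>" "isometric \<phi>" "algebra_iso \<psi>" "isometric \<psi>" "\<theta> = ptensor_map \<phi> \<psi>"
proof -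
  have bij: "bij \<theta>" and lin: "clinear \<theta>" and mult: "\<theta> (z * w) = \<theta> z * \<theta> w" for z w
    using \<theta>(1) by (auto simp: algebra_iso_def)
  have norm: "norm (\<theta> z) = norm z" for z using \<theta>(2) norm_isometric[OF lin] by simp
  have b\<theta>: "bounded_clinear \<theta>" by (rule bounded_clinear_isometric[OF lin \<theta>(2)])
  obtain \<phi> where \<phi>: "\<And>a. \<theta> (a \<otimes>\<^sub>\<gamma> 1) = \<phi> a \<otimes>\<^sub>\<gamma> 1"
  proof -
    have "\<forall>a. \<exists>x. \<theta> (a \<otimes>\<^sub>\<gamma> 1) = x \<otimes>\<^sub>\<gamma> 1" using left by blast
    from choice[OF this] show ?thesis using that by blast
  qed
  obtain \<psi> where \<psi>: "\<And>b. \<theta> (1 \<otimes>\<^sub>\<gamma> b) = 1 \<otimes>\<^sub>\<gamma> \<psi> b"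
  proof -
    have "\<forall>b. \<exists>x. \<theta> (1 \<otimes>\<^sub>\<gamma> b) = 1 \<otimes>\<^sub>\<gamma> x" using right by blast
    from choice[OF this] show ?thesis using that by blast
  qed
  have elem: "\<theta> (a \<otimes>\<^sub>\<gamma> b) = \<phi> a \<otimes>\<^sub>\<gamma> \<psi> b" for a b
    using mult[of "a \<otimes>\<^sub>\<gamma> 1" "1 \<otimes>\<^sub>\<gamma> b"] by (simp add: ptensor_elem_mult \<phi> \<psi>)
  have inj: "a = a'" if "a \<otimes>\<^sub>\<gamma> (1::'d) = a' \<otimes>\<^sub>\<gamma> 1" for a a' :: 'c
    using that by (simp add: elem_one_inject one)
  have inj': "b = b'" if "(1::'c) \<otimes>\<^sub>\<gamma> b = 1 \<otimes>\<^sub>\<gamma> b'" for b b' :: 'd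
    using that by (simp add: one_elem_inject one)
  have lin\<phi>: "clinear \<phi>"
    unfolding clinear_def
    by (intro conjI allI inj)
       (simp_all add: clinear_add[OF ptensor_elem_clinear_left] clinear_scaleC[OF ptensor_elem_clinear_left]
          clinear_add[OF lin] clinear_scaleC[OF lin] flip: \<phi>)
  have lin\<psi>: "clinear \<psi>"
    unfolding clinear_def
    by (intro conjI allI inj')
       (simp_all add: clinear_add[OF ptensor_elem_clinear_right] clinear_scaleC[OF ptensor_elem_clinear_right]
          clinear_add[OF lin] clinear_scaleC[OF lin] flip: \<psi>)
  have mult\<phi>: "\<phi> (x * y) = \<phi> x * \<phi> y" for x y
    using mult[of "x \<otimes>\<^sub>\<gamma> 1" "y \<otimes>\<^sub>\<gamma> 1"] by (intro inj) (simp add: ptensor_elem_mult \<phi>)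
  have mult\<psi>: "\<psi> (x * y) = \<psi> x * \<psi> y" for x y
    using mult[of "1 \<otimes>\<^sub>\<gamma> x" "1 \<otimes>\<^sub>\<gamma> y"] by (intro inj') (simp add: ptensor_elem_mult \<psi>)
  have iso\<phi>: "isometric \<phi>"
    unfolding norm_isometric[OF lin\<phi>]
    using norm norm_elem_one[OF one(2)] norm_elem_one[OF one(4)] \<phi> by metis
  have iso\<psi>: "isometric \<psi>"
    unfolding norm_isometric[OF lin\<psi>]
    using norm norm_one_elem[OF one(1)] norm_one_elem[OF one(3)] \<psi> by metis
  note b\<phi> = bounded_clinear_isometric[OF lin\<phi> iso\<phi>] and b\<psi> = bounded_clinear_isometric[OF lin\<psi> iso\<psi>]
  have "surj \<phi>"
    unfolding surj_def
  proof
    fix c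
    obtain g :: "'d \<Rightarrow> complex" where g: "state g" by (rule states_exist[OF one(4)])
    note bg = bounded_clinear_state[OF g]
    have bg\<psi>: "bounded_clinear (\<lambda>b. g (\<psi> b))" by (rule bounded_clinear_compose[OF bg b\<psi>])
    obtain z where z: "c \<otimes>\<^sub>\<gamma> 1 = \<theta> z" using bij by (metis bij_pointE)
    have "slice_right g (\<theta> z) = \<phi> (slice_right (\<lambda>b. g (\<psi> b)) z)"
      by (rule ptensor_eqI[OF bounded_clinear_compose[OF bounded_clinear_slice_right[OF bg] b\<theta>]
            bounded_clinear_compose[OF b\<phi> bounded_clinear_slice_right[OF bg\<psi>]]])
         (simp add: elem slice_right_elem bg bg\<psi> clinear_scaleC[OF lin\<phi>])
    moreover have "slice_right g (\<theta> z) = c"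
      by (simp add: slice_right_elem bg stateD(3)[OF g] scaleC_one flip: z)
    ultimately show "\<exists>a. c = \<phi> a" by metis
  qed
  then have "algebra_iso \<phi>"
    by (simp add: algebra_iso_def bij_def inj_isometric iso\<phi> lin\<phi> mult\<phi>)
  moreover have "surj \<psi>"
    unfolding surj_def
  proof
    fix d
    obtain f :: "'c \<Rightarrow> complex" where f: "state f" by (rule states_exist[OF one(3)])
    note bf = bounded_clinear_state[OF f]
    have bf\<phi>: "bounded_clinear (\<lambda>a. f (\<phi> a))" by (rule bounded_clinear_compose[OF bf b\<phi>])
    obtain z where z: "1 \<otimes>\<^sub>\<gamma> d = \<theta> z" using bij by (metis bij_pointE)
    have "slice_left f (\<theta> z) = \<psi> (slice_left (\<lambda>a. f (\<phi> a)) z)"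
      by (rule ptensor_eqI[OF bounded_clinear_compose[OF bounded_clinear_slice_left[OF bf] b\<theta>]
            bounded_clinear_compose[OF b\<psi> bounded_clinear_slice_left[OF bf\<phi>]]])
         (simp add: elem slice_left_elem bf bf\<phi> clinear_scaleC[OF lin\<psi>])
    moreover have "slice_left f (\<theta> z) = d"
      by (simp add: slice_left_elem bf stateD(3)[OF f] scaleC_one flip: z)
    ultimately show "\<exists>b. d = \<psi> b" by metis
  qed
  then have "algebra_iso \<psi>"
    by (simp add: algebra_iso_def bij_def inj_isometric iso\<psi> lin\<psi> mult\<psi>)
  moreover have "\<theta> = ptensor_map \<phi> \<psi>"
  proof
    fix z
    show "\<theta> z = ptensor_map \<phi> \<psi> z"
      by (rule ptensor_eqI[OF b\<theta> bounded_clinear_ptensor_map[OF lin\<phi> iso\<phi> lin\<psi> iso\<psi>]])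
         (simp add: elem ptensor_map_elem[OF lin\<phi> iso\<phi> lin\<psi> iso\<psi>])
  qed
  ultimately show ?thesis using iso\<phi> iso\<psi> by (intro that)
qed

text \<open>Products of images of the legs stay in the left leg, so by continuity the range of \<open>\<theta>\<close> does. Since
  \<open>\<theta>\<close> is onto, every \<open>1 \<otimes> d\<close> is some \<open>c \<otimes> 1\<close>.\<close>

lemma left_leg_onto:
  fixes \<theta> :: "('a::unital_cstar_algebra, 'b::unital_cstar_algebra) ptensor \<Rightarrow>
    ('c::unital_cstar_algebra, 'd::unital_cstar_algebra) ptensor"
  assumes \<theta>: "algebra_iso \<theta>" "isometric \<theta>" and one: "(1::'c) \<noteq> 0" "(1::'d) \<noteq> 0"
    and left: "range (\<lambda>a. \<theta> (a \<otimes>\<^sub>\<gamma> 1)) \<subseteq> range (\<lambda>c. c \<otimes>\<^sub>\<gamma> 1)"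
    and right: "range (\<lambda>b. \<theta> (1 \<otimes>\<^sub>\<gamma> b)) \<subseteq> range (\<lambda>c. c \<otimes>\<^sub>\<gamma> 1)"
  shows "\<exists>\<alpha>. d = \<alpha> *\<^sub>C (1::'d)"
proof -
  have bij: "bij \<theta>" and lin: "clinear \<theta>" and mult: "\<theta> (z * w) = \<theta> z * \<theta> w" for z w
    using \<theta>(1) by (auto simp: algebra_iso_def)
  have b\<theta>: "bounded_clinear \<theta>" by (rule bounded_clinear_isometric[OF lin \<theta>(2)])
  obtain f :: "'c \<Rightarrow> complex" where f: "state f" by (rule states_exist[OF one(1)])
  obtain g :: "'d \<Rightarrow> complex" where g: "state g" by (rule states_exist[OF one(2)])
  note bf = bounded_clinear_state[OF f] and bg = bounded_clinear_state[OF g]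
  obtain z where z: "1 \<otimes>\<^sub>\<gamma> d = \<theta> z" using bij by (metis bij_pointE)
  have "slice_right g (\<theta> z) \<otimes>\<^sub>\<gamma> 1 = \<theta> z"
  proof (rule ptensor_eqI[where f = "\<lambda>z. slice_right g (\<theta> z) \<otimes>\<^sub>\<gamma> 1"])
    show "bounded_clinear (\<lambda>z. slice_right g (\<theta> z) \<otimes>\<^sub>\<gamma> (1::'d))"
      by (intro bounded_clinear_compose[OF bounded_clinear_elem_left]
          bounded_clinear_compose[OF bounded_clinear_slice_right[OF bg] b\<theta>])
    fix a b
    obtain c c' where "\<theta> (a \<otimes>\<^sub>\<gamma> 1) = c \<otimes>\<^sub>\<gamma> 1" "\<theta> (1 \<otimes>\<^sub>\<gamma> b) = c' \<otimes>\<^sub>\<gamma> 1"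
      using left right by blast
    then have "\<theta> (a \<otimes>\<^sub>\<gamma> b) = (c * c') \<otimes>\<^sub>\<gamma> 1"
      using mult[of "a \<otimes>\<^sub>\<gamma> 1" "1 \<otimes>\<^sub>\<gamma> b"] by (simp add: ptensor_elem_mult)
    then show "slice_right g (\<theta> (a \<otimes>\<^sub>\<gamma> b)) \<otimes>\<^sub>\<gamma> 1 = \<theta> (a \<otimes>\<^sub>\<gamma> b)"
      by (simp add: slice_right_elem bg stateD(3)[OF g] scaleC_one)
  qed (rule b\<theta>)
  then have "slice_left f (slice_right g (\<theta> z) \<otimes>\<^sub>\<gamma> 1) = slice_left f (1 \<otimes>\<^sub>\<gamma> d)" by (simp add: z)
  then have "d = f (slice_right g (\<theta> z)) *\<^sub>C 1"
    by (simp add: slice_left_elem bf stateD(3)[OF f] scaleC_one)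
  then show ?thesis by blast
qed

text \<open>Each leg goes to the left or to the right leg. Of the four cases, the two in which both legs
  go to the same one occur only if one of the algebras consists of scalars, and they are then instances
  of the case in which the legs are preserved.\<close>

lemma isometric_automorphism_splits:
  fixes \<theta> :: "('a::unital_cstar_algebra, 'b::unital_cstar_algebra) ptensor \<Rightarrow> ('a, 'b) ptensor"
  assumes \<theta>: "algebra_iso \<theta>" "isometric \<theta>" and one: "(1::'a) \<noteq> 0" "(1::'b) \<noteq> 0"
  shows "(\<exists>(\<phi> :: 'a \<Rightarrow> 'a) (\<psi> :: 'b \<Rightarrow> 'b). algebra_iso \<phi> \<and> isometric \<phi> \<and> algebra_iso \<psi> \<and> isometric \<psi> \<and>
        \<theta> = ptensor_map \<phi> \<psi>) \<or>
      (\<exists>(\<mu> :: 'b \<Rightarrow> 'a) (\<rho> :: 'a \<Rightarrow> 'b). algebra_iso \<mu> \<and> isometric \<mu> \<and> algebra_iso \<rho> \<and> isometric \<rho> \<and>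
        \<theta> = ptensor_map \<mu> \<rho> \<circ> ptensor_flip)"
    (is "?direct \<or> ?flipped")
proof -
  let ?A = "range (\<lambda>a::'a. a \<otimes>\<^sub>\<gamma> (1::'b))" and ?B = "range (\<lambda>b::'b. (1::'a) \<otimes>\<^sub>\<gamma> b)"
  let ?left = "range (\<lambda>a. \<theta> (a \<otimes>\<^sub>\<gamma> 1))" and ?right = "range (\<lambda>b. \<theta> (1 \<otimes>\<^sub>\<gamma> b))"
  have lin: "clinear \<theta>" using \<theta>(1) by (simp add: algebra_iso_def)
  have scalar: "\<theta> (\<alpha> *\<^sub>C 1) = \<alpha> *\<^sub>C 1" for \<alpha>
    by (simp add: clinear_scaleC[OF lin] algebra_iso_one[OF \<theta>(1)])
  have scalars: "\<alpha> *\<^sub>C 1 \<in> ?A" "\<alpha> *\<^sub>C 1 \<in> ?B" for \<alpha>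
    by (simp_all add: one_ptensor_def flip: clinear_scaleC[OF ptensor_elem_clinear_left])
       (simp add: clinear_scaleC[OF ptensor_elem_clinear_left] flip: clinear_scaleC[OF ptensor_elem_clinear_right])
  let ?\<theta>' = "ptensor_flip \<circ> \<theta>"
  have \<theta>': "algebra_iso ?\<theta>'" "isometric ?\<theta>'"
    by (intro algebra_iso_comp isometric_comp ptensor_flip_iso \<theta>)+
  have direct: ?direct if "?left \<subseteq> ?A" "?right \<subseteq> ?B"
    using iso_splits[OF \<theta> one one that] by metis
  consider "?left \<subseteq> ?A" "?right \<subseteq> ?B" | "?left \<subseteq> ?B" "?right \<subseteq> ?A"
    | "?left \<subseteq> ?A" "?right \<subseteq> ?A" | "?left \<subseteq> ?B" "?right \<subseteq> ?B"
    using iso_dichotomy[OF \<theta> one] by blast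
  then show ?thesis
  proof cases
    case 1
    then show ?thesis using direct by blast
  next
    case 2
    have "ptensor_flip u \<in> range (\<lambda>c::'b. c \<otimes>\<^sub>\<gamma> (1::'a))" if "u \<in> ?B" for u :: "('a, 'b) ptensor"
      using that by (auto simp: ptensor_flip(3))
    moreover have "ptensor_flip u \<in> range (\<lambda>d::'a. (1::'b) \<otimes>\<^sub>\<gamma> d)" if "u \<in> ?A" for u :: "('a, 'b) ptensor"
      using that by (auto simp: ptensor_flip(3))
    ultimately have "range (\<lambda>a. ?\<theta>' (a \<otimes>\<^sub>\<gamma> 1)) \<subseteq> range (\<lambda>c::'b. c \<otimes>\<^sub>\<gamma> (1::'a))"
      "range (\<lambda>b. ?\<theta>' (1 \<otimes>\<^sub>\<gamma> b)) \<subseteq> range (\<lambda>d::'a. (1::'b) \<otimes>\<^sub>\<gamma> d)"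
      using 2 unfolding comp_def by blast+
    from iso_splits[OF \<theta>' one one(2,1) this]
    obtain \<rho> :: "'a \<Rightarrow> 'b" and \<mu> :: "'b \<Rightarrow> 'a" where iso: "algebra_iso \<rho>" "isometric \<rho>" "algebra_iso \<mu>" "isometric \<mu>"
      and eq: "?\<theta>' = ptensor_map \<rho> \<mu>" by blast
    have lins: "clinear \<rho>" "clinear \<mu>" using iso by (auto simp: algebra_iso_def)
    note m = isometric_ptensor_map[OF lins(1) iso(2) lins(2) iso(4)]
      and m' = isometric_ptensor_map[OF lins(2) iso(4) lins(1) iso(2)]
    have "\<theta> z = ptensor_map \<mu> \<rho> (ptensor_flip z)" for z
    proof -
      have "\<theta> z = ptensor_flip (ptensor_map \<rho> \<mu> z)"
        using fun_cong[OF eq, of z] by (metis comp_apply ptensor_flip_flip)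
      also have "\<dots> = ptensor_map \<mu> \<rho> (ptensor_flip z)"
        by (rule ptensor_eqI[OF bounded_clinear_compose[OF bounded_clinear_ptensor_flip m(2)]
              bounded_clinear_compose[OF m'(2) bounded_clinear_ptensor_flip]])
           (simp add: m m' ptensor_flip(3))
      finally show ?thesis .
    qed
    with iso have ?flipped by (auto simp: fun_eq_iff intro!: exI[of _ \<mu>] exI[of _ \<rho>])
    then show ?thesis by blast
  next
    case 3
    \<comment> \<open>All elements of the right algebra are scalars, and scalars lie in both legs.\<close>
    have "?right \<subseteq> ?B"
    proof
      fix u assume "u \<in> ?right"
      then obtain b where u: "u = \<theta> (1 \<otimes>\<^sub>\<gamma> b)" by blast
      obtain \<beta> where "b = \<beta> *\<^sub>C 1" using left_leg_onto[OF \<theta> one 3] by blast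
      then have "u = \<beta> *\<^sub>C 1"
        by (simp add: u clinear_scaleC[OF ptensor_elem_clinear_right] scalar flip: one_ptensor_def)
      then show "u \<in> ?B" using scalars by simp
    qed
    with 3 direct show ?thesis by blast
  next
    case 4
    have "ptensor_flip u \<in> range (\<lambda>c::'b. c \<otimes>\<^sub>\<gamma> (1::'a))" if "u \<in> ?B" for u :: "('a, 'b) ptensor"
      using that by (auto simp: ptensor_flip(3))
    then have "range (\<lambda>a. ?\<theta>' (a \<otimes>\<^sub>\<gamma> 1)) \<subseteq> range (\<lambda>c::'b. c \<otimes>\<^sub>\<gamma> (1::'a))"
      "range (\<lambda>b. ?\<theta>' (1 \<otimes>\<^sub>\<gamma> b)) \<subseteq> range (\<lambda>c::'b. c \<otimes>\<^sub>\<gamma> (1::'a))"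
      using 4 unfolding comp_def by blast+
    note onto = left_leg_onto[OF \<theta>' one(2,1) this]
    \<comment> \<open>All elements of the left algebra are scalars, by the previous case for the flipped map.\<close>
    have "?left \<subseteq> ?A"
    proof
      fix u assume "u \<in> ?left"
      then obtain a where u: "u = \<theta> (a \<otimes>\<^sub>\<gamma> 1)" by blast
      obtain \<alpha> where "a = \<alpha> *\<^sub>C 1" using onto by blast
      then have "u = \<alpha> *\<^sub>C 1"
        by (simp add: u clinear_scaleC[OF ptensor_elem_clinear_left] scalar flip: one_ptensor_def)
      then show "u \<in> ?A" using scalars by simp
    qed
    with 4 direct show ?thesis by blast
  qed
qed

lemma star_preserving_if_on_elems:
  fixes f :: "('a::complex_normed_star_algebra, 'b::complex_normed_star_algebra) ptensor \<Rightarrow> 'c::complex_normed_star_algebra"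
  assumes f: "bounded_clinear f" and star: "\<And>x y. f (star (x \<otimes>\<^sub>\<gamma> y)) = star (f (x \<otimes>\<^sub>\<gamma> y))"
  shows "f (star z) = star (f z)"
proof -
  obtain K where K: "\<And>z. norm (f z) \<le> K * norm z" using f by (auto simp: bounded_clinear_def)
  have "star (f (star z)) = f z"
  proof (rule ptensor_eqI[OF bounded_clinearI f])
    show "clinear (\<lambda>z. star (f (star z)))"
      using bounded_clinear_clinear[OF f] by (simp add: clinear_def star_add star_scaleC)
    show "norm (star (f (star z))) \<le> K * norm z" for z
      using K[of "star z"] by (simp add: norm_star)
    show "star (f (star (x \<otimes>\<^sub>\<gamma> y))) = f (x \<otimes>\<^sub>\<gamma> y)" for x y
      by (simp add: star star_star)
  qed
  then show ?thesis by (metis star_star)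
qed

lemma star_iso_ptensor_map:
  fixes \<phi> :: "'a::unital_cstar_algebra \<Rightarrow> 'c::unital_cstar_algebra"
    and \<psi> :: "'b::unital_cstar_algebra \<Rightarrow> 'd::unital_cstar_algebra"
  assumes "star_iso \<phi>" "star_iso \<psi>"
  shows "star_iso (ptensor_map \<phi> \<psi>)"
proof -
  have iso: "algebra_iso \<phi>" "isometric \<phi>" "algebra_iso \<psi>" "isometric \<psi>"
    using assms star_iso_iff_isometric by blast+
  then have lin: "clinear \<phi>" "clinear \<psi>" by (auto simp: algebra_iso_def)
  note m = isometric_ptensor_map[OF lin(1) iso(2) lin(2) iso(4)]
  have "ptensor_map \<phi> \<psi> (star z) = star (ptensor_map \<phi> \<psi> z)" for z
    by (rule star_preserving_if_on_elems[OF m(2)])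
       (use assms in \<open>simp add: m star_ptensor_elem star_iso_def\<close>)
  then show ?thesis using ptensor_map_iso(1)[OF iso] by (simp add: star_iso_def)
qed

lemma star_iso_ptensor_flip:
  "star_iso (ptensor_flip :: ('a::complex_normed_star_algebra, 'b::complex_normed_star_algebra) ptensor \<Rightarrow> _)"
  unfolding star_iso_def
  using star_preserving_if_on_elems[OF bounded_clinear_ptensor_flip] ptensor_flip_iso(1)
  by (auto simp: star_ptensor_elem ptensor_flip(3))

lemma star_iso_comp: "star_iso f \<Longrightarrow> star_iso g \<Longrightarrow> star_iso (f \<circ> g)"
  by (simp add: star_iso_def algebra_iso_comp)

lemma algebra_iso_id: "algebra_iso (\<lambda>x. x)"
  by (simp add: algebra_iso_def clinear_def bij_def)

lemma isometric_id: "isometric (\<lambda>x. x)"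
  by (simp add: isometric_def)

theorem theorem2p4:
  fixes \<theta> :: "('a::unital_cstar_algebra, 'b::unital_cstar_algebra) ptensor \<Rightarrow> ('a, 'b) ptensor"
  shows "(algebra_iso \<theta> \<and> isometric \<theta> \<longleftrightarrow>
      (\<exists>(\<phi> :: 'a \<Rightarrow> 'a) (\<psi> :: 'b \<Rightarrow> 'b). algebra_iso \<phi> \<and> isometric \<phi> \<and> algebra_iso \<psi> \<and> isometric \<psi> \<and>
        \<theta> = ptensor_map \<phi> \<psi>) \<or>
      (\<exists>(\<mu> :: 'b \<Rightarrow> 'a) (\<rho> :: 'a \<Rightarrow> 'b). algebra_iso \<mu> \<and> isometric \<mu> \<and> algebra_iso \<rho> \<and> isometric \<rho> \<and>
        \<theta> = ptensor_map \<mu> \<rho> \<circ> ptensor_flip)) \<and>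
    (star_iso \<theta> \<and> isometric \<theta> \<longleftrightarrow>
      (\<exists>(\<phi> :: 'a \<Rightarrow> 'a) (\<psi> :: 'b \<Rightarrow> 'b). star_iso \<phi> \<and> star_iso \<psi> \<and> \<theta> = ptensor_map \<phi> \<psi>) \<or>
      (\<exists>(\<mu> :: 'b \<Rightarrow> 'a) (\<rho> :: 'a \<Rightarrow> 'b). star_iso \<mu> \<and> star_iso \<rho> \<and>
        \<theta> = ptensor_map \<mu> \<rho> \<circ> ptensor_flip))"
    (is "(?iso \<longleftrightarrow> ?direct \<or> ?flipped) \<and> (?star_iso \<longleftrightarrow> ?star_direct \<or> ?star_flipped)")
proof -
  have eq: "?direct \<longleftrightarrow> ?star_direct" "?flipped \<longleftrightarrow> ?star_flipped"
    by (simp_all add: star_iso_iff_isometric conj_assoc)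
  have split: "?direct \<or> ?flipped" if ?iso
  \<comment> \<open>If one of the algebras is zero, so is the tensor product, and identities serve as factors.
    Only non-zero algebras have states.\<close>
  proof (cases "(1::'a) = 0 \<or> (1::'b) = 0")
    case True
    then have "(1 :: ('a, 'b) ptensor) = 0"
      by (auto simp: one_ptensor_def clinear_zero[OF ptensor_elem_clinear_left]
          clinear_zero[OF ptensor_elem_clinear_right])
    then have "\<theta> = ptensor_map (\<lambda>a. a) (\<lambda>b. b)"
      by (metis ext zero_if_one_zero)
    then have ?direct
      by (intro exI[of _ "\<lambda>a. a"] exI[of _ "\<lambda>b. b"])
         (simp add: algebra_iso_id isometric_id)
    then show ?thesis by blast
  next
    case False
    with that isometric_automorphism_splits show ?thesis by blast
  qed
  have iso: ?iso if "?direct \<or> ?flipped"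
    using that
    by (elim disjE exE conjE)
       (simp_all add: ptensor_map_iso ptensor_flip_iso algebra_iso_comp isometric_comp)
  have star: "star_iso \<theta>" if "?star_direct \<or> ?star_flipped"
    using that
    by (elim disjE exE conjE)
       (simp_all add: star_iso_ptensor_map star_iso_ptensor_flip star_iso_comp)
  have part_i: "?iso \<longleftrightarrow> ?direct \<or> ?flipped" using split iso by (rule iffI)
  have "?star_iso \<longleftrightarrow> ?star_direct \<or> ?star_flipped"
  proof
    assume ?star_iso
    then have ?iso by (simp add: star_iso_def)
    from split[OF this] show "?star_direct \<or> ?star_flipped" unfolding eq .
  next
    assume "?star_direct \<or> ?star_flipped"
    with star iso show ?star_iso unfolding eq by (intro conjI; simp only:)
  qed
  with part_i show ?thesis by (rule conjI)
qed

end
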